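(* Let $\alpha\in(0,1]$, let $p:[0,1]\to[0,1]$ and $q=1-p$ be weight functions in $\mathcal H_\alpha[0,1]$, and let $(Z_n)_{n\ge0}$ be the Diaconis–Friedman chain on $[0,1]$ with weights $p,q$, i.e. the Markov chain with transition operator $$Q\varphi(x)=p(x)\int_0^1\varphi(tx)\,\mathrm dt+q(x)\int_0^1\varphi(tx+1-t)\,\mathrm dt$$ for bounded Borel $\varphi:[0,1]\to\mathbb C$ and $x\in[0,1]$. Then one of the following options holds. 1. If $p(0)<1$ and $q(1)<1$, then there exists on $[0,1]$ a unique $Q$-invariant probability measure $\nu_p$. Furthermore, this measure is absolutely continuous with respect to the Lebesgue measure on $[0,1]$, with density $f_p$ given by $$\forall x\in[0,1],\quad f_p(x)=C\exp\Bigl(\int_x^{1/2}\frac{p(y)}{y}\,\mathrm dy+\int_{1/2}^x\frac{q(y)}{1-y}\,\mathrm dy\Bigr),$$ where $C$ is a normalization constant. Moreover, there exist constants $\kappa>0$ and $\rho\in[0,1[$ such that for all $\varphi\in\mathcal H_\alpha[0,1]$, all $x\in[0,1]$ and all $n\ge0$, $|Q^n\varphi(x)-\nu_p(\varphi)|\le\kappa\rho^n\|\varphi\|_\alpha$. 2. If $p(0)=1$ and $q(1)<1$, then the Dirac measure $\delta_0$ is the unique $Q$-invariant probability measure on $[0,1]$, and there exist constants $\kappa>0$ and $\rho\in[0,1[$ such that for all $\varphi\in\mathcal H_\alpha[0,1]$, all $x\in[0,1]$ and all $n\ge0$, $|Q^n\varphi(x)-\varphi(0)|\le\kappa\rho^n\|\varphi\|_\alpha$.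 Similarly, if $p(0)<1$ and $q(1)=1$, then the Dirac measure $\delta_1$ is the unique $Q$-invariant probability measure on $[0,1]$, and there exist constants $\kappa>0$ and $\rho\in[0,1[$ such that for all $\varphi\in\mathcal H_\alpha[0,1]$, all $x\in[0,1]$ and all $n\ge0$, $|Q^n\varphi(x)-\varphi(1)|\le\kappa\rho^n\|\varphi\|_\alpha$. 3. If $p(0)=1$ and $q(1)=1$, then the invariant probability measures of $(Z_n)_{n\ge0}$ are the convex combinations of $\delta_0$ and $\delta_1$. Furthermore, there is a unique function $h\in\mathcal H_\alpha[0,1]$ such that $Qh=h$, $h(0)=0$ and $h(1)=1$, and for any $x\in[0,1]$ the chain $(Z_n)_{n\ge0}$ converges $\mathbb P_x$-a.s. to a random variable $Z_\infty$ with values in $\{0,1\}$, whose law is given by $$\mathbb P_x(Z_\infty=0)=1-h(x)\quad\text{and}\quad\mathbb P_x(Z_\infty=1)=h(x).$$ Moreover, there exist $\kappa>0$ and $\rho\in[0,1[$ such that for all $\varphi\in\mathcal H_\alpha[0,1]$, all $x\in[0,1]$ and all $n\ge0$, $|Q^n\varphi(x)-(1-h(x))\varphi(0)-h(x)\varphi(1)|\le\kappa\rho^n\|\varphi\|_\alpha$.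
   Context: $\mathcal H_\alpha[0,1]$ is the space of $\alpha$-Hölder continuous functions $f:[0,1]\to\mathbb C$, with norm $\|f\|_\alpha=|f|_\infty+m_\alpha(f)$, where $|f|_\infty=\sup|f|$ and $m_\alpha(f)=\sup_{x\neq y}|f(x)-f(y)|/|x-y|^\alpha$. $\mathbb P_x$ is the law of the chain started from $Z_0=x$. A probability measure $\nu$ on $[0,1]$ is $Q$-invariant (invariant for $(Z_n)$) if $\int Q\varphi\,\mathrm d\nu=\int\varphi\,\mathrm d\nu$ for all bounded Borel $\varphi$; $\nu(\varphi)=\int\varphi\,\mathrm d\nu$. The formula for $f_p$ may take the value $+\infty$ at the endpoints $0$ and $1$. *)

theory Defs
  imports "HOL-Probability.Probability"
begin

text \<open>Functions on \<open>[0,1]\<close> are represented by functions on all of \<^typ>\<open>real\<close>; only their values on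
  \<^term>\<open>{0..1::real}\<close> ever matter, and equality of such functions is equality on \<^term>\<open>{0..1::real}\<close>.
  Measures on \<open>[0,1]\<close> live on the Borel space \<open>unit_borel\<close>.\<close>

abbreviation unit_borel :: "real measure" where
  "unit_borel \<equiv> restrict_space borel {0..1}"

abbreviation unit_lebesgue :: "real measure" where
  "unit_lebesgue \<equiv> restrict_space lborel {0..1}"

definition bounded_borel :: "(real \<Rightarrow> 'a::real_normed_vector) set" where
  "bounded_borel = {\<phi> \<in> borel_measurable unit_borel. bounded (\<phi> ` {0..1})}"


section \<open>Hoelder spaces on the unit interval\<close>

definition holder :: "real \<Rightarrow> (real \<Rightarrow> 'a::real_normed_vector) set" where
  "holder \<alpha> = {f. \<exists>C. \<forall>x\<in>{0..1}. \<forall>y\<in>{0..1}. norm (f x - f y) \<le> C * \<bar>x - y\<bar> powr \<alpha>}"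

definition holder_seminorm :: "real \<Rightarrow> (real \<Rightarrow> 'a::real_normed_vector) \<Rightarrow> real" where
  "holder_seminorm \<alpha> f =
     Sup {norm (f x - f y) / \<bar>x - y\<bar> powr \<alpha> | x y. x \<in> {0..1} \<and> y \<in> {0..1} \<and> x \<noteq> y}"

definition holder_norm :: "real \<Rightarrow> (real \<Rightarrow> 'a::real_normed_vector) \<Rightarrow> real" where
  "holder_norm \<alpha> f = (SUP x\<in>{0..1}. norm (f x)) + holder_seminorm \<alpha> f"


section \<open>The Diaconis--Friedman chain\<close>

definition DF_op ::
  "(real \<Rightarrow> real) \<Rightarrow> (real \<Rightarrow> real) \<Rightarrow> (real \<Rightarrow> 'a::{banach,second_countable_topology}) \<Rightarrow> real \<Rightarrow> 'a" where
  "DF_op p q \<phi> x =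
     p x *\<^sub>R (LINT t:{0..1}|lborel. \<phi> (t * x)) + q x *\<^sub>R (LINT t:{0..1}|lborel. \<phi> (t * x + 1 - t))"

definition DF_invariant :: "(real \<Rightarrow> real) \<Rightarrow> (real \<Rightarrow> real) \<Rightarrow> real measure \<Rightarrow> bool" where
  "DF_invariant p q \<nu> \<longleftrightarrow>
     prob_space \<nu> \<and> sets \<nu> = sets unit_borel \<and>
     (\<forall>\<phi>::real \<Rightarrow> complex. \<phi> \<in> bounded_borel \<longrightarrow> (LINT x|\<nu>. DF_op p q \<phi> x) = (LINT x|\<nu>. \<phi> x))"

definition past :: "'w measure \<Rightarrow> (nat \<Rightarrow> 'w \<Rightarrow> real) \<Rightarrow> nat \<Rightarrow> 'w measure" where
  "past M Z n = vimage_algebra (space M) (\<lambda>\<omega>. \<lambda>k\<in>{..n}. Z k \<omega>) (\<Pi>\<^sub>M k\<in>{..n}. unit_borel)"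

text \<open>\<open>Z\<close> is, on the probability space \<open>M\<close>, a Markov chain on \<open>[0,1]\<close> with \<open>Z\<^sub>0 = x\<close> and transition
  operator \<^const>\<open>DF_op\<close>, i.e. \<open>E[\<phi>(Z\<^sub>n\<^sub>+\<^sub>1) | Z\<^sub>0, \<dots>, Z\<^sub>n] = Q\<phi>(Z\<^sub>n)\<close> almost surely. Real test functions
  suffice (the library's conditional expectation is real-valued); the complex case follows by linearity.\<close>

definition DF_chain ::
  "(real \<Rightarrow> real) \<Rightarrow> (real \<Rightarrow> real) \<Rightarrow> real \<Rightarrow> 'w measure \<Rightarrow> (nat \<Rightarrow> 'w \<Rightarrow> real) \<Rightarrow> bool" where
  "DF_chain p q x M Z \<longleftrightarrow>
     prob_space M \<and> (\<forall>n. Z n \<in> measurable M unit_borel) \<and>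
     (AE \<omega> in M. Z 0 \<omega> = x) \<and>
     (\<forall>n. \<forall>\<phi>::real \<Rightarrow> real. \<phi> \<in> bounded_borel \<longrightarrow>
        (AE \<omega> in M. real_cond_exp M (past M Z n) (\<lambda>\<omega>. \<phi> (Z (Suc n) \<omega>)) \<omega> = DF_op p q \<phi> (Z n \<omega>)))"


section \<open>The invariant density\<close>

text \<open>The oriented integral of a nonnegative function, with values in the extended reals.\<close>

definition ext_integral :: "real \<Rightarrow> real \<Rightarrow> (real \<Rightarrow> real) \<Rightarrow> ereal" where
  "ext_integral a b g =
     (if a \<le> b then enn2ereal (\<integral>\<^sup>+y\<in>{a..b}. ennreal (g y) \<partial>lborel)
      else - enn2ereal (\<integral>\<^sup>+y\<in>{b..a}. ennreal (g y) \<partial>lborel))"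

fun ext_exp :: "ereal \<Rightarrow> ennreal" where
  "ext_exp (ereal r) = ennreal (exp r)"
| "ext_exp PInfty = \<infinity>"
| "ext_exp MInfty = 0"

text \<open>The first integral can be infinite only for \<open>x = 0\<close>, the second only for \<open>x = 1\<close>, in both cases
  with value \<open>+\<infinity>\<close>, so the sum is never of the form \<open>\<infinity> - \<infinity>\<close>.\<close>

definition DF_density :: "(real \<Rightarrow> real) \<Rightarrow> (real \<Rightarrow> real) \<Rightarrow> real \<Rightarrow> real \<Rightarrow> ennreal" where
  "DF_density p q C x =
     ennreal C * ext_exp (ext_integral x (1/2) (\<lambda>y. p y / y) + ext_integral (1/2) x (\<lambda>y. q y / (1 - y)))"

end

theory Submission
  imports Defs
begin

text \<open>The operator \<open>Q\<close> is compared with a Lyapunov function or a minorizing measure.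

  If no endpoint is absorbing, two steps of the chain charge a fixed interval uniformly in the starting
  point (Doeblin's condition), so the oscillation of \<open>Q\<^sup>n \<phi>\<close> decays geometrically. The density \<open>f\<close> solves
  \<open>f' = (q / (1 - x) - p / x) f\<close>; the dual operator applied to \<open>f\<close> is at most \<open>f\<close> and has the same mass,
  hence equals \<open>f\<close>.

  If \<open>0\<close> is absorbing, \<open>q(x) = O(x\<^sup>\<alpha>)\<close>, and \<open>W(x) = min 1 (L x\<^sup>\<alpha>)\<close> with \<open>L\<close> large satisfies
  \<open>Q\<^sup>2 W \<le> r W\<close> with \<open>r < 1\<close>. As \<open>\<bar>\<phi> - \<phi>(0)\<bar> \<le> m\<^sub>\<alpha>(\<phi>) W\<close>, the whole claim follows. With two absorbing
  endpoints the minimum of both such functions dominates, up to a constant, every Hoelder function vanishing at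
  both endpoints; in particular \<open>Q\<^sup>n id\<close> is a geometric Cauchy sequence, and its limit is \<open>h\<close>. Along the chain the
  second moments of the increments decay geometrically, so the increments are almost surely summable, and
  \<open>E Z\<^sub>n = Q\<^sup>n id (x)\<close> gives the law of the limit.\<close>

section \<open>Bounded Borel functions and the transition operator\<close>

text \<open>The obstacle is that the weights may vanish inside the interval: from a point with q = 0
  the chain can only go down, from one with p = 0 only up, so one step need not charge a common
  interval from all starting points. But whatever the weights are, a step ends within d of 0 or of 1
  with probability at least d, since t \<le> d suffices in both moves. Near the endpoints the
  hypotheses on p(0) and q(1) control the weights, and a second step does the rest. This is why most
  contractions concern \<open>Q\<close> applied twice. The order \<alpha> in \<open>W\<close> has
  two sources: Hoelder test functions centred at an absorbing point vanish there to this order, and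
  the probability of escaping from that point is of the same order. For the density, the limits of x
  f(x) at 0 and of (1 - x) f(x) at 1 are not computed. Integrating the derivative identities over
  compact subintervals leaves only inequalities, and the total mass turns them into
  equality.\<close>

lemma prob_space_unit_lebesgue: "prob_space unit_lebesgue"
  by (rule prob_spaceI) (simp add: emeasure_restrict_space space_restrict_space)

text \<open>Over the probability space \<open>unit_lebesgue\<close> bounded functions are integrable
  and constants integrate to themselves, so the proof works with this form of
  \<open>Q\<close>.\<close>

lemma DF_op_eq:
  "DF_op p q \<phi> x =
     p x *\<^sub>R (LINT t|unit_lebesgue. \<phi> (t * x)) + q x *\<^sub>R (LINT t|unit_lebesgue. \<phi> (t * x + 1 - t))"
  by (simp add: DF_op_def set_lebesgue_integral_def integral_restrict_space)

lemma down_mem: "t \<in> {0..1} \<Longrightarrow> x \<in> {0..1} \<Longrightarrow> t * x \<in> {0..1}" for t x :: real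
  by (auto simp: mult_le_one)

lemma up_mem: "t \<in> {0..1} \<Longrightarrow> x \<in> {0..1} \<Longrightarrow> t * x + 1 - t \<in> {0..1}" for t x :: real
proof -
  assume a: "t \<in> {0..1}" "x \<in> {0..1}"
  then have "0 \<le> t * x" "0 \<le> t * (1 - x)" by auto
  then show ?thesis using a by (auto simp: algebra_simps)
qed

lemma bounded_borelI:
  assumes "\<phi> \<in> borel_measurable unit_borel" "\<And>x. x \<in> {0..1} \<Longrightarrow> norm (\<phi> x) \<le> B"
  shows "\<phi> \<in> bounded_borel"
  using assms unfolding bounded_borel_def by (auto intro!: boundedI[where B=B])

lemma bounded_borelD: "\<phi> \<in> bounded_borel \<Longrightarrow> \<phi> \<in> borel_measurable unit_borel"
  by (simp add: bounded_borel_def)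

lemma bounded_borelE:
  assumes "\<phi> \<in> bounded_borel"
  obtains B where "0 \<le> B" "\<And>x. x \<in> {0..1} \<Longrightarrow> norm (\<phi> x) \<le> B"
proof -
  obtain B where B: "\<And>x. x \<in> {0..1} \<Longrightarrow> norm (\<phi> x) \<le> B"
    using assms by (force simp: bounded_borel_def bounded_iff)
  moreover have "0 \<le> B" using B[of 0] order_trans[OF norm_ge_zero] by simp
  ultimately show thesis using that by blast
qed

lemma bounded_borel_continuous:
  assumes "continuous_on {0..1} \<phi>"
  shows "\<phi> \<in> bounded_borel"
  unfolding bounded_borel_def
  using assms compact_imp_bounded[OF compact_continuous_image[OF assms]]
  by (auto intro: borel_measurable_continuous_on_restrict)

lemma bounded_borel_const [simp]: "(\<lambda>x. c) \<in> bounded_borel"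
  by (rule bounded_borel_continuous) auto

lemma bounded_borel_add:
  fixes f g :: "real \<Rightarrow> 'a::{banach,second_countable_topology}"
  assumes "f \<in> bounded_borel" "g \<in> bounded_borel"
  shows "(\<lambda>x. f x + g x) \<in> bounded_borel"
proof -
  obtain B C where "\<And>x. x \<in> {0..1} \<Longrightarrow> norm (f x) \<le> B" "\<And>x. x \<in> {0..1} \<Longrightarrow> norm (g x) \<le> C"
    using assms by (metis bounded_borelE)
  then show ?thesis using assms[THEN bounded_borelD]
    by (intro bounded_borelI[where B="B + C"] borel_measurable_add) (auto intro: norm_triangle_mono)
qed

lemma bounded_borel_scaleR:
  fixes g :: "real \<Rightarrow> 'a::{banach,second_countable_topology}"
  assumes "f \<in> bounded_borel" "g \<in> bounded_borel"
  shows "(\<lambda>x. f x *\<^sub>R g x) \<in> bounded_borel"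
proof -
  obtain B C where "0 \<le> B" "\<And>x. x \<in> {0..1} \<Longrightarrow> norm (f x) \<le> B" "\<And>x. x \<in> {0..1} \<Longrightarrow> norm (g x) \<le> C"
    using assms by (metis bounded_borelE)
  then show ?thesis using assms[THEN bounded_borelD]
    by (intro bounded_borelI[where B="B * C"] borel_measurable_scaleR) (auto intro!: mult_mono)
qed

lemma bounded_borel_bounded_linear:
  fixes f :: "real \<Rightarrow> 'a::{banach,second_countable_topology}"
    and T :: "'a \<Rightarrow> 'b::{banach,second_countable_topology}"
  assumes T: "bounded_linear T" and f: "f \<in> bounded_borel"
  shows "(\<lambda>x. T (f x)) \<in> bounded_borel"
proof -
  have "T \<in> borel_measurable borel"
    using T by (intro borel_measurable_continuous_onI linear_continuous_on)
  then have "(\<lambda>x. T (f x)) \<in> borel_measurable unit_borel"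
    using measurable_compose[OF bounded_borelD[OF f]] by auto
  moreover have "bounded ((\<lambda>x. T (f x)) ` {0..1})"
    using bounded_linear_image[OF _ T, of "f ` {0..1}"] f by (simp add: bounded_borel_def image_image)
  ultimately show ?thesis by (simp add: bounded_borel_def)
qed

lemma bounded_borel_diff:
  fixes f g :: "real \<Rightarrow> 'a::{banach,second_countable_topology}"
  assumes "f \<in> bounded_borel" "g \<in> bounded_borel"
  shows "(\<lambda>x. f x - g x) \<in> bounded_borel"
  using bounded_borel_add[OF assms(1) bounded_borel_bounded_linear[OF bounded_linear_minus[OF bounded_linear_ident] assms(2)]]
  by simp

lemma bounded_borel_norm:
  fixes f :: "real \<Rightarrow> 'a::{banach,second_countable_topology}"
  assumes "f \<in> bounded_borel" shows "(\<lambda>x. norm (f x)) \<in> bounded_borel"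
  using assms by (auto simp: bounded_borel_def bounded_iff)

lemma measurable_down: "x \<in> {0..1} \<Longrightarrow> (\<lambda>t. t * x) \<in> measurable unit_lebesgue unit_borel"
  by (rule measurable_restrict_space2)
    (auto simp: space_restrict_space mult_le_one intro!: measurable_restrict_space1)

lemma measurable_up: "x \<in> {0..1} \<Longrightarrow> (\<lambda>t. t * x + 1 - t) \<in> measurable unit_lebesgue unit_borel"
  by (rule measurable_restrict_space2)
    (use up_mem in \<open>auto simp: space_restrict_space intro!: measurable_restrict_space1\<close>)

lemma integrable_unit_lebesgue:
  fixes f :: "real \<Rightarrow> 'a::{banach,second_countable_topology}"
  assumes "f \<in> borel_measurable unit_lebesgue" "\<And>t. t \<in> {0..1} \<Longrightarrow> norm (f t) \<le> B"
  shows "integrable unit_lebesgue f"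
proof -
  interpret prob_space unit_lebesgue by (rule prob_space_unit_lebesgue)
  show ?thesis
    by (rule integrable_const_bound[where B=B])
      (use assms in \<open>auto simp: space_restrict_space intro!: AE_I2\<close>)
qed

lemma integrable_down:
  fixes \<phi> :: "real \<Rightarrow> 'a::{banach,second_countable_topology}"
  assumes "\<phi> \<in> bounded_borel" "x \<in> {0..1}"
  shows "integrable unit_lebesgue (\<lambda>t. \<phi> (t * x))"
proof -
  obtain B where "\<And>y. y \<in> {0..1} \<Longrightarrow> norm (\<phi> y) \<le> B" using assms bounded_borelE by metis
  then show ?thesis
    by (intro integrable_unit_lebesgue[where B=B] measurable_compose[OF measurable_down bounded_borelD])
      (use assms down_mem in auto)
qed

lemma integrable_up:
  fixes \<phi> :: "real \<Rightarrow> 'a::{banach,second_countable_topology}"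
  assumes "\<phi> \<in> bounded_borel" "x \<in> {0..1}"
  shows "integrable unit_lebesgue (\<lambda>t. \<phi> (t * x + 1 - t))"
proof -
  obtain B where "\<And>y. y \<in> {0..1} \<Longrightarrow> norm (\<phi> y) \<le> B" using assms bounded_borelE by metis
  then show ?thesis
    by (intro integrable_unit_lebesgue[where B=B] measurable_compose[OF measurable_up bounded_borelD])
      (use assms up_mem in auto)
qed

text \<open>Functions are controlled on \<open>{0..1}\<close> only, so iterates cannot be rewritten
  as equal functions on the reals; this congruence takes the place of extensionality in the
  inductions on \<open>n\<close>.\<close>

lemma DF_op_cong:
  assumes "x \<in> {0..1}" "\<And>y. y \<in> {0..1} \<Longrightarrow> f y = g y"
  shows "DF_op p q f x = DF_op p q g x"
proof -
  have "(LINT t|unit_lebesgue. f (t * x)) = (LINT t|unit_lebesgue. g (t * x))"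
    "(LINT t|unit_lebesgue. f (t * x + 1 - t)) = (LINT t|unit_lebesgue. g (t * x + 1 - t))"
    by (intro Bochner_Integration.integral_cong; use assms down_mem up_mem in \<open>auto simp: space_restrict_space\<close>)+
  then show ?thesis by (simp only: DF_op_eq)
qed

lemma DF_op_add:
  fixes f g :: "real \<Rightarrow> 'a::{banach,second_countable_topology}"
  assumes "x \<in> {0..1}" "f \<in> bounded_borel" "g \<in> bounded_borel"
  shows "DF_op p q (\<lambda>y. f y + g y) x = DF_op p q f x + DF_op p q g x"
  using assms
  by (simp only: DF_op_eq Bochner_Integration.integral_add[OF integrable_down integrable_down]
      Bochner_Integration.integral_add[OF integrable_up integrable_up]) (simp add: algebra_simps)

text \<open>Covers at once scalar multiples, real and imaginary parts and the embedding of the reals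
  into the complex numbers, so real estimates transfer to complex test functions.\<close>

lemma DF_op_bounded_linear:
  fixes f :: "real \<Rightarrow> 'a::{banach,second_countable_topology}"
    and T :: "'a \<Rightarrow> 'b::{banach,second_countable_topology}"
  assumes "x \<in> {0..1}" "f \<in> bounded_borel" and T: "bounded_linear T"
  shows "DF_op p q (\<lambda>y. T (f y)) x = T (DF_op p q f x)"
  using integral_bounded_linear[OF T integrable_down[OF assms(2,1)]]
    integral_bounded_linear[OF T integrable_up[OF assms(2,1)]]
  by (simp add: DF_op_eq linear_simps[OF T])

lemma DF_op_diff:
  fixes f g :: "real \<Rightarrow> 'a::{banach,second_countable_topology}"
  assumes "x \<in> {0..1}" "f \<in> bounded_borel" "g \<in> bounded_borel"
  shows "DF_op p q (\<lambda>y. f y - g y) x = DF_op p q f x - DF_op p q g x"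
  using assms
  by (simp only: DF_op_eq Bochner_Integration.integral_diff[OF integrable_down integrable_down]
      Bochner_Integration.integral_diff[OF integrable_up integrable_up]) (simp add: algebra_simps)

section \<open>The transition operator: positivity, conservation of mass, iteration\<close>

locale weights =
  fixes p q :: "real \<Rightarrow> real"
  assumes p_range: "p \<in> {0..1} \<rightarrow> {0..1}"
    and q_eq: "\<And>x. x \<in> {0..1} \<Longrightarrow> q x = 1 - p x"
    and continuous_p: "continuous_on {0..1} p"
begin

abbreviation Q :: "(real \<Rightarrow> 'a::{banach,second_countable_topology}) \<Rightarrow> real \<Rightarrow> 'a" where
  "Q \<equiv> DF_op p q"

lemma p_nonneg: "x \<in> {0..1} \<Longrightarrow> 0 \<le> p x"
  and p_le_1: "x \<in> {0..1} \<Longrightarrow> p x \<le> 1"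
  and q_nonneg: "x \<in> {0..1} \<Longrightarrow> 0 \<le> q x"
  and q_le_1: "x \<in> {0..1} \<Longrightarrow> q x \<le> 1"
  using p_range q_eq by (auto simp: Pi_iff)

lemma continuous_q: "continuous_on {0..1} q"
proof -
  have "continuous_on {0..1} (\<lambda>x. 1 - p x)" by (intro continuous_intros continuous_p)
  then show ?thesis by (rule continuous_on_eq) (simp add: q_eq)
qed

lemma Q_const: "x \<in> {0..1} \<Longrightarrow> Q (\<lambda>y. c) x = c"
  using prob_space.prob_space[OF prob_space_unit_lebesgue]
  by (simp add: DF_op_eq q_eq flip: scaleR_add_left)

lemma Q_mono:
  fixes f g :: "real \<Rightarrow> real"
  assumes x: "x \<in> {0..1}" and "f \<in> bounded_borel" "g \<in> bounded_borel"
    and "\<And>y. y \<in> {0..1} \<Longrightarrow> f y \<le> g y"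
  shows "Q f x \<le> Q g x"
  unfolding DF_op_eq
  by (intro add_mono scaleR_left_mono integral_mono integrable_down integrable_up)
    (use assms p_nonneg q_nonneg down_mem up_mem in \<open>auto simp: space_restrict_space\<close>)

lemma norm_Q_le:
  fixes f :: "real \<Rightarrow> 'a::{banach,second_countable_topology}"
  assumes x: "x \<in> {0..1}" and f: "f \<in> bounded_borel" and g: "g \<in> bounded_borel"
    and fg: "\<And>y. y \<in> {0..1} \<Longrightarrow> norm (f y) \<le> g y"
  shows "norm (Q f x) \<le> Q g x"
proof -
  have "norm (Q f x) \<le> Q (\<lambda>y. norm (f y)) x"
    unfolding DF_op_eq using x p_nonneg q_nonneg
    by (intro order_trans[OF norm_triangle_ineq] add_mono)
       (auto intro!: mult_left_mono integral_norm_bound)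
  also have "\<dots> \<le> Q g x" using assms by (intro Q_mono bounded_borel_norm) auto
  finally show ?thesis .
qed

text \<open>A parameter integral: both moves are jointly measurable in (x, t) with values in the
  unit interval, so \<open>f\<close> only has to be measurable there.\<close>

lemma measurable_Q:
  fixes f :: "real \<Rightarrow> 'a::{banach,second_countable_topology}"
  assumes "f \<in> borel_measurable unit_borel"
  shows "Q f \<in> borel_measurable unit_borel"
proof -
  interpret prob_space unit_lebesgue by (rule prob_space_unit_lebesgue)
  have [measurable]: "p \<in> borel_measurable unit_borel" "q \<in> borel_measurable unit_borel"
    using continuous_p continuous_q by (auto intro: borel_measurable_continuous_on_restrict)
  have id: "(\<lambda>x. x) \<in> borel_measurable unit_borel" "(\<lambda>x. x) \<in> borel_measurable unit_lebesgue"
    by (auto intro!: measurable_restrict_space1)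
  have fs: "fst \<in> borel_measurable (unit_borel \<Otimes>\<^sub>M unit_lebesgue)"
    "snd \<in> borel_measurable (unit_borel \<Otimes>\<^sub>M unit_lebesgue)"
    by (rule measurable_compose[OF measurable_fst id(1)] measurable_compose[OF measurable_snd id(2)])+
  have "(\<lambda>z. snd z * fst z) \<in> measurable (unit_borel \<Otimes>\<^sub>M unit_lebesgue) unit_borel"
    "(\<lambda>z. snd z * fst z + 1 - snd z) \<in> measurable (unit_borel \<Otimes>\<^sub>M unit_lebesgue) unit_borel"
    using down_mem up_mem
    by (auto intro!: measurable_restrict_space2 borel_measurable_add borel_measurable_diff
        borel_measurable_times fs simp: space_pair_measure space_restrict_space)
  from this[THEN measurable_compose, OF assms]
  have "case_prod (\<lambda>x t. f (t * x)) \<in> borel_measurable (unit_borel \<Otimes>\<^sub>M unit_lebesgue)"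
    "case_prod (\<lambda>x t. f (t * x + 1 - t)) \<in> borel_measurable (unit_borel \<Otimes>\<^sub>M unit_lebesgue)"
    by (simp_all add: split_beta')
  from this[THEN borel_measurable_lebesgue_integral] show ?thesis
    unfolding DF_op_eq by measurable
qed

lemma norm_Q_bound:
  fixes f :: "real \<Rightarrow> 'a::{banach,second_countable_topology}"
  assumes "x \<in> {0..1}" "f \<in> bounded_borel" "\<And>y. y \<in> {0..1} \<Longrightarrow> norm (f y) \<le> B"
  shows "norm (Q f x) \<le> B"
  using norm_Q_le[of x f "\<lambda>_. B"] assms by (simp add: Q_const)

lemma Q_bounded_borel:
  fixes f :: "real \<Rightarrow> 'a::{banach,second_countable_topology}"
  assumes "f \<in> bounded_borel" shows "Q f \<in> bounded_borel"
proof -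
  obtain B where "\<And>x. x \<in> {0..1} \<Longrightarrow> norm (f x) \<le> B" using assms bounded_borelE by metis
  then show ?thesis
    by (intro bounded_borelI[where B=B, OF measurable_Q[OF bounded_borelD[OF assms]]]
        norm_Q_bound[OF _ assms])
qed

lemma Qn_bounded_borel:
  fixes f :: "real \<Rightarrow> 'a::{banach,second_countable_topology}"
  assumes "f \<in> bounded_borel" shows "(Q ^^ n) f \<in> bounded_borel"
  by (induction n) (use assms Q_bounded_borel in auto)

lemma Qn_diff:
  fixes f g :: "real \<Rightarrow> 'a::{banach,second_countable_topology}"
  assumes "x \<in> {0..1}" "f \<in> bounded_borel" "g \<in> bounded_borel"
  shows "(Q ^^ n) (\<lambda>y. f y - g y) x = (Q ^^ n) f x - (Q ^^ n) g x"
  using assms(1)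
proof (induction n arbitrary: x)
  case (Suc n)
  have "(Q ^^ Suc n) (\<lambda>y. f y - g y) x = Q (\<lambda>y. (Q ^^ n) f y - (Q ^^ n) g y) x"
    using Suc by (auto intro: DF_op_cong)
  also have "\<dots> = (Q ^^ Suc n) f x - (Q ^^ Suc n) g x"
    using DF_op_diff[OF Suc.prems, of "(Q ^^ n) f" "(Q ^^ n) g"] assms Qn_bounded_borel by auto
  finally show ?case .
qed simp

lemma Qn_bounded_linear:
  fixes f :: "real \<Rightarrow> 'a::{banach,second_countable_topology}"
    and T :: "'a \<Rightarrow> 'b::{banach,second_countable_topology}"
  assumes "x \<in> {0..1}" "f \<in> bounded_borel" and T: "bounded_linear T"
  shows "(Q ^^ n) (\<lambda>y. T (f y)) x = T ((Q ^^ n) f x)"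
  using assms(1)
proof (induction n arbitrary: x)
  case (Suc n)
  have "(Q ^^ Suc n) (\<lambda>y. T (f y)) x = Q (\<lambda>y. T ((Q ^^ n) f y)) x"
    using Suc by (auto intro: DF_op_cong)
  also have "\<dots> = T ((Q ^^ Suc n) f x)"
    using DF_op_bounded_linear[OF Suc.prems Qn_bounded_borel[OF assms(2)] T] by simp
  finally show ?case .
qed simp

lemma Qn_fixed:
  fixes f :: "real \<Rightarrow> 'a::{banach,second_countable_topology}"
  assumes "\<And>x. x \<in> {0..1} \<Longrightarrow> Q f x = f x" "x \<in> {0..1}"
  shows "(Q ^^ n) f x = f x"
  using assms(2)
proof (induction n arbitrary: x)
  case (Suc n)
  have "(Q ^^ Suc n) f x = Q f x" using Suc by (auto intro: DF_op_cong)
  then show ?case using assms Suc by simp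
qed simp

text \<open>\<open>Q\<close> is positive, so a majorant stays a majorant under iteration. The
  geometric rates with an absorbing endpoint come from taking a Lyapunov function as
  \<open>g\<close>.\<close>

lemma norm_Qn_le:
  fixes f :: "real \<Rightarrow> 'a::{banach,second_countable_topology}"
  assumes x: "x \<in> {0..1}" and f: "f \<in> bounded_borel" and g: "g \<in> bounded_borel"
    and fg: "\<And>y. y \<in> {0..1} \<Longrightarrow> norm (f y) \<le> g y"
  shows "norm ((Q ^^ n) f x) \<le> (Q ^^ n) g x"
  using x
proof (induction n arbitrary: x)
  case (Suc n)
  show ?case
    using norm_Q_le[OF Suc.prems Qn_bounded_borel[OF f] Qn_bounded_borel[OF g] Suc.IH] by simp
qed (use fg in auto)

end

section \<open>Hoelder functions and Lyapunov functions\<close>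

lemma powr_le_one: "0 \<le> x \<Longrightarrow> x \<le> 1 \<Longrightarrow> 0 < a \<Longrightarrow> x powr a \<le> 1" for x a :: real
  using powr_mono2[of a x 1] by simp

lemma
  fixes f :: "real \<Rightarrow> 'a::real_normed_vector"
  assumes f: "f \<in> holder \<alpha>" and \<alpha>: "0 < \<alpha>"
  shows holder_norm_nonneg: "0 \<le> holder_norm \<alpha> f"
    and norm_le_holder_norm: "x \<in> {0..1} \<Longrightarrow> norm (f x) \<le> holder_norm \<alpha> f"
    and holder_norm_diff: "x \<in> {0..1} \<Longrightarrow> y \<in> {0..1} \<Longrightarrow>
      norm (f x - f y) \<le> holder_norm \<alpha> f * \<bar>x - y\<bar> powr \<alpha>"
proof -
  obtain C where C: "\<And>x y. x \<in> {0..1} \<Longrightarrow> y \<in> {0..1} \<Longrightarrow> norm (f x - f y) \<le> C * \<bar>x - y\<bar> powr \<alpha>"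
    using f unfolding holder_def by blast
  define S where "S = {norm (f x - f y) / \<bar>x - y\<bar> powr \<alpha> | x y. x \<in> {0..1} \<and> y \<in> {0..1} \<and> x \<noteq> y}"
  \<comment> \<open>A supremum of reals is informative only for a bounded set, so the Hoelder
    constant \<open>C\<close> has to bound the quotients here, and the values of \<open>f\<close>
    below, before either supremum can be used.\<close>
  have bS: "bdd_above S"
    unfolding S_def by (rule bdd_aboveI[of _ C]) (use C in \<open>auto simp: divide_le_eq\<close>)
  have SS: "norm (f x - f y) / \<bar>x - y\<bar> powr \<alpha> \<le> Sup S" if "x \<in> {0..1}" "y \<in> {0..1}" "x \<noteq> y" for x y
    by (rule cSup_upper[OF _ bS]) (use that in \<open>auto simp: S_def\<close>)
  have S0: "0 \<le> Sup S" using order_trans[OF _ SS[of 0 1], of 0] by simp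
  have "norm (f x) \<le> norm (f 0) + \<bar>C\<bar>" if "x \<in> {0..1}" for x
  proof -
    have "norm (f x - f 0) \<le> C * \<bar>x\<bar> powr \<alpha>" using C[of x 0] that by simp
    also have "\<dots> \<le> \<bar>C\<bar> * 1" using that \<alpha> powr_le_one[of x \<alpha>] by (intro mult_mono) auto
    finally show ?thesis using norm_triangle_ineq2[of "f x" "f 0"] by simp
  qed
  then have bN: "bdd_above ((\<lambda>x. norm (f x)) ` {0..1})" by (auto intro!: bdd_aboveI[of _ "norm (f 0) + \<bar>C\<bar>"])
  have N: "norm (f x) \<le> (SUP x\<in>{0..1}. norm (f x))" if "x \<in> {0..1}" for x
    using bN that by (rule cSUP_upper2) auto
  have N0: "0 \<le> (SUP x\<in>{0..1}. norm (f x))" using order_trans[OF norm_ge_zero N[of 0]] by simp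
  have eq: "holder_norm \<alpha> f = (SUP x\<in>{0..1}. norm (f x)) + Sup S"
    by (simp add: holder_norm_def holder_seminorm_def S_def)
  show "0 \<le> holder_norm \<alpha> f" using N0 S0 eq by simp
  show "norm (f x) \<le> holder_norm \<alpha> f" if "x \<in> {0..1}"
    using N[OF that] S0 eq by simp
  show "norm (f x - f y) \<le> holder_norm \<alpha> f * \<bar>x - y\<bar> powr \<alpha>" if "x \<in> {0..1}" "y \<in> {0..1}"
  proof (cases "x = y")
    case False
    then have "norm (f x - f y) \<le> Sup S * \<bar>x - y\<bar> powr \<alpha>"
      using SS[OF that False] by (simp add: divide_le_eq)
    also have "\<dots> \<le> holder_norm \<alpha> f * \<bar>x - y\<bar> powr \<alpha>" using eq N0 by (intro mult_right_mono) auto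
    finally show ?thesis .
  qed (use \<alpha> in auto)
qed

lemma holder_continuous_on:
  fixes f :: "real \<Rightarrow> 'a::real_normed_vector"
  assumes f: "f \<in> holder \<alpha>" and \<alpha>: "0 < \<alpha>"
  shows "continuous_on {0..1} f"
  unfolding continuous_on_def
proof
  fix y :: real assume y: "y \<in> {0..1}"
  have "((\<lambda>x. holder_norm \<alpha> f * \<bar>x - y\<bar> powr \<alpha>) \<longlongrightarrow> 0) (at y within {0..1})"
    by (intro tendsto_mult_right_zero tendsto_zero_powrI[where b=\<alpha>] tendsto_rabs_zero LIM_zero) (use \<alpha> in auto)
  then have "((\<lambda>x. f x - f y) \<longlongrightarrow> 0) (at y within {0..1})"
    by (rule Lim_null_comparison[rotated])
      (use holder_norm_diff[OF f \<alpha> _ y] in \<open>auto simp: eventually_at_filter\<close>)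
  then show "(f \<longlongrightarrow> f y) (at y within {0..1})" by (rule LIM_zero_cancel)
qed

lemma integrable_unit_lebesgue_powr: "0 < a \<Longrightarrow> integrable unit_lebesgue (\<lambda>t. t powr a)"
  by (rule integrable_unit_lebesgue[where B=1])
    (auto simp: powr_le_one intro!: measurable_restrict_space1)

lemma LINT_unit_lebesgue_powr:
  assumes "0 < a" shows "(LINT t|unit_lebesgue. t powr a) = 1 / (1 + a)"
proof -
  have i: "set_integrable lborel {0..1} (\<lambda>t. t powr a)"
    using integrable_unit_lebesgue_powr[OF assms] by (simp add: set_integrable_def integrable_restrict_space)
  have "(LINT t|unit_lebesgue. t powr a) = (LINT t:{0..1}|lborel. t powr a)"
    by (simp add: set_lebesgue_integral_def integral_restrict_space)
  also have "\<dots> = integral {0..1} (\<lambda>t. t powr a)" by (rule set_borel_integral_eq_integral[OF i])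
  also have "\<dots> = 1 / (1 + a)"
    using has_integral_powr_from_0[of a 1] assms by (auto simp: integral_unique add.commute)
  finally show ?thesis .
qed

lemma LINT_unit_lebesgue_indicator:
  assumes "0 \<le> d" "d \<le> 1" shows "(LINT t|unit_lebesgue. c * indicator {0..d} t) = c * d"
  using assms by (simp add: measure_restrict_space space_restrict_space Int_absorb1)

text \<open>Substitution y = t x: the downward move is uniform on [0, x]. Keeping the factor
  \<open>x\<close> on the left avoids a quotient.\<close>

lemma unit_mult_LINT_down:
  fixes f :: "real \<Rightarrow> 'a::{banach,second_countable_topology}"
  assumes "0 < x" "x \<le> 1"
  shows "x *\<^sub>R (LINT t|unit_lebesgue. f (t * x)) = (LINT y:{0..x}|lborel. f y)"
  using assms lborel_integral_real_affine[of x "\<lambda>y. indicator {0..x} y *\<^sub>R f y" 0]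
  by (simp add: set_lebesgue_integral_def integral_restrict_space indicator_def mult.commute
      zero_le_mult_iff mult_le_cancel_left1 mult_le_cancel_right1 cong: if_cong)

lemma unit_mult_LINT_up:
  fixes f :: "real \<Rightarrow> 'a::{banach,second_countable_topology}"
  assumes "0 \<le> x" "x < 1"
  shows "(1 - x) *\<^sub>R (LINT t|unit_lebesgue. f (t * x + 1 - t)) = (LINT y:{x..1}|lborel. f y)"
proof -
  \<comment> \<open>The substitution y = 1 - (1 - x) t has negative slope, so the preimage of the
    interval is computed by hand.\<close>
  have "indicator {x..1} (1 + (x - 1) * t) = (indicator {0..1} t :: real)" for t
  proof -
    have "x \<le> 1 + (x - 1) * t \<longleftrightarrow> 0 \<le> (1 - x) * (1 - t)" by (simp add: algebra_simps)
    also have "\<dots> \<longleftrightarrow> t \<le> 1" using assms by (simp add: zero_le_mult_iff)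
    finally have 1: "x \<le> 1 + (x - 1) * t \<longleftrightarrow> t \<le> 1" .
    have "1 + (x - 1) * t \<le> 1 \<longleftrightarrow> 0 \<le> (1 - x) * t" by (simp add: algebra_simps)
    also have "\<dots> \<longleftrightarrow> 0 \<le> t" using assms by (simp add: zero_le_mult_iff)
    finally show ?thesis using 1 by (auto simp: indicator_def)
  qed
  then show ?thesis
    using assms lborel_integral_real_affine[of "x - 1" "\<lambda>y. indicator {x..1} y *\<^sub>R f y" 1]
    by (simp add: set_lebesgue_integral_def integral_restrict_space algebra_simps)
qed

text \<open>Turns a contraction per two steps into a rate per step: \<rho> is sqrt r, and an odd
  \<open>n\<close> costs the factor 1 / sqrt r.\<close>

lemma half_power_bound:
  assumes "0 < r" "r < 1"
  shows "\<exists>\<kappa>>0. \<exists>\<rho>::real. 0 < \<rho> \<and> \<rho> < 1 \<and> (\<forall>n. r ^ (n div 2) \<le> \<kappa> * \<rho> ^ n)"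
proof (intro exI conjI allI)
  show "0 < 1 / sqrt r" "0 < sqrt r" "sqrt r < 1" using assms by auto
  show "r ^ (n div 2) \<le> 1 / sqrt r * sqrt r ^ n" for n
  proof -
    have "sqrt r * r ^ (n div 2) = sqrt r ^ Suc (2 * (n div 2))"
      using assms by (simp add: power_mult)
    also have "\<dots> \<le> sqrt r ^ n" using assms by (intro power_decreasing) auto
    finally show ?thesis using assms by (simp add: field_simps)
  qed
qed

text \<open>If t \<le> d then t x \<le> d whatever x is, and this event has probability
  \<open>d\<close>; elsewhere \<open>g\<close> enters only through its sign.\<close>

lemma LINT_down_ge:
  fixes g :: "real \<Rightarrow> real"
  assumes x: "x \<in> {0..1}" and g: "g \<in> bounded_borel" "\<And>y. y \<in> {0..1} \<Longrightarrow> 0 \<le> g y"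
    and d: "0 \<le> d" "d \<le> 1" and c: "\<And>y. y \<in> {0..d} \<Longrightarrow> c \<le> g y"
  shows "c * d \<le> (LINT t|unit_lebesgue. g (t * x))"
proof -
  have i: "integrable unit_lebesgue (\<lambda>t. c * indicator {0..d} t :: real)"
    by (rule integrable_unit_lebesgue[where B="\<bar>c\<bar>"])
      (auto simp: indicator_def intro!: measurable_restrict_space1)
  have dn: "t * x \<le> d" if "t \<in> {0..d}" for t
    using that x mult_mono[of t d x 1] by auto
  show ?thesis
    unfolding LINT_unit_lebesgue_indicator[OF d, symmetric]
    by (rule integral_mono[OF i integrable_down[OF g(1) x]])
      (use x d g c down_mem dn in \<open>auto simp: space_restrict_space indicator_def\<close>)
qed

lemma LINT_up_ge:
  fixes g :: "real \<Rightarrow> real"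
  assumes x: "x \<in> {0..1}" and g: "g \<in> bounded_borel" "\<And>y. y \<in> {0..1} \<Longrightarrow> 0 \<le> g y"
    and d: "0 \<le> d" "d \<le> 1" and c: "\<And>y. y \<in> {1 - d..1} \<Longrightarrow> c \<le> g y"
  shows "c * d \<le> (LINT t|unit_lebesgue. g (t * x + 1 - t))"
proof -
  have i: "integrable unit_lebesgue (\<lambda>t. c * indicator {0..d} t :: real)"
    by (rule integrable_unit_lebesgue[where B="\<bar>c\<bar>"])
      (auto simp: indicator_def intro!: measurable_restrict_space1)
  have up: "1 - d \<le> t * x + 1 - t" if "t \<in> {0..d}" for t
    using that x mult_nonneg_nonneg[of t x] unfolding atLeastAtMost_iff by linarith
  show ?thesis
    unfolding LINT_unit_lebesgue_indicator[OF d, symmetric]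
    by (rule integral_mono[OF i integrable_up[OF g(1) x]])
      (use x d g c up_mem up in \<open>auto simp: space_restrict_space indicator_def\<close>)
qed

section \<open>One-step bounds near the endpoints and geometric decay of Lyapunov functions\<close>

context weights
begin

text \<open>Each move reaches the d-neighbourhood of its own endpoint with probability at least
  \<open>d\<close>; as the weights sum to 1, the bound is independent of them.\<close>

lemma Q_ge_spread:
  fixes g :: "real \<Rightarrow> real"
  assumes x: "x \<in> {0..1}" and g: "g \<in> bounded_borel" "\<And>y. y \<in> {0..1} \<Longrightarrow> 0 \<le> g y"
    and d: "0 \<le> d" "d \<le> 1"
    and c: "\<And>y. y \<in> {0..1} \<Longrightarrow> y \<le> d \<or> 1 - d \<le> y \<Longrightarrow> c \<le> g y"
  shows "c * d \<le> Q g x"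
proof -
  have "c * d = p x * (c * d) + q x * (c * d)" using x by (simp add: q_eq algebra_simps)
  also have "\<dots> \<le> Q g x" unfolding DF_op_eq real_scaleR_def
    by (intro add_mono mult_left_mono p_nonneg q_nonneg LINT_down_ge LINT_up_ge x g d) (use d c in auto)
  finally show ?thesis .
qed

text \<open>In contrast to \<open>Q_ge_spread\<close>, information on \<open>g\<close> near 0 is
  enough; the price is the factor \<open>p x\<close>.\<close>

lemma Q_ge_down:
  fixes g :: "real \<Rightarrow> real"
  assumes x: "x \<in> {0..1}" and g: "g \<in> bounded_borel" "\<And>y. y \<in> {0..1} \<Longrightarrow> 0 \<le> g y"
    and d: "0 \<le> d" "d \<le> 1" and c: "\<And>y. y \<in> {0..d} \<Longrightarrow> c \<le> g y"
  shows "p x * (c * d) \<le> Q g x"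
proof -
  \<comment> \<open>Nonnegativity of the upward part is the case c = 0 of
    \<open>LINT_up_ge\<close>.\<close>
  have "0 * d \<le> (LINT t|unit_lebesgue. g (t * x + 1 - t))"
    by (rule LINT_up_ge[OF x g d]) (use d g in auto)
  then have "0 \<le> q x * (LINT t|unit_lebesgue. g (t * x + 1 - t))"
    using q_nonneg[OF x] by simp
  moreover have "p x * (c * d) \<le> p x * (LINT t|unit_lebesgue. g (t * x))"
    by (intro mult_left_mono p_nonneg LINT_down_ge x g d c)
  ultimately show ?thesis unfolding DF_op_eq real_scaleR_def by linarith
qed

lemma Qn_mult:
  fixes f :: "real \<Rightarrow> real"
  assumes "x \<in> {0..1}" "f \<in> bounded_borel"
  shows "(Q ^^ n) (\<lambda>y. c * f y) x = c * (Q ^^ n) f x"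
  using Qn_bounded_linear[OF assms bounded_linear_mult_right] .

lemma norm_Qn_le_mult:
  fixes f :: "real \<Rightarrow> 'a::{banach,second_countable_topology}" and W :: "real \<Rightarrow> real"
  assumes "x \<in> {0..1}" "f \<in> bounded_borel" "W \<in> bounded_borel"
    and "\<And>y. y \<in> {0..1} \<Longrightarrow> norm (f y) \<le> K * W y"
  shows "norm ((Q ^^ n) f x) \<le> K * (Q ^^ n) W x"
  using norm_Qn_le[of x f "\<lambda>y. K * W y" n] assms
    bounded_borel_bounded_linear[OF bounded_linear_mult_right assms(3)] Qn_mult by simp

lemma Q_one_minus:
  fixes f :: "real \<Rightarrow> real"
  assumes "x \<in> {0..1}" "f \<in> bounded_borel"
  shows "Q (\<lambda>y. 1 - f y) x = 1 - Q f x"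
  using DF_op_diff[OF assms(1) bounded_borel_const assms(2)] assms by (simp add: Q_const)

text \<open>A downward step multiplies the bound by \<open>t powr a\<close>, of mean 1 / (1 + a); an
  upward step, of probability \<open>q x\<close>, is charged the worst value 1.\<close>

lemma Q_le_near_0:
  fixes g :: "real \<Rightarrow> real"
  assumes x: "x \<in> {0..1}" and g: "g \<in> bounded_borel" and a: "0 < a" and L: "0 \<le> L"
    and g1: "\<And>y. y \<in> {0..1} \<Longrightarrow> g y \<le> 1" and gL: "\<And>y. y \<in> {0..1} \<Longrightarrow> g y \<le> L * y powr a"
  shows "Q g x \<le> L * x powr a / (1 + a) + q x"
proof -
  interpret prob_space unit_lebesgue by (rule prob_space_unit_lebesgue)
  have "(LINT t|unit_lebesgue. g (t * x)) \<le> (LINT t|unit_lebesgue. (L * x powr a) * t powr a)"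
  proof (rule integral_mono[OF integrable_down[OF g x]])
    show "integrable unit_lebesgue (\<lambda>t. (L * x powr a) * t powr a)"
      by (intro integrable_mult_right integrable_unit_lebesgue_powr a)
    show "g (t * x) \<le> (L * x powr a) * t powr a" if "t \<in> space unit_lebesgue" for t
      using gL[OF down_mem[of t x]] that x by (simp add: space_restrict_space powr_mult mult_ac)
  qed
  also have "\<dots> = L * x powr a / (1 + a)" using a by (simp add: LINT_unit_lebesgue_powr)
  finally have A: "(LINT t|unit_lebesgue. g (t * x)) \<le> L * x powr a / (1 + a)" .
  have "(LINT t|unit_lebesgue. g (t * x + 1 - t)) \<le> (LINT t|unit_lebesgue. 1)"
    by (rule integral_mono[OF integrable_up[OF g x] integrable_const])
      (rule g1, rule up_mem, use x in \<open>simp_all add: space_restrict_space\<close>)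
  then have B: "(LINT t|unit_lebesgue. g (t * x + 1 - t)) \<le> 1"
    by (simp only: lebesgue_integral_const prob_space) simp
  have "Q g x \<le> p x * (L * x powr a / (1 + a)) + q x * 1"
    unfolding DF_op_eq real_scaleR_def
    by (intro add_mono mult_left_mono A B p_nonneg q_nonneg x)
  also have "\<dots> \<le> 1 * (L * x powr a / (1 + a)) + q x * 1"
    using L a by (intro add_mono mult_right_mono p_le_1 x order_refl) auto
  finally show ?thesis by simp
qed

lemma Q_le_near_1:
  fixes g :: "real \<Rightarrow> real"
  assumes x: "x \<in> {0..1}" and g: "g \<in> bounded_borel" and a: "0 < a" and L: "0 \<le> L"
    and g1: "\<And>y. y \<in> {0..1} \<Longrightarrow> g y \<le> 1" and gL: "\<And>y. y \<in> {0..1} \<Longrightarrow> g y \<le> L * (1 - y) powr a"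
  shows "Q g x \<le> L * (1 - x) powr a / (1 + a) + p x"
proof -
  interpret prob_space unit_lebesgue by (rule prob_space_unit_lebesgue)
  have "(LINT t|unit_lebesgue. g (t * x + 1 - t)) \<le> (LINT t|unit_lebesgue. (L * (1 - x) powr a) * t powr a)"
  proof (rule integral_mono[OF integrable_up[OF g x]])
    show "integrable unit_lebesgue (\<lambda>t. (L * (1 - x) powr a) * t powr a)"
      by (intro integrable_mult_right integrable_unit_lebesgue_powr a)
    show "g (t * x + 1 - t) \<le> (L * (1 - x) powr a) * t powr a" if "t \<in> space unit_lebesgue" for t
    proof -
      have "1 - (t * x + 1 - t) = (1 - x) * t" by (simp add: algebra_simps)
      then show ?thesis
        using gL[OF up_mem[of t x]] that x by (simp add: space_restrict_space powr_mult mult_ac)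
    qed
  qed
  also have "\<dots> = L * (1 - x) powr a / (1 + a)" using a by (simp add: LINT_unit_lebesgue_powr)
  finally have B: "(LINT t|unit_lebesgue. g (t * x + 1 - t)) \<le> L * (1 - x) powr a / (1 + a)" .
  have "(LINT t|unit_lebesgue. g (t * x)) \<le> (LINT t|unit_lebesgue. 1)"
    by (rule integral_mono[OF integrable_down[OF g x] integrable_const])
      (rule g1, rule down_mem, use x in \<open>simp_all add: space_restrict_space\<close>)
  then have A: "(LINT t|unit_lebesgue. g (t * x)) \<le> 1"
    by (simp only: lebesgue_integral_const prob_space) simp
  have "Q g x \<le> p x * 1 + q x * (L * (1 - x) powr a / (1 + a))"
    unfolding DF_op_eq real_scaleR_def
    by (intro add_mono mult_left_mono A B p_nonneg q_nonneg x)
  also have "\<dots> \<le> p x * 1 + 1 * (L * (1 - x) powr a / (1 + a))"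
    using L a by (intro add_mono mult_right_mono q_le_1 x order_refl) auto
  finally show ?thesis by simp
qed

lemma Q_mult:
  fixes f :: "real \<Rightarrow> real"
  assumes "x \<in> {0..1}" "f \<in> bounded_borel"
  shows "Q (\<lambda>y. c * f y) x = c * Q f x"
  using DF_op_bounded_linear[OF assms bounded_linear_mult_right] .

text \<open>Even times iterate \<open>QQ\<close>. An odd time is one more application of
  \<open>Q\<close> to a bound that no longer depends on the state, and \<open>Q\<close> fixes
  constants; this avoids comparing \<open>Q W\<close> with \<open>W\<close>.\<close>

lemma lyapunov_decay:
  fixes W :: "real \<Rightarrow> real"
  assumes W: "W \<in> bounded_borel" "\<And>y. y \<in> {0..1} \<Longrightarrow> 0 \<le> W y" "\<And>y. y \<in> {0..1} \<Longrightarrow> W y \<le> 1"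
    and r: "0 < r" "r < 1" and QQ: "\<And>y. y \<in> {0..1} \<Longrightarrow> Q (Q W) y \<le> r * W y"
  shows "\<exists>\<kappa>>0. \<exists>\<rho>::real. 0 < \<rho> \<and> \<rho> < 1 \<and> (\<forall>n. \<forall>x\<in>{0..1}. (Q ^^ n) W x \<le> \<kappa> * \<rho> ^ n)"
proof -
  have le: "(Q ^^ n) W x \<le> r ^ (n div 2)" if "x \<in> {0..1}" for n x
    using that
  proof (induction n arbitrary: x rule: less_induct)
    case (less n)
    have *: "(Q ^^ (2 * k)) W x \<le> r ^ k * W x" if "x \<in> {0..1}" for k x
      using that
    proof (induction k arbitrary: x)
      case (Suc k)
      have "(Q ^^ (2 * Suc k)) W x = Q (Q ((Q ^^ (2 * k)) W)) x" by simp
      also have "\<dots> \<le> Q (Q (\<lambda>y. r ^ k * W y)) x"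
        by (intro Q_mono Q_bounded_borel Qn_bounded_borel
          bounded_borel_bounded_linear[OF bounded_linear_mult_right] W Suc)
      also have "\<dots> = r ^ k * Q (Q W) x"
      proof -
        have "Q (Q (\<lambda>y. r ^ k * W y)) x = Q (\<lambda>y. r ^ k * Q W y) x"
          by (intro DF_op_cong Suc Q_mult W)
        then show ?thesis using Q_mult[OF Suc.prems Q_bounded_borel[OF W(1)]] by simp
      qed
      also have "\<dots> \<le> r ^ k * (r * W x)" using QQ Suc r by (intro mult_left_mono) auto
      finally show ?case by (simp add: mult_ac)
    qed simp
    have even: "(Q ^^ (2 * k)) W x \<le> r ^ k" if "x \<in> {0..1}" for k x
      using *[OF that, of k] mult_left_le[OF W(3)[OF that], of "r ^ k"] r by (meson less_imp_le order_trans zero_le_power)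
    show ?case
    proof (cases "even n")
      case True then show ?thesis using even less.prems by (auto elim!: evenE)
    next
      case False
      then obtain k where k: "n = 2 * k + 1" by (auto elim: oddE)
      have "(Q ^^ n) W x = Q ((Q ^^ (2 * k)) W) x" by (simp add: k)
      also have "\<dots> \<le> Q (\<lambda>_. r ^ k) x"
        by (intro Q_mono Qn_bounded_borel W less.prems even) auto
      finally show ?thesis using k less.prems by (simp add: Q_const)
    qed
  qed
  obtain \<kappa> \<rho> where "\<kappa> > 0" "0 < \<rho>" "\<rho> < 1" "\<And>n. r ^ (n div 2) \<le> \<kappa> * \<rho> ^ n"
    using half_power_bound[OF r] by blast
  then show ?thesis using le by (meson order_trans)
qed

end

section \<open>Invariant measures and Lyapunov functions\<close>

lemma integrable_bounded_borel:
  fixes f :: "real \<Rightarrow> 'a::{banach,second_countable_topology}"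
  assumes "prob_space \<nu>" "sets \<nu> = sets unit_borel" "f \<in> bounded_borel"
  shows "integrable \<nu> f"
proof -
  interpret prob_space \<nu> by fact
  obtain B where B: "\<And>y. y \<in> {0..1} \<Longrightarrow> norm (f y) \<le> B" using assms bounded_borelE by metis
  have sp: "space \<nu> = {0..1}" using sets_eq_imp_space_eq[OF assms(2)] by (simp add: space_restrict_space)
  have "f \<in> borel_measurable \<nu>"
    using bounded_borelD[OF assms(3)] measurable_cong_sets[OF assms(2) refl] by blast
  then show ?thesis by (rule integrable_const_bound[where B=B, rotated]) (use sp B in \<open>auto intro!: AE_I2\<close>)
qed

lemma invariant_space:
  assumes "DF_invariant p q \<nu>"
  shows "prob_space \<nu>" "sets \<nu> = sets unit_borel" "space \<nu> = {0..1}"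
  using assms sets_eq_imp_space_eq[of \<nu> unit_borel]
  by (auto simp: DF_invariant_def space_restrict_space)

lemma eq_return_if_AE:
  assumes "prob_space \<nu>" "sets \<nu> = sets unit_borel" "a \<in> {0..1}" "AE y in \<nu>. y = a"
  shows "\<nu> = return unit_borel a"
proof (rule measure_eqI)
  interpret prob_space \<nu> by fact
  fix A assume A: "A \<in> sets \<nu>"
  have "AE y in \<nu>. y \<in> A \<longleftrightarrow> y \<in> (if a \<in> A then space \<nu> else {})"
    using assms(4) AE_space by eventually_elim auto
  then have "emeasure \<nu> A = emeasure \<nu> (if a \<in> A then space \<nu> else {})"
    by (rule emeasure_eq_AE) (use A in auto)
  then show "emeasure \<nu> A = emeasure (return unit_borel a) A"
    using A assms by (auto simp: emeasure_space_1)
qed (use assms in auto)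

lemma LINT_unit_lebesgue_const:
  fixes c :: "'a::{banach,second_countable_topology}"
  shows "(LINT t|unit_lebesgue. c) = c"
  by (simp only: lebesgue_integral_const prob_space.prob_space[OF prob_space_unit_lebesgue] scaleR_one)

context weights
begin

lemma Qn_const: "x \<in> {0..1} \<Longrightarrow> (Q ^^ n) (\<lambda>_. c) x = c"
  by (rule Qn_fixed) (rule Q_const)

text \<open>\<open>DF_invariant\<close> tests complex functions; the real version is recovered
  through \<open>of_real\<close>, which commutes with \<open>Q\<close> and with the
  integral.\<close>

lemma invariant_LINT_real:
  fixes f :: "real \<Rightarrow> real"
  assumes \<nu>: "DF_invariant p q \<nu>" and f: "f \<in> bounded_borel"
  shows "(LINT y|\<nu>. Q f y) = (LINT y|\<nu>. f y)"
proof -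
  let ?c = "complex_of_real"
  note T = bounded_linear_of_real[where 'a=complex]
  have "?c (LINT y|\<nu>. Q f y) = (LINT y|\<nu>. ?c (Q f y))" by simp
  also have "\<dots> = (LINT y|\<nu>. Q (\<lambda>z. ?c (f z)) y)"
    by (rule Bochner_Integration.integral_cong[OF refl])
      (simp add: DF_op_bounded_linear[OF _ f T] invariant_space(3)[OF \<nu>])
  also have "\<dots> = (LINT y|\<nu>. ?c (f y))"
    using \<nu> bounded_borel_bounded_linear[OF T f] unfolding DF_invariant_def by blast
  finally show ?thesis by (simp only: integral_complex_of_real of_real_eq_iff)
qed

text \<open>Integrating \<open>QQ\<close> against \<nu> gives \<nu>(W) \<le> r \<nu>(W), hence
  \<nu>(W) = 0. This locates all invariant measures without any convergence of iterates.\<close>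

lemma invariant_lyapunov:
  fixes W :: "real \<Rightarrow> real"
  assumes \<nu>: "DF_invariant p q \<nu>"
    and W: "W \<in> bounded_borel" "\<And>y. y \<in> {0..1} \<Longrightarrow> 0 \<le> W y"
    and r: "r < 1" and QQ: "\<And>y. y \<in> {0..1} \<Longrightarrow> Q (Q W) y \<le> r * W y"
  shows "AE y in \<nu>. W y = 0"
proof -
  note sp = invariant_space[OF \<nu>]
  note int = integrable_bounded_borel[OF sp(1,2)]
  have "(LINT y|\<nu>. W y) = (LINT y|\<nu>. Q (Q W) y)"
    using invariant_LINT_real[OF \<nu> W(1)] invariant_LINT_real[OF \<nu> Q_bounded_borel[OF W(1)]] by simp
  also have "\<dots> \<le> (LINT y|\<nu>. r * W y)"
    by (rule integral_mono[OF int[OF Q_bounded_borel[OF Q_bounded_borel[OF W(1)]]]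
          integrable_mult_right[OF int[OF W(1)]]]) (use QQ sp(3) in auto)
  finally have "(1 - r) * (LINT y|\<nu>. W y) \<le> 0" by (simp add: algebra_simps)
  moreover have ge: "AE y in \<nu>. 0 \<le> W y" using W(2) sp(3) by (auto intro!: AE_I2)
  ultimately have "(LINT y|\<nu>. W y) = 0"
    using r integral_nonneg_AE[OF ge] by (simp add: mult_le_0_iff)
  then show ?thesis using integral_nonneg_eq_0_iff_AE[OF int[OF W(1)] ge] by simp
qed

text \<open>The hypothesis \<open>fix_a\<close> says that \<open>a\<close> is an absorbing
  point.\<close>

lemma invariant_return:
  assumes a: "a \<in> {0..1}" and fix_a: "\<And>f :: real \<Rightarrow> complex. f \<in> bounded_borel \<Longrightarrow> Q f a = f a"
  shows "DF_invariant p q (return unit_borel a)"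
proof -
  have "(LINT x|return unit_borel a. Q f x) = (LINT x|return unit_borel a. f x)"
    if f: "f \<in> bounded_borel" for f :: "real \<Rightarrow> complex"
    using a fix_a[OF f] integral_return[OF _ bounded_borelD[OF f]]
      integral_return[OF _ bounded_borelD[OF Q_bounded_borel[OF f]]]
    by (simp add: space_restrict_space)
  then show ?thesis using a unfolding DF_invariant_def
    by (auto simp: space_restrict_space intro!: prob_space_return)
qed

lemma Q_at_0:
  fixes f :: "real \<Rightarrow> 'a::{banach,second_countable_topology}"
  assumes "p 0 = 1" shows "Q f 0 = f 0"
proof -
  have "q 0 = 0" using q_eq[of 0] assms by simp
  then show ?thesis
    unfolding DF_op_eq mult_zero_right LINT_unit_lebesgue_const assms by simp
qed

lemma Q_at_1:
  fixes f :: "real \<Rightarrow> 'a::{banach,second_countable_topology}"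
  assumes "q 1 = 1" shows "Q f 1 = f 1"
proof -
  have p: "p 1 = 0" using q_eq[of 1] assms by simp
  have "t + 1 - t = 1" for t :: real by simp
  then show ?thesis
    by (simp only: DF_op_eq mult_1_right LINT_unit_lebesgue_const assms p) simp
qed

end

section \<open>One absorbing endpoint\<close>

text \<open>\<open>M\<close> is any Hoelder constant of \<open>p\<close>, kept as a parameter so
  that the reflected weights satisfy the same assumptions with the same constants.\<close>

locale holder_weights =
  fixes p q :: "real \<Rightarrow> real" and \<alpha> M :: real
  assumes \<alpha>: "0 < \<alpha>" "\<alpha> \<le> 1" and M: "0 \<le> M"
    and range_p: "p \<in> {0..1} \<rightarrow> {0..1}"
    and one_minus_p: "\<And>x. x \<in> {0..1} \<Longrightarrow> q x = 1 - p x"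
    and p_diff: "\<And>x y. x \<in> {0..1} \<Longrightarrow> y \<in> {0..1} \<Longrightarrow> \<bar>p x - p y\<bar> \<le> M * \<bar>x - y\<bar> powr \<alpha>"

sublocale holder_weights \<subseteq> weights
proof
  have "p \<in> holder \<alpha>" using p_diff unfolding holder_def real_norm_def by blast
  then show "continuous_on {0..1} p" by (rule holder_continuous_on[OF _ \<alpha>(1)])
qed (use range_p one_minus_p in auto)

text \<open>Under x to 1 - x the endpoints and the two moves exchange their roles, so results about
  0 carry over to 1.\<close>

lemma (in holder_weights) reflect_holder: "holder_weights (\<lambda>x. q (1 - x)) (\<lambda>x. p (1 - x)) \<alpha> M"
proof
  show "\<bar>q (1 - x) - q (1 - y)\<bar> \<le> M * \<bar>x - y\<bar> powr \<alpha>" if "x \<in> {0..1}" "y \<in> {0..1}" for x y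
    using p_diff[of "1 - x" "1 - y"] that by (simp add: q_eq abs_minus_commute)
qed (use \<alpha> M in \<open>auto simp: q_eq p_nonneg p_le_1\<close>)

lemma DF_op_reflect:
  "DF_op (\<lambda>x. q (1 - x)) (\<lambda>x. p (1 - x)) f x = DF_op p q (\<lambda>y. f (1 - y)) (1 - x)"
  unfolding DF_op_eq by (simp add: algebra_simps)

lemma bounded_borel_reflect:
  fixes f :: "real \<Rightarrow> 'a::{banach,second_countable_topology}"
  assumes "f \<in> bounded_borel" shows "(\<lambda>x. f (1 - x)) \<in> bounded_borel"
proof -
  obtain B where B: "\<And>y. y \<in> {0..1} \<Longrightarrow> norm (f y) \<le> B" using assms bounded_borelE by metis
  have "(\<lambda>x. 1 - x) \<in> measurable unit_borel unit_borel"
    by (rule measurable_restrict_space2)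
      (auto simp: space_restrict_space intro!: measurable_restrict_space1)
  from measurable_compose[OF this bounded_borelD[OF assms]] show ?thesis
    by (rule bounded_borelI[where B=B]) (use B in auto)
qed

context holder_weights
begin

lemma q_diff: "x \<in> {0..1} \<Longrightarrow> y \<in> {0..1} \<Longrightarrow> \<bar>q x - q y\<bar> \<le> M * \<bar>x - y\<bar> powr \<alpha>"
  using p_diff[of x y] by (simp add: q_eq abs_minus_commute)

text \<open>Chosen so that \<open>M\<close> is at most
  \<open>L * \<alpha> / (2 * (1 + \<alpha>))\<close>: the escape term then uses up at most half of
  the gap 1 - 1 / (1 + \<alpha>). Being at least 1 makes the capped function dominate the plain
  power.\<close>

definition L :: real where "L = max 1 (2 * M * (1 + \<alpha>) / \<alpha>)"
text \<open>The midpoint of 1 / (1 + \<alpha>) and 1.\<close>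

definition r\<^sub>0 :: real where "r\<^sub>0 = 1 - \<alpha> / (2 * (1 + \<alpha>))"

lemma L_ge_1: "1 \<le> L" by (simp add: L_def)

lemma r0: "0 < r\<^sub>0" "r\<^sub>0 < 1" using \<alpha> by (auto simp: r\<^sub>0_def field_simps)

lemma L_contract:
  assumes "0 \<le> z" shows "L * z / (1 + \<alpha>) + M * z \<le> r\<^sub>0 * (L * z)"
proof -
  have "2 * M * (1 + \<alpha>) / \<alpha> \<le> L" by (simp add: L_def)
  then have "M \<le> L * \<alpha> / (2 * (1 + \<alpha>))" using \<alpha> by (simp add: field_simps)
  then have "L * z / (1 + \<alpha>) + M * z \<le> L * z / (1 + \<alpha>) + L * \<alpha> / (2 * (1 + \<alpha>)) * z"
    using assms by (intro add_left_mono mult_right_mono)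
  also have "\<dots> = r\<^sub>0 * (L * z)"
  proof -
    define u where "u = \<alpha> / (2 * (1 + \<alpha>))"
    have "1 / (1 + \<alpha>) = 1 - 2 * u" using \<alpha> by (simp add: u_def field_simps)
    then have "L * z / (1 + \<alpha>) = L * z * (1 - 2 * u)" by (metis times_divide_eq_right mult_1_right)
    moreover have "L * \<alpha> / (2 * (1 + \<alpha>)) = L * u" by (simp add: u_def)
    moreover have "r\<^sub>0 = 1 - u" by (simp add: r\<^sub>0_def u_def)
    ultimately show ?thesis by (simp only:) (simp add: algebra_simps)
  qed
  finally show ?thesis .
qed

lemma small_radius: obtains d where "0 < d" "d \<le> 1" "\<And>y. 0 \<le> y \<Longrightarrow> y \<le> d \<Longrightarrow> L * y powr \<alpha> \<le> 1 / 2"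
proof
  \<comment> \<open>The solution of \<open>L * d powr \<alpha> = 1 / 2\<close>.\<close>
  let ?d = "(1 / (2 * L)) powr (1 / \<alpha>)"
  show "0 < ?d" using L_ge_1 by simp
  show "?d \<le> 1" using L_ge_1 \<alpha> by (intro powr_le_one) auto
  show "L * y powr \<alpha> \<le> 1 / 2" if "0 \<le> y" "y \<le> ?d" for y
  proof -
    have "y powr \<alpha> \<le> ?d powr \<alpha>" using that \<alpha> by (intro powr_mono2) auto
    also have "\<dots> = 1 / (2 * L)" using \<alpha> L_ge_1 by (simp add: powr_powr)
    finally show ?thesis using L_ge_1 by (simp add: field_simps)
  qed
qed

text \<open>Near the absorbing point \<open>0\<close> the function \<open>W\<close> is contracted because \<open>E t\<^sup>\<alpha> = 1 / (1 + \<alpha>) < 1\<close> while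
  an escape has probability \<open>O(x\<^sup>\<alpha>)\<close>; elsewhere two steps reach a neighbourhood of \<open>0\<close> with probability
  bounded below.\<close>

lemma lyapunov_absorbing_0:
  assumes p0: "p 0 = 1" and q1: "q 1 < 1"
  obtains W r where "W \<in> bounded_borel" "\<And>y. y \<in> {0..1} \<Longrightarrow> 0 \<le> W y" "\<And>y. y \<in> {0..1} \<Longrightarrow> W y \<le> (1::real)"
    "\<And>y. y \<in> {0..1} \<Longrightarrow> y powr \<alpha> \<le> W y" "0 < r" "r < 1" "\<And>y. y \<in> {0..1} \<Longrightarrow> Q (Q W) y \<le> r * W y"
proof -
  define W where "W = (\<lambda>y. min 1 (L * y powr \<alpha>))"
  have bb: "W \<in> bounded_borel" unfolding W_def
    by (intro bounded_borel_continuous continuous_intros continuous_on_powr') (use \<alpha> in auto)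
  note Qbb = Q_bounded_borel[OF bb]
  have W01: "0 \<le> W y" "W y \<le> 1" for y using L_ge_1 by (auto simp: W_def)
  have Wlow: "y powr \<alpha> \<le> W y" if "y \<in> {0..1}" for y
    using that \<alpha> L_ge_1 powr_le_one[of y \<alpha>] mult_right_mono[of 1 L "y powr \<alpha>"] by (auto simp: W_def)
  have QW1: "Q W y \<le> 1" if "y \<in> {0..1}" for y
    using Q_mono[OF that bb bounded_borel_const[of 1]] W01 that by (simp add: Q_const)
  have QWL: "Q W y \<le> r\<^sub>0 * (L * y powr \<alpha>)" if y: "y \<in> {0..1}" for y
  proof -
    have "Q W y \<le> L * y powr \<alpha> / (1 + \<alpha>) + q y"
      by (rule Q_le_near_0[OF y bb \<alpha>(1)]) (use L_ge_1 in \<open>auto simp: W_def\<close>)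
    \<comment> \<open>As \<open>q 0 = 0\<close>, the escape probability is a Hoelder increment of
      \<open>q\<close>.\<close>
    also have "q y \<le> M * y powr \<alpha>" using q_diff[of y 0] y p0 by (simp add: q_eq)
    finally show ?thesis using L_contract[of "y powr \<alpha>"] by simp
  qed
  have QW: "Q W y \<le> W y" if y: "y \<in> {0..1}" for y
  proof -
    have "r\<^sub>0 * (L * y powr \<alpha>) \<le> 1 * (L * y powr \<alpha>)"
      using r0 L_ge_1 by (intro mult_right_mono) auto
    then show ?thesis using QW1[OF y] QWL[OF y] by (simp add: W_def)
  qed
  have QQW: "Q (Q W) y \<le> Q W y" if "y \<in> {0..1}" for y
    by (rule Q_mono[OF that Qbb bb QW])
  have p1: "0 < p 1" "p 1 \<le> 1" using q1 q_eq[of 1] p_le_1 by auto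
  obtain d\<^sub>0 where d0: "0 < d\<^sub>0" "d\<^sub>0 \<le> 1" "\<And>y. 0 \<le> y \<Longrightarrow> y \<le> d\<^sub>0 \<Longrightarrow> L * y powr \<alpha> \<le> 1 / 2"
    using small_radius by blast
  have "\<exists>d>0. \<forall>y\<in>{0..1}. dist y 1 < d \<longrightarrow> dist (p y) (p 1) < p 1 / 2"
    using continuous_p p1 unfolding continuous_on_iff by (metis atLeastAtMost_iff half_gt_zero order_refl zero_le_one)
  then obtain d\<^sub>1 where d1: "0 < d\<^sub>1" "\<And>y. y \<in> {0..1} \<Longrightarrow> dist y 1 < d\<^sub>1 \<Longrightarrow> dist (p y) (p 1) < p 1 / 2"
    by blast
  \<comment> \<open>\<open>d\<^sub>0\<close> makes \<open>W\<close> at most 1/2 near 0, and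
    \<open>d\<^sub>1\<close> keeps \<open>p\<close> above \<open>p 1 / 2\<close> near 1; halving
    \<open>d\<^sub>1\<close> gives the strict inequality in the continuity statement.\<close>
  define d where "d = min d\<^sub>0 (d\<^sub>1 / 2)"
  have d: "0 < d" "d \<le> 1" using d0 d1 by (auto simp: d_def)
  have pd: "p 1 / 2 \<le> p y" if "y \<in> {0..1}" "1 - d \<le> y" for y
  proof -
    have "dist y 1 < d\<^sub>1" using that d1(1) by (auto simp: dist_real_def d_def)
    then have "\<bar>p y - p 1\<bar> < p 1 / 2" using d1(2) that by (simp add: dist_real_def)
    then show ?thesis by linarith
  qed
  have Wd: "W y \<le> 1 / 2" if "0 \<le> y" "y \<le> d" for y using d0(3)[of y] that by (simp add: W_def d_def min_le_iff_disj)
  \<comment> \<open>From a point near 1: a downward move of weight at least \<open>p 1 / 2\<close>,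
    landing in \<open>{0..d}\<close> with probability at least \<open>d\<close>, where
    \<open>1 - W\<close> is at least 1/2. Near 0 the loss is already 1/2.\<close>
  let ?c = "p 1 * d / 4"
  have c: "0 < ?c" "?c \<le> 1 / 4" using p1 d by (auto simp: mult_le_one)
  have "?c \<le> 1 - Q W y" if y: "y \<in> {0..1}" "y \<le> d \<or> 1 - d \<le> y" for y
  proof (cases "y \<le> d")
    case True then show ?thesis using QW[OF y(1)] Wd[of y] y c by auto
  next
    case False
    then have "?c \<le> p y * (1 / 2 * d)" using pd[of y] y d mult_right_mono[of "p 1 / 2" "p y" "d / 2"] by auto
    also have "\<dots> \<le> Q (\<lambda>z. 1 - W z) y"
      by (rule Q_ge_down) (use y d W01 Wd bb in \<open>auto intro!: bounded_borel_diff\<close>)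
    finally show ?thesis using Q_one_minus[OF y(1) bb] by simp
  qed
  \<comment> \<open>The outer application of \<open>Q\<close>: neighbourhoods of the endpoints,
    where \<open>1 - Q W\<close> is at least \<open>?c\<close>, are reached with probability at
    least \<open>d\<close> from everywhere.\<close>
  then have "?c * d \<le> Q (\<lambda>z. 1 - Q W z) y" if "y \<in> {0..1}" for y
    by (intro Q_ge_spread that bounded_borel_diff bounded_borel_const Qbb) (use d QW1 in auto)
  then have c': "Q (Q W) y \<le> 1 - ?c * d" if "y \<in> {0..1}" for y
    using Q_one_minus[OF that Qbb] that by fastforce
  let ?r = "max r\<^sub>0 (1 - ?c * d)"
  have "Q (Q W) y \<le> ?r * W y" if y: "y \<in> {0..1}" for y
  \<comment> \<open>Below the cap the one-step contraction suffices; on the cap \<open>W\<close> is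
    1 and the uniform loss \<open>?c * d\<close> is used.\<close>
  proof (cases "L * y powr \<alpha> \<le> 1")
    case True
    then have "Q (Q W) y \<le> r\<^sub>0 * W y" using QQW[OF y] QWL[OF y] by (simp add: W_def)
    also have "\<dots> \<le> ?r * W y" using W01 by (intro mult_right_mono) auto
    finally show ?thesis .
  next
    case False then show ?thesis using c'[OF y] by (simp add: W_def)
  qed
  moreover have "0 < ?r" "?r < 1" using r0 c d by auto
  ultimately show thesis using that[OF bb W01 Wlow] by blast
qed

text \<open>The reflection of \<open>lyapunov_absorbing_0\<close>, with \<open>W (1 - y)\<close> as
  the new function.\<close>

lemma lyapunov_absorbing_1:
  assumes p0: "p 0 < 1" and q1: "q 1 = 1"
  obtains W r where "W \<in> bounded_borel" "\<And>y. y \<in> {0..1} \<Longrightarrow> 0 \<le> W y" "\<And>y. y \<in> {0..1} \<Longrightarrow> W y \<le> (1::real)"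
    "\<And>y. y \<in> {0..1} \<Longrightarrow> (1 - y) powr \<alpha> \<le> W y" "0 < r" "r < 1" "\<And>y. y \<in> {0..1} \<Longrightarrow> Q (Q W) y \<le> r * W y"
proof -
  interpret R: holder_weights "\<lambda>x. q (1 - x)" "\<lambda>x. p (1 - x)" \<alpha> M by (rule reflect_holder)
  obtain W r where W: "W \<in> bounded_borel" "\<And>y. y \<in> {0..1} \<Longrightarrow> 0 \<le> W y" "\<And>y. y \<in> {0..1} \<Longrightarrow> W y \<le> (1::real)"
    "\<And>y. y \<in> {0..1} \<Longrightarrow> y powr \<alpha> \<le> W y" and r: "0 < r" "r < 1"
    and QQ: "\<And>y. y \<in> {0..1} \<Longrightarrow> R.Q (R.Q W) y \<le> r * W y"
    using R.lyapunov_absorbing_0 p0 q1 by auto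
  have refl: "Q (\<lambda>y. f (1 - y)) = (\<lambda>x. R.Q f (1 - x))" for f :: "real \<Rightarrow> real"
    using DF_op_reflect[of q p f] by (simp add: fun_eq_iff)
  show thesis
  proof (rule that[of "\<lambda>y. W (1 - y)" r])
    show "Q (Q (\<lambda>y. W (1 - y))) y \<le> r * W (1 - y)" if "y \<in> {0..1}" for y
      unfolding refl refl[of "R.Q W"] using QQ[of "1 - y"] that by simp
  qed (use W r bounded_borel_reflect[OF W(1)] in auto)
qed

text \<open>Abstract in the absorbing point \<open>a\<close> and in \<open>W\<close>, so that either
  endpoint is an instance. The lower bound on \<open>W\<close> serves twice: it makes
  \<open>a\<close> the only possible zero, and it dominates Hoelder increments at
  \<open>a\<close>.\<close>

lemma absorbing_conclusion:
  fixes W :: "real \<Rightarrow> real"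
  assumes a: "a \<in> {0..1}" and fix_a: "\<And>f :: real \<Rightarrow> complex. f \<in> bounded_borel \<Longrightarrow> Q f a = f a"
    and W: "W \<in> bounded_borel" "\<And>y. y \<in> {0..1} \<Longrightarrow> 0 \<le> W y" "\<And>y. y \<in> {0..1} \<Longrightarrow> W y \<le> 1"
      "\<And>y. y \<in> {0..1} \<Longrightarrow> \<bar>y - a\<bar> powr \<alpha> \<le> W y"
    and r: "0 < r" "r < 1" and QQ: "\<And>y. y \<in> {0..1} \<Longrightarrow> Q (Q W) y \<le> r * W y"
  shows "DF_invariant p q \<nu> \<longleftrightarrow> \<nu> = return unit_borel a"
    and "\<exists>\<kappa>>0. \<exists>\<rho>. 0 \<le> \<rho> \<and> \<rho> < 1 \<and>
          (\<forall>\<phi>::real \<Rightarrow> complex. \<phi> \<in> holder \<alpha> \<longrightarrow> (\<forall>x\<in>{0..1}. \<forall>n.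
             norm ((Q ^^ n) \<phi> x - \<phi> a) \<le> \<kappa> * \<rho> ^ n * holder_norm \<alpha> \<phi>))"
proof -
  show "DF_invariant p q \<nu> \<longleftrightarrow> \<nu> = return unit_borel a"
  proof
    assume \<nu>: "DF_invariant p q \<nu>"
    note sp = invariant_space[OF \<nu>]
    have "AE y in \<nu>. y = a"
      using invariant_lyapunov[OF \<nu> W(1,2) r(2) QQ, simplified] AE_space
    proof eventually_elim
      case (elim y)
      then show ?case using W(4)[of y] sp(3) powr_gt_zero[of "\<bar>y - a\<bar>" \<alpha>] by force
    qed
    then show "\<nu> = return unit_borel a" using eq_return_if_AE sp a by simp
  qed (use invariant_return[OF a fix_a] in simp)
  obtain \<kappa> \<rho> where \<kappa>: "\<kappa> > 0" "0 < \<rho>" "\<rho> < 1" "\<And>n x. x \<in> {0..1} \<Longrightarrow> (Q ^^ n) W x \<le> \<kappa> * \<rho> ^ n"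
    using lyapunov_decay[OF W(1-3) r QQ] by blast
  have "norm ((Q ^^ n) \<phi> x - \<phi> a) \<le> \<kappa> * \<rho> ^ n * holder_norm \<alpha> \<phi>"
    if \<phi>: "\<phi> \<in> holder \<alpha>" and x: "x \<in> {0..1}" for \<phi> :: "real \<Rightarrow> complex" and x n
  proof -
    note bb = bounded_borel_continuous[OF holder_continuous_on[OF \<phi> \<alpha>(1)]]
    have "(Q ^^ n) \<phi> x - \<phi> a = (Q ^^ n) (\<lambda>y. \<phi> y - \<phi> a) x"
      by (simp only: Qn_diff[OF x bb bounded_borel_const] Qn_const[OF x])
    also have "norm \<dots> \<le> holder_norm \<alpha> \<phi> * (Q ^^ n) W x"
    proof (rule norm_Qn_le_mult[OF x bounded_borel_diff[OF bb bounded_borel_const] W(1)])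
      fix y :: real assume y: "y \<in> {0..1}"
      have "norm (\<phi> y - \<phi> a) \<le> holder_norm \<alpha> \<phi> * \<bar>y - a\<bar> powr \<alpha>"
        using holder_norm_diff[OF \<phi> \<alpha>(1) y a] .
      also have "\<dots> \<le> holder_norm \<alpha> \<phi> * W y"
        by (rule mult_left_mono[OF W(4)[OF y] holder_norm_nonneg[OF \<phi> \<alpha>(1)]])
      finally show "norm (\<phi> y - \<phi> a) \<le> holder_norm \<alpha> \<phi> * W y" .
    qed
    also have "\<dots> \<le> holder_norm \<alpha> \<phi> * (\<kappa> * \<rho> ^ n)"
      by (rule mult_left_mono[OF \<kappa>(4)[OF x] holder_norm_nonneg[OF \<phi> \<alpha>(1)]])
    finally show ?thesis by (simp add: mult_ac)
  qed
  then show "\<exists>\<kappa>>0. \<exists>\<rho>. 0 \<le> \<rho> \<and> \<rho> < 1 \<and>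
          (\<forall>\<phi>::real \<Rightarrow> complex. \<phi> \<in> holder \<alpha> \<longrightarrow> (\<forall>x\<in>{0..1}. \<forall>n.
             norm ((Q ^^ n) \<phi> x - \<phi> a) \<le> \<kappa> * \<rho> ^ n * holder_norm \<alpha> \<phi>))"
    using \<kappa>(1,3) less_imp_le[OF \<kappa>(2)] by blast
qed

end

section \<open>Two absorbing endpoints\<close>

context holder_weights
begin

text \<open>A Doeblin-Fortet inequality. Both moves multiply distances by t, so averaging shrinks
  the Hoelder constant by 1 / (1 + \<alpha>); the variation of the weights adds 2 M, since both
  averages lie in [-1, 1].\<close>

lemma Q_holder_bound:
  fixes f :: "real \<Rightarrow> real"
  assumes f: "f \<in> bounded_borel" "\<And>y. y \<in> {0..1} \<Longrightarrow> \<bar>f y\<bar> \<le> 1"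
    and fC: "\<And>x y. x \<in> {0..1} \<Longrightarrow> y \<in> {0..1} \<Longrightarrow> \<bar>f x - f y\<bar> \<le> C * \<bar>x - y\<bar> powr \<alpha>"
    and x: "x \<in> {0..1}" and y: "y \<in> {0..1}"
  shows "\<bar>Q f x - Q f y\<bar> \<le> (C / (1 + \<alpha>) + 2 * M) * \<bar>x - y\<bar> powr \<alpha>"
proof -
  let ?D = "\<bar>x - y\<bar> powr \<alpha>"
  define A where "A = (\<lambda>x. LINT t|unit_lebesgue. f (t * x))"
  define B where "B = (\<lambda>x. LINT t|unit_lebesgue. f (t * x + 1 - t))"
  have pw: "(LINT t|unit_lebesgue. (C * ?D) * t powr \<alpha>) = C / (1 + \<alpha>) * ?D"
    by (simp add: LINT_unit_lebesgue_powr \<alpha>)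
  have ipw: "integrable unit_lebesgue (\<lambda>t. (C * ?D) * t powr \<alpha>)"
    by (intro integrable_mult_right integrable_unit_lebesgue_powr \<alpha>)
  have one: "\<bar>LINT t|unit_lebesgue. g t\<bar> \<le> 1" if "integrable unit_lebesgue g" "\<And>t. t \<in> {0..1} \<Longrightarrow> \<bar>g t\<bar> \<le> 1"
    for g :: "real \<Rightarrow> real"
  proof -
    have "\<bar>LINT t|unit_lebesgue. g t\<bar> \<le> (LINT t|unit_lebesgue. \<bar>g t\<bar>)" using integral_norm_bound[of unit_lebesgue g] by (simp only: real_norm_def)
    also have "\<dots> \<le> (LINT t|unit_lebesgue. 1)"
      by (rule integral_mono[OF integrable_abs[OF that(1)]])
        (use that(2) in \<open>auto intro!: integrable_unit_lebesgue simp: space_restrict_space\<close>)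
    finally show ?thesis by (simp only: LINT_unit_lebesgue_const)
  qed
  have A1: "\<bar>A y\<bar> \<le> 1" and B1: "\<bar>B y\<bar> \<le> 1"
    unfolding A_def B_def
    by (intro one integrable_down integrable_up f down_mem up_mem y; assumption)+
  have le: "\<bar>f (t * x) - f (t * y)\<bar> \<le> (C * ?D) * t powr \<alpha>"
    "\<bar>f (t * x + 1 - t) - f (t * y + 1 - t)\<bar> \<le> (C * ?D) * t powr \<alpha>" if t: "t \<in> {0..1}" for t
  proof -
    have "\<bar>t * (x - y)\<bar> powr \<alpha> = ?D * t powr \<alpha>" using t by (simp add: abs_mult powr_mult)
    moreover have "t * x - t * y = t * (x - y)" "t * x + 1 - t - (t * y + 1 - t) = t * (x - y)"
      by (simp_all add: algebra_simps)
    ultimately show "\<bar>f (t * x) - f (t * y)\<bar> \<le> (C * ?D) * t powr \<alpha>"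
      "\<bar>f (t * x + 1 - t) - f (t * y + 1 - t)\<bar> \<le> (C * ?D) * t powr \<alpha>"
      using fC[OF down_mem[OF t x] down_mem[OF t y]] fC[OF up_mem[OF t x] up_mem[OF t y]]
      by (simp_all add: mult_ac)
  qed
  have Ad: "\<bar>A x - A y\<bar> \<le> C / (1 + \<alpha>) * ?D"
  proof -
    note i = integrable_down[OF f(1) x] integrable_down[OF f(1) y]
    have "\<bar>A x - A y\<bar> = \<bar>LINT t|unit_lebesgue. f (t * x) - f (t * y)\<bar>"
      unfolding A_def by (subst Bochner_Integration.integral_diff[OF i]) simp
    also have "\<dots> \<le> (LINT t|unit_lebesgue. \<bar>f (t * x) - f (t * y)\<bar>)"
      using integral_norm_bound[of unit_lebesgue "\<lambda>t. f (t * x) - f (t * y)"] by (simp only: real_norm_def)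
    also have "\<dots> \<le> (LINT t|unit_lebesgue. (C * ?D) * t powr \<alpha>)"
      by (rule integral_mono[OF integrable_abs[OF Bochner_Integration.integrable_diff[OF i]] ipw])
        (rule le, simp add: space_restrict_space)
    finally show ?thesis unfolding pw .
  qed
  have Bd: "\<bar>B x - B y\<bar> \<le> C / (1 + \<alpha>) * ?D"
  proof -
    note i = integrable_up[OF f(1) x] integrable_up[OF f(1) y]
    have "\<bar>B x - B y\<bar> = \<bar>LINT t|unit_lebesgue. f (t * x + 1 - t) - f (t * y + 1 - t)\<bar>"
      unfolding B_def by (subst Bochner_Integration.integral_diff[OF i]) simp
    also have "\<dots> \<le> (LINT t|unit_lebesgue. \<bar>f (t * x + 1 - t) - f (t * y + 1 - t)\<bar>)"
      using integral_norm_bound[of unit_lebesgue "\<lambda>t. f (t * x + 1 - t) - f (t * y + 1 - t)"] by (simp only: real_norm_def)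
    also have "\<dots> \<le> (LINT t|unit_lebesgue. (C * ?D) * t powr \<alpha>)"
      by (rule integral_mono[OF integrable_abs[OF Bochner_Integration.integrable_diff[OF i]] ipw])
        (rule le, simp add: space_restrict_space)
    finally show ?thesis unfolding pw .
  qed
  \<comment> \<open>As q = 1 - p, the two weights have opposite increments, which therefore act on
    the difference of the averages.\<close>
  have "Q f x - Q f y = p x * (A x - A y) + q x * (B x - B y) + (p x - p y) * (A y - B y)"
    using x y by (simp add: DF_op_eq A_def B_def q_eq algebra_simps)
  also have "\<bar>\<dots>\<bar> \<le> p x * \<bar>A x - A y\<bar> + q x * \<bar>B x - B y\<bar> + \<bar>p x - p y\<bar> * \<bar>A y - B y\<bar>"
    using p_nonneg[OF x] q_nonneg[OF x]
    by (intro order_trans[OF abs_triangle_ineq] add_mono) (auto simp: abs_mult)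
  also have "\<dots> \<le> p x * (C / (1 + \<alpha>) * ?D) + q x * (C / (1 + \<alpha>) * ?D) + (M * ?D) * 2"
    by (intro add_mono mult_mono Ad Bd p_diff x y p_nonneg q_nonneg order_refl abs_ge_zero)
      (use A1 B1 M in auto)
  also have "\<dots> = (p x + q x) * (C / (1 + \<alpha>) * ?D) + (M * ?D) * 2" by (simp only: distrib_right)
  also have "\<dots> = (C / (1 + \<alpha>) + 2 * M) * ?D" using x by (simp add: q_eq algebra_simps)
  finally show ?thesis .
qed

text \<open>The map C to C / (1 + \<alpha>) + 2 M does not increase any C at or above its fixed
  point 2 M (1 + \<alpha>) / \<alpha>, so such a constant survives all iterations.\<close>

lemma Qn_holder_bound:
  fixes f :: "real \<Rightarrow> real"
  assumes f: "f \<in> bounded_borel" "\<And>y. y \<in> {0..1} \<Longrightarrow> \<bar>f y\<bar> \<le> 1"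
    and fC: "\<And>x y. x \<in> {0..1} \<Longrightarrow> y \<in> {0..1} \<Longrightarrow> \<bar>f x - f y\<bar> \<le> C * \<bar>x - y\<bar> powr \<alpha>"
    and C: "2 * M * (1 + \<alpha>) / \<alpha> \<le> C"
    and x: "x \<in> {0..1}" and y: "y \<in> {0..1}"
  shows "\<bar>(Q ^^ n) f x - (Q ^^ n) f y\<bar> \<le> C * \<bar>x - y\<bar> powr \<alpha>"
  using x y
proof (induction n arbitrary: x y)
  case (Suc n)
  have bb: "(Q ^^ n) f \<in> bounded_borel" by (rule Qn_bounded_borel[OF f(1)])
  have 1: "\<bar>(Q ^^ n) f y\<bar> \<le> 1" if "y \<in> {0..1}" for y
    using norm_Qn_le[OF that f(1) bounded_borel_const[of 1], of n] f(2)
      Qn_const[OF that, of n "1::real"] by simp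
  have "\<bar>Q ((Q ^^ n) f) x - Q ((Q ^^ n) f) y\<bar> \<le> (C / (1 + \<alpha>) + 2 * M) * \<bar>x - y\<bar> powr \<alpha>"
    by (rule Q_holder_bound[OF bb 1 Suc.IH Suc.prems])
  also have "C / (1 + \<alpha>) + 2 * M \<le> C" using C \<alpha> by (simp add: field_simps)
  finally show ?case by (simp add: mult_right_mono)
qed (use fC in simp)

end

section \<open>Two-sided Lyapunov function, the harmonic function and the rate\<close>

locale absorbing_weights = holder_weights +
  assumes p0: "p 0 = 1" and q1: "q 1 = 1"
begin

definition W :: "real \<Rightarrow> real" where
  "W y = min 1 (min (L * y powr \<alpha>) (L * (1 - y) powr \<alpha>))"

lemma W_bb: "W \<in> bounded_borel"
  unfolding W_def
  by (intro bounded_borel_continuous continuous_intros continuous_on_powr') (use \<alpha> in auto)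

lemma W_nonneg: "0 \<le> W y" and W_le_1: "W y \<le> 1"
  using L_ge_1 by (auto simp: W_def)

text \<open>Since L \<ge> 1 and both powers are at most 1, \<open>W\<close> is at least the minimum
  of the two plain powers.\<close>

lemma le_W:
  assumes "y \<in> {0..1}" "0 \<le> K" "z \<le> K * y powr \<alpha>" "z \<le> K * (1 - y) powr \<alpha>"
  shows "z \<le> K * W y"
proof -
  have "v \<le> min 1 (L * v)" if "0 \<le> v" "v \<le> 1" for v using that L_ge_1 mult_right_mono[of 1 L v] by auto
  then have "min (y powr \<alpha>) ((1 - y) powr \<alpha>) \<le> W y"
    using assms(1) \<alpha> powr_le_one[of y \<alpha>] powr_le_one[of "1 - y" \<alpha>]
    unfolding W_def by (smt (verit) atLeastAtMost_iff powr_ge_zero)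
  then have "K * min (y powr \<alpha>) ((1 - y) powr \<alpha>) \<le> K * W y" using assms by (intro mult_left_mono)
  then show ?thesis using assms by (auto simp: min_def split: if_splits)
qed

text \<open>A neighbourhood of \<open>{0, 1}\<close> is reached in one step from everywhere, so here a single application of
  \<open>Q\<close> contracts \<open>W\<close>.\<close>

lemma Q_W: obtains r where "0 < r" "r < 1" "\<And>y. y \<in> {0..1} \<Longrightarrow> Q W y \<le> r * W y"
proof -
  obtain d where d: "0 < d" "d \<le> 1" "\<And>y. 0 \<le> y \<Longrightarrow> y \<le> d \<Longrightarrow> L * y powr \<alpha> \<le> 1 / 2"
    using small_radius by blast
  let ?r = "max r\<^sub>0 (1 - 1 / 2 * d)"
  have "Q W y \<le> ?r * W y" if y: "y \<in> {0..1}" for y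
  proof -
    have "Q W y \<le> L * y powr \<alpha> / (1 + \<alpha>) + q y"
      by (rule Q_le_near_0[OF y W_bb \<alpha>(1)]) (use L_ge_1 in \<open>auto simp: W_def\<close>)
    moreover have "q y \<le> M * y powr \<alpha>" using q_diff[of y 0] y p0 by (simp add: q_eq)
    ultimately have 0: "Q W y \<le> r\<^sub>0 * (L * y powr \<alpha>)" using L_contract[of "y powr \<alpha>"] by simp
    have "Q W y \<le> L * (1 - y) powr \<alpha> / (1 + \<alpha>) + p y"
      by (rule Q_le_near_1[OF y W_bb \<alpha>(1)]) (use L_ge_1 in \<open>auto simp: W_def\<close>)
    moreover have "p y \<le> M * (1 - y) powr \<alpha>"
      using p_diff[of y 1] y q1 q_eq[of 1] by (simp add: abs_minus_commute)
    ultimately have 1: "Q W y \<le> r\<^sub>0 * (L * (1 - y) powr \<alpha>)" using L_contract[of "(1 - y) powr \<alpha>"] by simp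
    \<comment> \<open>This treats the cap of \<open>W\<close>; the facts \<open>0\<close> and
      \<open>1\<close> treat the two powers in the minimum. Within \<open>d\<close> of either
      endpoint \<open>1 - W\<close> is at least 1/2.\<close>
    have "1 / 2 * d \<le> Q (\<lambda>z. 1 - W z) y"
    proof (rule Q_ge_spread[OF y bounded_borel_diff[OF bounded_borel_const W_bb]])
      show "1 / 2 \<le> 1 - W z" if "z \<in> {0..1}" "z \<le> d \<or> 1 - d \<le> z" for z
        using that d(3)[of z] d(3)[of "1 - z"] by (auto simp: W_def min_le_iff_disj)
    qed (use d W_le_1 in auto)
    then have 2: "Q W y \<le> 1 - 1 / 2 * d" using Q_one_minus[OF y W_bb] by simp
    have mono: "z * v \<le> ?r * v" if "z \<le> ?r" "0 \<le> v" for z v using that by (rule mult_right_mono)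
    have "Q W y \<le> ?r * (L * y powr \<alpha>)" by (rule order_trans[OF 0 mono]) (use L_ge_1 in auto)
    moreover have "Q W y \<le> ?r * (L * (1 - y) powr \<alpha>)" by (rule order_trans[OF 1 mono]) (use L_ge_1 in auto)
    moreover have "Q W y \<le> ?r * 1" using 2 by simp
    ultimately
    show ?thesis unfolding W_def min_def by (auto split: if_splits)
  qed
  moreover have "0 < ?r" "?r < 1" using r0 d by auto
  ultimately show thesis using that by blast
qed

lemma W_decay: "\<exists>\<kappa>>0. \<exists>\<rho>::real. 0 < \<rho> \<and> \<rho> < 1 \<and> (\<forall>n. \<forall>x\<in>{0..1}. (Q ^^ n) W x \<le> \<kappa> * \<rho> ^ n)"
proof -
  obtain r where r: "0 < r" "r < 1" "\<And>y. y \<in> {0..1} \<Longrightarrow> Q W y \<le> r * W y" using Q_W by blast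
  have rW: "r * W y \<le> W y" for y using r W_nonneg[of y] by (simp add: mult_left_le_one_le)
  \<comment> \<open>\<open>lyapunov_decay\<close> asks for two steps; monotonicity of
    \<open>Q\<close> derives this from the one-step contraction.\<close>
  have "Q (Q W) y \<le> r * W y" if "y \<in> {0..1}" for y
    using Q_mono[OF that Q_bounded_borel[OF W_bb] W_bb] r rW that by (meson order_trans)
  then show ?thesis by (intro lyapunov_decay[OF W_bb W_nonneg W_le_1 r(1,2)])
qed

text \<open>The constants of \<open>W_decay\<close> are fixed once by choice, so that the later
  rates can name them.\<close>

definition \<kappa>\<^sub>W where "\<kappa>\<^sub>W = (SOME \<kappa>. \<kappa> > 0 \<and> (\<exists>\<rho>::real. 0 < \<rho> \<and> \<rho> < 1 \<and> (\<forall>n. \<forall>x\<in>{0..1}. (Q ^^ n) W x \<le> \<kappa> * \<rho> ^ n)))"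
definition \<rho>\<^sub>W where "\<rho>\<^sub>W = (SOME \<rho>::real. 0 < \<rho> \<and> \<rho> < 1 \<and> (\<forall>n. \<forall>x\<in>{0..1}. (Q ^^ n) W x \<le> \<kappa>\<^sub>W * \<rho> ^ n))"

lemma \<kappa>\<^sub>W: "0 < \<kappa>\<^sub>W"
  and \<rho>\<^sub>W: "0 < \<rho>\<^sub>W" "\<rho>\<^sub>W < 1"
  and W_bound: "x \<in> {0..1} \<Longrightarrow> (Q ^^ n) W x \<le> \<kappa>\<^sub>W * \<rho>\<^sub>W ^ n"
proof -
  have *: "\<kappa>\<^sub>W > 0 \<and> (\<exists>\<rho>::real. 0 < \<rho> \<and> \<rho> < 1 \<and> (\<forall>n. \<forall>x\<in>{0..1}. (Q ^^ n) W x \<le> \<kappa>\<^sub>W * \<rho> ^ n))"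
    unfolding \<kappa>\<^sub>W_def using W_decay by (rule someI_ex)
  then show "0 < \<kappa>\<^sub>W" by simp
  have "0 < \<rho>\<^sub>W \<and> \<rho>\<^sub>W < 1 \<and> (\<forall>n. \<forall>x\<in>{0..1}. (Q ^^ n) W x \<le> \<kappa>\<^sub>W * \<rho>\<^sub>W ^ n)"
    unfolding \<rho>\<^sub>W_def using *[THEN conjunct2] by (rule someI_ex)
  then show "0 < \<rho>\<^sub>W" "\<rho>\<^sub>W < 1" "x \<in> {0..1} \<Longrightarrow> (Q ^^ n) W x \<le> \<kappa>\<^sub>W * \<rho>\<^sub>W ^ n" by auto
qed

text \<open>The form in which the decay of \<open>W\<close> is used: \<open>K\<close> is a common
  Hoelder constant at the two endpoints, where \<open>f\<close> vanishes.\<close>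

lemma norm_Qn_bound:
  fixes f :: "real \<Rightarrow> 'a::{banach,second_countable_topology}"
  assumes x: "x \<in> {0..1}" and f: "f \<in> bounded_borel" and K: "0 \<le> K"
    and 0: "\<And>y. y \<in> {0..1} \<Longrightarrow> norm (f y) \<le> K * y powr \<alpha>"
    and 1: "\<And>y. y \<in> {0..1} \<Longrightarrow> norm (f y) \<le> K * (1 - y) powr \<alpha>"
  shows "norm ((Q ^^ n) f x) \<le> K * (\<kappa>\<^sub>W * \<rho>\<^sub>W ^ n)"
proof -
  have "norm ((Q ^^ n) f x) \<le> K * (Q ^^ n) W x"
    by (rule norm_Qn_le_mult[OF x f W_bb le_W[OF _ K 0 1]])
  also have "\<dots> \<le> K * (\<kappa>\<^sub>W * \<rho>\<^sub>W ^ n)" using W_bound[OF x] K by (rule mult_left_mono)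
  finally show ?thesis .
qed

text \<open>The mean position of the chain after \<open>n\<close> steps as a function of its
  starting point, compare \<open>LINT_Z\<close>.\<close>

definition u :: "nat \<Rightarrow> real \<Rightarrow> real" where "u n = (Q ^^ n) (\<lambda>x. x)"

lemma id_bb: "(\<lambda>x::real. x) \<in> bounded_borel"
  by (rule bounded_borel_continuous) auto

lemma u_bb: "u n \<in> bounded_borel" unfolding u_def by (rule Qn_bounded_borel[OF id_bb])

lemma u_Suc: "u (Suc n) = Q (u n)" by (simp add: u_def)

text \<open>The threshold of \<open>Qn_holder_bound\<close>, raised to at least 1 because 1 is a
  Hoelder constant of the identity on the unit interval.\<close>

definition C\<^sub>u :: real where "C\<^sub>u = max 1 (2 * M * (1 + \<alpha>) / \<alpha>)"

lemma abs_le_powr: "\<bar>z\<bar> \<le> 1 \<Longrightarrow> \<bar>z\<bar> \<le> \<bar>z\<bar> powr \<alpha>" for z :: real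
  using \<alpha> powr_mono'[of \<alpha> 1 "\<bar>z\<bar>"] by (cases "z = 0") auto

text \<open>The constant does not depend on \<open>n\<close>, which is what makes the limit
  \<open>h\<close> Hoelder continuous.\<close>

lemma u_holder: "x \<in> {0..1} \<Longrightarrow> y \<in> {0..1} \<Longrightarrow> \<bar>u n x - u n y\<bar> \<le> C\<^sub>u * \<bar>x - y\<bar> powr \<alpha>"
  unfolding u_def
proof (rule Qn_holder_bound[OF id_bb])
  show "\<bar>x - y\<bar> \<le> C\<^sub>u * \<bar>x - y\<bar> powr \<alpha>" if "x \<in> {0..1}" "y \<in> {0..1}" for x y
  proof -
    have "\<bar>x - y\<bar> \<le> 1 * \<bar>x - y\<bar> powr \<alpha>" using abs_le_powr[of "x - y"] that by (auto simp: abs_if)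
    also have "\<dots> \<le> C\<^sub>u * \<bar>x - y\<bar> powr \<alpha>" by (intro mult_right_mono) (auto simp: C\<^sub>u_def)
    finally show ?thesis .
  qed
qed (auto simp: C\<^sub>u_def)

lemma u_0: "u n 0 = 0"
  by (induction n) (simp_all add: u_def Q_at_0[OF p0])

lemma u_1: "u n 1 = 1"
  by (induction n) (simp_all add: u_def Q_at_1[OF q1])

lemma C\<^sub>u_ge_1: "1 \<le> C\<^sub>u" by (simp add: C\<^sub>u_def)

text \<open>The increment is \<open>Q ^^ n\<close> applied to \<open>u 1 - u 0\<close>, a Hoelder
  function with constant twice \<open>C\<^sub>u\<close> that vanishes at both absorbing
  endpoints.\<close>

lemma u_step:
  assumes x: "x \<in> {0..1}" shows "\<bar>u (Suc n) x - u n x\<bar> \<le> (2 * C\<^sub>u) * (\<kappa>\<^sub>W * \<rho>\<^sub>W ^ n)"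
proof -
  have eq: "u (Suc n) x - u n x = (Q ^^ n) (\<lambda>y. u 1 y - u 0 y) x"
    by (subst Qn_diff[OF x u_bb u_bb]) (simp add: u_def funpow_swap1)
  have "norm ((Q ^^ n) (\<lambda>y. u 1 y - u 0 y) x) \<le> (2 * C\<^sub>u) * (\<kappa>\<^sub>W * \<rho>\<^sub>W ^ n)"
  proof (rule norm_Qn_bound[OF x bounded_borel_diff[OF u_bb u_bb]])
    fix y :: real assume y: "y \<in> {0..1}"
    show "norm (u 1 y - u 0 y) \<le> (2 * C\<^sub>u) * y powr \<alpha>"
      using u_holder[OF y, of 0 1] u_holder[OF y, of 0 0] y u_0[of 0] u_0[of 1] by auto
    show "norm (u 1 y - u 0 y) \<le> (2 * C\<^sub>u) * (1 - y) powr \<alpha>"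
      using u_holder[OF y, of 1 1] u_holder[OF y, of 1 0] y u_1[of 0] u_1[of 1] 
      by (auto simp: abs_minus_commute)
  qed (use C\<^sub>u_ge_1 in auto)
  then show ?thesis by (simp add: eq)
qed

definition h :: "real \<Rightarrow> real" where "h x = lim (\<lambda>n. u n x)"

lemma u_tendsto:
  assumes x: "x \<in> {0..1}" shows "(\<lambda>n. u n x) \<longlonglongrightarrow> h x"
proof -
  have "summable (\<lambda>n. (2 * C\<^sub>u) * (\<kappa>\<^sub>W * \<rho>\<^sub>W ^ n))"
    using \<rho>\<^sub>W by (intro summable_mult summable_geometric) auto
  then have "summable (\<lambda>n. u (Suc n) x - u n x)"
    by (rule summable_comparison_test'[where N=0]) (use u_step[OF x] in auto)
  then have "convergent (\<lambda>n. u n x)" by (simp add: summable_iff_convergent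
    sum_lessThan_telescope[of "\<lambda>n. u n x"] convergent_diff_const_right_iff)
  then show ?thesis unfolding h_def by (simp add: convergent_LIMSEQ_iff)
qed

lemma h_holder:
  assumes "x \<in> {0..1}" "y \<in> {0..1}" shows "\<bar>h x - h y\<bar> \<le> C\<^sub>u * \<bar>x - y\<bar> powr \<alpha>"
  by (rule LIMSEQ_le_const2[OF tendsto_rabs[OF tendsto_diff[OF u_tendsto[OF assms(1)] u_tendsto[OF assms(2)]]]])
    (use u_holder[OF assms] in auto)

lemma h_0: "h 0 = 0" and h_1: "h 1 = 1"
  using u_tendsto[of 0] u_tendsto[of 1] by (simp_all add: u_0 u_1 LIMSEQ_const_iff)

lemma h_bb: "h \<in> bounded_borel"
proof -
  have "h \<in> holder \<alpha>" unfolding holder_def real_norm_def using h_holder by blast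
  then show ?thesis by (intro bounded_borel_continuous holder_continuous_on[OF _ \<alpha>(1)])
qed

text \<open>\<open>Q (u n)\<close> is \<open>u (Suc n)\<close>, and \<open>Q\<close> passes to
  bounded pointwise limits by dominated convergence in both integrals.\<close>

lemma Q_h:
  assumes x: "x \<in> {0..1}" shows "Q h x = h x"
proof -
  have u1: "\<bar>u n y\<bar> \<le> 1" if "y \<in> {0..1}" for n y
    using norm_Qn_le[OF that id_bb bounded_borel_const[of 1], of n]
      Qn_const[OF that, of n "1::real"] that by (simp add: u_def)
  have meas: "g \<in> bounded_borel \<Longrightarrow> (\<lambda>t. g (t * x)) \<in> borel_measurable unit_lebesgue"
    "g \<in> bounded_borel \<Longrightarrow> (\<lambda>t. g (t * x + 1 - t)) \<in> borel_measurable unit_lebesgue" for g :: "real \<Rightarrow> real"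
    using integrable_down[OF _ x, of g] integrable_up[OF _ x, of g] by auto
  have i1: "integrable unit_lebesgue (\<lambda>_. 1::real)" by (rule integrable_unit_lebesgue[where B=1]) auto
  have "(\<lambda>n. LINT t|unit_lebesgue. u n (t * x)) \<longlonglongrightarrow> (LINT t|unit_lebesgue. h (t * x))"
    by (rule integral_dominated_convergence[OF meas(1)[OF h_bb] meas(1)[OF u_bb] i1])
      (use u_tendsto u1 down_mem[OF _ x] in \<open>auto intro!: AE_I2 simp: space_restrict_space\<close>)
  moreover have "(\<lambda>n. LINT t|unit_lebesgue. u n (t * x + 1 - t)) \<longlonglongrightarrow> (LINT t|unit_lebesgue. h (t * x + 1 - t))"
    by (rule integral_dominated_convergence[OF meas(2)[OF h_bb] meas(2)[OF u_bb] i1])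
      (use u_tendsto u1 up_mem[OF _ x] in \<open>auto intro!: AE_I2 simp: space_restrict_space\<close>)
  ultimately have "(\<lambda>n. Q (u n) x) \<longlonglongrightarrow> Q h x"
    unfolding DF_op_eq by (intro tendsto_intros)
  moreover have "(\<lambda>n. Q (u n) x) \<longlonglongrightarrow> h x"
    using LIMSEQ_Suc[OF u_tendsto[OF x]] by (simp add: u_Suc)
  ultimately show ?thesis by (rule LIMSEQ_unique)
qed

lemma Q_complex_h:
  assumes "x \<in> {0..1}" shows "Q (\<lambda>y. complex_of_real (h y)) x = h x"
  using DF_op_bounded_linear[OF assms h_bb bounded_linear_of_real[where 'a=complex], of p q]
  by (simp add: Q_h[OF assms])

lemma complex_h_bb: "(\<lambda>y. complex_of_real (h y)) \<in> bounded_borel"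
  by (rule bounded_borel_bounded_linear[OF bounded_linear_of_real h_bb])

text \<open>Subtract the harmonic interpolation \<open>?g\<close> of the boundary values:
  \<open>Q\<close> fixes it and it agrees with \<phi> at both endpoints, so \<open>W\<close>
  dominates the remainder.\<close>

lemma Qn_limit:
  fixes \<phi> :: "real \<Rightarrow> complex"
  assumes \<phi>: "\<phi> \<in> holder \<alpha>" and x: "x \<in> {0..1}"
  shows "norm ((Q ^^ n) \<phi> x - (1 - h x) * \<phi> 0 - h x * \<phi> 1) \<le> ((1 + 2 * C\<^sub>u) * \<kappa>\<^sub>W) * \<rho>\<^sub>W ^ n * holder_norm \<alpha> \<phi>"
proof -
  note N = holder_norm_nonneg[OF \<phi> \<alpha>(1)]
  note bb = bounded_borel_continuous[OF holder_continuous_on[OF \<phi> \<alpha>(1)]]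
  let ?g = "\<lambda>y. \<phi> 0 + complex_of_real (h y) * (\<phi> 1 - \<phi> 0)"
  have gbb: "?g \<in> bounded_borel"
    by (intro bounded_borel_add bounded_borel_const bounded_borel_bounded_linear[OF bounded_linear_mult_left complex_h_bb])
  have Qg: "Q ?g y = ?g y" if y: "y \<in> {0..1}" for y
  proof -
    have "Q ?g y = Q (\<lambda>y. \<phi> 0) y + Q (\<lambda>y. complex_of_real (h y) * (\<phi> 1 - \<phi> 0)) y"
      by (rule DF_op_add[OF y bounded_borel_const bounded_borel_bounded_linear[OF bounded_linear_mult_left complex_h_bb]])
    also have "Q (\<lambda>y. complex_of_real (h y) * (\<phi> 1 - \<phi> 0)) y = h y * (\<phi> 1 - \<phi> 0)"
      using DF_op_bounded_linear[OF y complex_h_bb bounded_linear_mult_left] Q_complex_h[OF y] by simp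
    finally show ?thesis using y by (simp add: Q_const)
  qed
  have "(Q ^^ n) \<phi> x - (1 - h x) * \<phi> 0 - h x * \<phi> 1 = (Q ^^ n) \<phi> x - (Q ^^ n) ?g x"
    by (subst Qn_fixed[OF Qg x]) (auto simp: algebra_simps)
  also have "\<dots> = (Q ^^ n) (\<lambda>y. \<phi> y - ?g y) x" by (rule Qn_diff[OF x bb gbb, symmetric])
  \<comment> \<open>The 1 comes from \<phi> itself, the other term from \<open>h\<close>, as
    \<open>\<phi> 1 - \<phi> 0\<close> is at most twice the Hoelder norm.\<close>
  also have "norm \<dots> \<le> (holder_norm \<alpha> \<phi> * (1 + 2 * C\<^sub>u)) * (\<kappa>\<^sub>W * \<rho>\<^sub>W ^ n)"
  proof (rule norm_Qn_bound[OF x bounded_borel_diff[OF bb gbb]])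
    have N2: "norm (\<phi> 1 - \<phi> 0) \<le> 2 * holder_norm \<alpha> \<phi>"
      using norm_triangle_ineq4[of "\<phi> 1" "\<phi> 0"] norm_le_holder_norm[OF \<phi> \<alpha>(1), of 0]
        norm_le_holder_norm[OF \<phi> \<alpha>(1), of 1] by auto
    fix y :: real assume y: "y \<in> {0..1}"
    have "norm (\<phi> y - ?g y) \<le> norm (\<phi> y - \<phi> 0) + \<bar>h y - h 0\<bar> * norm (\<phi> 1 - \<phi> 0)"
      using norm_triangle_ineq4[of "\<phi> y - \<phi> 0" "h y * (\<phi> 1 - \<phi> 0)"]
      by (simp only: norm_mult norm_of_real h_0 diff_0_right diff_diff_add)
    also have "\<dots> \<le> holder_norm \<alpha> \<phi> * y powr \<alpha> + (C\<^sub>u * y powr \<alpha>) * (2 * holder_norm \<alpha> \<phi>)"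
      using holder_norm_diff[OF \<phi> \<alpha>(1) y, of 0] h_holder[OF y, of 0] y C\<^sub>u_ge_1
      by (intro add_mono mult_mono N2) auto
    finally show "norm (\<phi> y - ?g y) \<le> holder_norm \<alpha> \<phi> * (1 + 2 * C\<^sub>u) * y powr \<alpha>" by (simp add: algebra_simps)
    \<comment> \<open>The same remainder recentred at 1, using \<open>h 1 = 1\<close>.\<close>
    have "\<phi> y - ?g y = (\<phi> y - \<phi> 1) - (h y - h 1) * (\<phi> 1 - \<phi> 0)" by (simp add: h_1 algebra_simps)
    then have "norm (\<phi> y - ?g y) \<le> norm (\<phi> y - \<phi> 1) + norm ((h y - h 1) * (\<phi> 1 - \<phi> 0))"
      by (simp only: norm_triangle_ineq4)
    also have "norm ((h y - h 1) * (\<phi> 1 - \<phi> 0)) = \<bar>h y - h 1\<bar> * norm (\<phi> 1 - \<phi> 0)"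
      by (simp only: norm_mult norm_of_real)
    also have "norm (\<phi> y - \<phi> 1) + \<bar>h y - h 1\<bar> * norm (\<phi> 1 - \<phi> 0)
        \<le> holder_norm \<alpha> \<phi> * (1 - y) powr \<alpha> + (C\<^sub>u * (1 - y) powr \<alpha>) * (2 * holder_norm \<alpha> \<phi>)"
      using holder_norm_diff[OF \<phi> \<alpha>(1) y, of 1] h_holder[OF y, of 1] y C\<^sub>u_ge_1
      by (intro add_mono mult_mono N2) (auto simp: abs_minus_commute)
    finally show "norm (\<phi> y - ?g y) \<le> holder_norm \<alpha> \<phi> * (1 + 2 * C\<^sub>u) * (1 - y) powr \<alpha>" by (simp add: algebra_simps)
  qed (use N C\<^sub>u_ge_1 in auto)
  finally show ?thesis by (simp add: mult_ac)
qed

text \<open>A fixed function is its own iterate, so \<open>Qn_limit\<close> bounds its distance to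
  \<open>h\<close> by a null sequence.\<close>

lemma harmonic_unique:
  fixes g :: "real \<Rightarrow> complex"
  assumes g: "g \<in> holder \<alpha>" "\<And>x. x \<in> {0..1} \<Longrightarrow> Q g x = g x" "g 0 = 0" "g 1 = 1" and x: "x \<in> {0..1}"
  shows "g x = h x"
proof -
  have "norm (g x - h x) \<le> ((1 + 2 * C\<^sub>u) * \<kappa>\<^sub>W) * \<rho>\<^sub>W ^ n * holder_norm \<alpha> g" for n
    using Qn_limit[OF g(1) x, of n] Qn_fixed[OF g(2) x, of n] g by simp
  moreover have "(\<lambda>n. ((1 + 2 * C\<^sub>u) * \<kappa>\<^sub>W) * \<rho>\<^sub>W ^ n * holder_norm \<alpha> g) \<longlonglongrightarrow> ((1 + 2 * C\<^sub>u) * \<kappa>\<^sub>W) * 0 * holder_norm \<alpha> g"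
    using \<rho>\<^sub>W by (intro tendsto_intros LIMSEQ_realpow_zero) auto
  ultimately have "norm (g x - h x) \<le> 0"
    by (intro LIMSEQ_le_const[where X="\<lambda>n. ((1 + 2 * C\<^sub>u) * \<kappa>\<^sub>W) * \<rho>\<^sub>W ^ n * holder_norm \<alpha> g"]) auto
  then show ?thesis by simp
qed

lemma complex_h_holder: "(\<lambda>y. complex_of_real (h y)) \<in> holder \<alpha>"
  unfolding holder_def using h_holder by (auto intro!: exI[of _ "C\<^sub>u"] simp flip: of_real_diff)

end

section \<open>Convergence of the chain\<close>

text \<open>The sum has finite mean by monotone convergence, hence is finite almost surely.\<close>

lemma AE_summable_if_LINT_summable:
  fixes f :: "nat \<Rightarrow> 'w \<Rightarrow> real"
  assumes f: "\<And>n. integrable M (f n)" "\<And>n \<omega>. 0 \<le> f n \<omega>"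
    and b: "\<And>n. (LINT \<omega>|M. f n \<omega>) \<le> b n" "summable b"
  shows "AE \<omega> in M. summable (\<lambda>n. f n \<omega>)"
proof -
  have f_meas [measurable]: "f n \<in> borel_measurable M" for n using f(1) by auto
  have I0: "0 \<le> (LINT \<omega>|M. f n \<omega>)" for n using f(2) by simp
  have "(\<integral>\<^sup>+\<omega>. (\<Sum>n. ennreal (f n \<omega>)) \<partial>M) = (\<Sum>n. \<integral>\<^sup>+\<omega>. ennreal (f n \<omega>) \<partial>M)"
    by (rule nn_integral_suminf) measurable
  also have "\<dots> = (\<Sum>n. ennreal (LINT \<omega>|M. f n \<omega>))"
    by (intro suminf_cong nn_integral_eq_integral f) (use f in auto)
  also have "\<dots> = ennreal (\<Sum>n. LINT \<omega>|M. f n \<omega>)"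
    by (rule suminf_ennreal2[OF I0 summable_comparison_test'[OF b(2), of 0]])
      (use b(1) I0 in simp)
  finally have "(\<integral>\<^sup>+\<omega>. (\<Sum>n. ennreal (f n \<omega>)) \<partial>M) \<noteq> \<infinity>" by simp
  then have "AE \<omega> in M. (\<Sum>n. ennreal (f n \<omega>)) \<noteq> \<infinity>"
    by (intro nn_integral_PInf_AE) measurable
  then show ?thesis by eventually_elim (use summable_suminf_not_top f(2) in auto)
qed

section \<open>Moments along the chain\<close>

locale weights_chain = weights +
  fixes x :: real and M :: "'w measure" and Z :: "nat \<Rightarrow> 'w \<Rightarrow> real"
  assumes x: "x \<in> {0..1}" and chain: "DF_chain p q x M Z"
begin

sublocale prob_space M using chain by (simp add: DF_chain_def)

lemma measurable_Z: "Z n \<in> measurable M unit_borel"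
  using chain by (simp add: DF_chain_def)

lemma Z_mem: "\<omega> \<in> space M \<Longrightarrow> Z n \<omega> \<in> {0..1}"
  using measurable_space[OF measurable_Z] by (simp add: space_restrict_space)

lemma measurable_comp_Z: "f \<in> borel_measurable unit_borel \<Longrightarrow> (\<lambda>\<omega>. f (Z n \<omega>)) \<in> borel_measurable M"
  by (rule measurable_compose[OF measurable_Z])

lemma integrable_Z:
  fixes f :: "real \<Rightarrow> real"
  assumes f: "f \<in> bounded_borel" shows "integrable M (\<lambda>\<omega>. f (Z n \<omega>))"
proof -
  obtain B where B: "\<And>y. y \<in> {0..1} \<Longrightarrow> norm (f y) \<le> B" using f bounded_borelE by metis
  show ?thesis
    by (rule integrable_const_bound[where B=B, OF _ measurable_comp_Z[OF bounded_borelD[OF f]]])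
      (use B[OF Z_mem] in \<open>auto intro!: AE_I2\<close>)
qed

lemma integrable_Z2:
  fixes f k :: "real \<Rightarrow> real"
  assumes f: "f \<in> bounded_borel" and k: "k \<in> bounded_borel"
  shows "integrable M (\<lambda>\<omega>. k (Z m \<omega>) * f (Z n \<omega>))"
proof -
  obtain B where B: "\<And>y. y \<in> {0..1} \<Longrightarrow> norm (f y) \<le> B" using f bounded_borelE by metis
  obtain C where C: "0 \<le> C" "\<And>y. y \<in> {0..1} \<Longrightarrow> norm (k y) \<le> C" using k bounded_borelE by metis
  show ?thesis
    by (rule integrable_const_bound[where B="C * B",
          OF _ borel_measurable_times[OF measurable_comp_Z[OF bounded_borelD[OF k]] measurable_comp_Z[OF bounded_borelD[OF f]]]])
      (use B[OF Z_mem] C(1) C(2)[OF Z_mem] in \<open>auto intro!: AE_I2 mult_mono simp: abs_mult\<close>)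
qed

lemma space_past: "space (past M Z n) = space M"
  by (simp add: past_def)

lemma measurable_path: "(\<lambda>\<omega>. \<lambda>k\<in>{..n}. Z k \<omega>) \<in> measurable M (\<Pi>\<^sub>M k\<in>{..n}. unit_borel)"
  by (rule measurable_restrict) (rule measurable_Z)

lemma subalgebra_past: "subalgebra M (past M Z n)"
  unfolding subalgebra_def space_past
  using sets_image_in_sets[OF refl measurable_path, of n] by (simp add: past_def)

lemma measurable_Z_past: "Z n \<in> measurable (past M Z n) unit_borel"
proof -
  have 1: "(\<lambda>\<omega>. \<lambda>k\<in>{..n}. Z k \<omega>) \<in> measurable (past M Z n) (\<Pi>\<^sub>M k\<in>{..n}. unit_borel)"
    unfolding past_def using measurable_space[OF measurable_path]
    by (intro measurable_vimage_algebra1) auto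
  have 2: "(\<lambda>w. w n) \<in> measurable (\<Pi>\<^sub>M k\<in>{..n}. unit_borel) unit_borel"
    by (rule measurable_component_singleton) simp
  show ?thesis using measurable_compose[OF 1 2] by simp
qed

text \<open>The factor \<open>k (Z n)\<close> is measurable for the past and can be pulled out of
  the conditional expectation; it provides the cross term of a squared increment.\<close>

lemma LINT_step:
  fixes f k :: "real \<Rightarrow> real"
  assumes f: "f \<in> bounded_borel" and k: "k \<in> bounded_borel"
  shows "(LINT \<omega>|M. k (Z n \<omega>) * f (Z (Suc n) \<omega>)) = (LINT \<omega>|M. k (Z n \<omega>) * Q f (Z n \<omega>))"
proof -
  interpret finite_measure_subalgebra M "past M Z n"
    by unfold_locales (rule subalgebra_past)
  let ?E = "real_cond_exp M (past M Z n) (\<lambda>\<omega>. f (Z (Suc n) \<omega>))"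
  have km: "(\<lambda>\<omega>. k (Z n \<omega>)) \<in> borel_measurable (past M Z n)"
    by (rule measurable_compose[OF measurable_Z_past bounded_borelD[OF k]])
  have fm: "(\<lambda>\<omega>. f (Z (Suc n) \<omega>)) \<in> borel_measurable M"
    by (rule measurable_comp_Z[OF bounded_borelD[OF f]])
  note ce = real_cond_exp_intg[OF integrable_Z2[OF f k] km fm]
  have AE: "AE \<omega> in M. ?E \<omega> = Q f (Z n \<omega>)"
    using chain f by (simp add: DF_chain_def)
  have "(LINT \<omega>|M. k (Z n \<omega>) * ?E \<omega>) = (LINT \<omega>|M. k (Z n \<omega>) * Q f (Z n \<omega>))"
    by (rule integral_cong_AE[OF borel_measurable_integrable[OF ce(1)]
          borel_measurable_integrable[OF integrable_Z2[OF Q_bounded_borel[OF f] k]]])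
      (use AE in eventually_elim, simp)
  then show ?thesis using ce(2) by simp
qed

lemma LINT_Z:
  fixes f :: "real \<Rightarrow> real"
  assumes "f \<in> bounded_borel" shows "(LINT \<omega>|M. f (Z n \<omega>)) = (Q ^^ n) f x"
  using assms
\<comment> \<open>The induction step passes from \<open>f\<close> to \<open>Q f\<close>.\<close>
proof (induction n arbitrary: f)
  case 0
  have "AE \<omega> in M. Z 0 \<omega> = x" using chain by (simp add: DF_chain_def)
  then have "AE \<omega> in M. f (Z 0 \<omega>) = f x" by eventually_elim simp
  then have "(LINT \<omega>|M. f (Z 0 \<omega>)) = (LINT \<omega>|M. f x)"
    by (intro integral_cong_AE borel_measurable_integrable[OF integrable_Z[OF 0]]) auto
  then show ?case by (simp add: prob_space)
next
  case (Suc n)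
  have "(LINT \<omega>|M. f (Z (Suc n) \<omega>)) = (LINT \<omega>|M. Q f (Z n \<omega>))"
    using LINT_step[OF Suc.prems bounded_borel_const[of 1], of n] by simp
  also have "\<dots> = (Q ^^ n) (Q f) x" by (rule Suc.IH[OF Q_bounded_borel[OF Suc.prems]])
  finally show ?case by (simp add: funpow_swap1)
qed

text \<open>Only one-step conditional expectations of functions of \<open>Z (Suc n)\<close> are given, so second moments of
  the increments are used instead of first moments.\<close>

lemma LINT_square_increment:
  "(LINT \<omega>|M. (Z (Suc n) \<omega> - Z n \<omega>)\<^sup>2) = (Q ^^ n) (\<lambda>y. Q (\<lambda>z. z\<^sup>2) y - 2 * y * Q (\<lambda>z. z) y + y\<^sup>2) x"
  and integrable_square_increment: "integrable M (\<lambda>\<omega>. (Z (Suc n) \<omega> - Z n \<omega>)\<^sup>2)"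
  and bounded_borel_variance: "(\<lambda>y. Q (\<lambda>z. z\<^sup>2) y - 2 * y * Q (\<lambda>z. z) y + y\<^sup>2) \<in> bounded_borel"
proof -
  have id: "(\<lambda>z::real. z) \<in> bounded_borel" and sq: "(\<lambda>z::real. z\<^sup>2) \<in> bounded_borel" and tw: "(\<lambda>z::real. 2 * z) \<in> bounded_borel"
    by (rule bounded_borel_continuous; auto intro!: continuous_intros)+
  note Qid = Q_bounded_borel[OF id] and Qsq = Q_bounded_borel[OF sq]
  have 3: "(\<lambda>y. 2 * y * Q (\<lambda>z. z) y) \<in> bounded_borel"
    using bounded_borel_scaleR[OF tw Qid] by simp
  show v: "(\<lambda>y. Q (\<lambda>z. z\<^sup>2) y - 2 * y * Q (\<lambda>z. z) y + y\<^sup>2) \<in> bounded_borel"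
    by (intro bounded_borel_add bounded_borel_diff Qsq 3 sq)
  have eq: "(Z (Suc n) \<omega> - Z n \<omega>)\<^sup>2 = (Z (Suc n) \<omega>)\<^sup>2 - 2 * Z n \<omega> * Z (Suc n) \<omega> + (Z n \<omega>)\<^sup>2" for \<omega>
    by (simp add: power2_eq_square algebra_simps)
  note i = integrable_Z[OF sq] integrable_Z2[OF id tw]
  show "integrable M (\<lambda>\<omega>. (Z (Suc n) \<omega> - Z n \<omega>)\<^sup>2)"
    unfolding eq by (intro Bochner_Integration.integrable_add Bochner_Integration.integrable_diff i)
  have "(LINT \<omega>|M. (Z (Suc n) \<omega> - Z n \<omega>)\<^sup>2) =
      (LINT \<omega>|M. (Z (Suc n) \<omega>)\<^sup>2) - (LINT \<omega>|M. 2 * Z n \<omega> * Z (Suc n) \<omega>) + (LINT \<omega>|M. (Z n \<omega>)\<^sup>2)"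
    unfolding eq using i by simp
  also have "(LINT \<omega>|M. (Z (Suc n) \<omega>)\<^sup>2) = (LINT \<omega>|M. Q (\<lambda>z. z\<^sup>2) (Z n \<omega>))"
    using LINT_step[OF sq bounded_borel_const[of 1], of n] by simp
  also have "(LINT \<omega>|M. 2 * Z n \<omega> * Z (Suc n) \<omega>) = (LINT \<omega>|M. 2 * Z n \<omega> * Q (\<lambda>z. z) (Z n \<omega>))"
    using LINT_step[OF id tw, of n] by simp
  also have "(LINT \<omega>|M. Q (\<lambda>z. z\<^sup>2) (Z n \<omega>)) - (LINT \<omega>|M. 2 * Z n \<omega> * Q (\<lambda>z. z) (Z n \<omega>)) + (LINT \<omega>|M. (Z n \<omega>)\<^sup>2)
     = (LINT \<omega>|M. Q (\<lambda>z. z\<^sup>2) (Z n \<omega>) - 2 * Z n \<omega> * Q (\<lambda>z. z) (Z n \<omega>) + (Z n \<omega>)\<^sup>2)"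
    using integrable_Z[OF Qsq, of n] integrable_Z2[OF Qid tw, of n n] integrable_Z[OF sq, of n] by simp
  also have "\<dots> = (Q ^^ n) (\<lambda>y. Q (\<lambda>z. z\<^sup>2) y - 2 * y * Q (\<lambda>z. z) y + y\<^sup>2) x"
    by (rule LINT_Z[OF v])
  finally show "(LINT \<omega>|M. (Z (Suc n) \<omega> - Z n \<omega>)\<^sup>2) = \<dots>" .
qed

end

section \<open>Almost sure convergence and the law of the limit\<close>

context absorbing_weights
begin

lemma Qn_tendsto_0:
  fixes f :: "real \<Rightarrow> real"
  assumes x: "x \<in> {0..1}" and f: "f \<in> bounded_borel" and K: "0 \<le> K"
    and 0: "\<And>y. y \<in> {0..1} \<Longrightarrow> norm (f y) \<le> K * y powr \<alpha>"
    and 1: "\<And>y. y \<in> {0..1} \<Longrightarrow> norm (f y) \<le> K * (1 - y) powr \<alpha>"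
  shows "(\<lambda>n. (Q ^^ n) f x) \<longlonglongrightarrow> 0"
proof (rule Lim_null_comparison)
  show "\<forall>\<^sub>F n in sequentially. norm ((Q ^^ n) f x) \<le> K * (\<kappa>\<^sub>W * \<rho>\<^sub>W ^ n)"
    using norm_Qn_bound[OF assms] by simp
  have "(\<lambda>n. K * (\<kappa>\<^sub>W * \<rho>\<^sub>W ^ n)) \<longlonglongrightarrow> K * (\<kappa>\<^sub>W * 0)"
    using \<rho>\<^sub>W by (intro tendsto_intros LIMSEQ_realpow_zero) auto
  then show "(\<lambda>n. K * (\<kappa>\<^sub>W * \<rho>\<^sub>W ^ n)) \<longlonglongrightarrow> 0" by simp
qed

text \<open>\<open>v\<close> is the mean square displacement in one step from \<open>y\<close>. It
  vanishes at the absorbing endpoints and is built from functions with Hoelder constants controlled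
  by \<open>C\<^sub>u\<close>, so it is of order \<alpha> at both ends.\<close>

lemma variance_bound:
  fixes y :: real
  assumes y: "y \<in> {0..1}"
  defines "v \<equiv> Q (\<lambda>z. z\<^sup>2) y - 2 * y * Q (\<lambda>z. z) y + y\<^sup>2"
  shows "\<bar>v\<bar> \<le> (4 * C\<^sub>u + 4) * y powr \<alpha>" "\<bar>v\<bar> \<le> (4 * C\<^sub>u + 4) * (1 - y) powr \<alpha>"
proof -
  have sq: "(\<lambda>z::real. z\<^sup>2) \<in> bounded_borel"
    by (rule bounded_borel_continuous; auto intro!: continuous_intros)
  have sqL: "\<bar>s\<^sup>2 - t\<^sup>2\<bar> \<le> (2 * C\<^sub>u) * \<bar>s - t\<bar> powr \<alpha>" if "s \<in> {0..1}" "t \<in> {0..1}" for s t :: real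
  proof -
    have "\<bar>s\<^sup>2 - t\<^sup>2\<bar> = \<bar>s + t\<bar> * \<bar>s - t\<bar>" by (simp add: power2_eq_square algebra_simps flip: abs_mult)
    also have "\<dots> \<le> (2 * C\<^sub>u) * \<bar>s - t\<bar> powr \<alpha>"
      using that C\<^sub>u_ge_1 by (intro mult_mono abs_le_powr) auto
    finally show ?thesis .
  qed
  have Qsq: "\<bar>Q (\<lambda>z. z\<^sup>2) s - Q (\<lambda>z. z\<^sup>2) t\<bar> \<le> (2 * C\<^sub>u) * \<bar>s - t\<bar> powr \<alpha>"
    if "s \<in> {0..1}" "t \<in> {0..1}" for s t :: real
    using Qn_holder_bound[OF sq _ sqL _ that, of 1]
    by (simp add: abs_square_le_1 C\<^sub>u_def)
  have Qid: "\<bar>Q (\<lambda>z. z) s - Q (\<lambda>z. z) t\<bar> \<le> C\<^sub>u * \<bar>s - t\<bar> powr \<alpha>"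
    if "s \<in> {0..1}" "t \<in> {0..1}" for s t :: real
    using u_holder[OF that, of 1] by (simp add: u_def)
  have Qid1: "\<bar>Q (\<lambda>z. z) y\<bar> \<le> 1" using norm_Q_bound[OF y id_bb, of 1] by simp
  have py: "y \<le> y powr \<alpha>" "1 - y \<le> (1 - y) powr \<alpha>"
    using abs_le_powr[of y] abs_le_powr[of "1 - y"] y by auto
  have ends: "Q (\<lambda>z. z\<^sup>2) 0 = 0" "Q (\<lambda>z. z\<^sup>2) 1 = (1::real)" "Q (\<lambda>z. z) 1 = (1::real)"
    by (simp_all add: Q_at_0[OF p0] Q_at_1[OF q1])
  have ym: "\<bar>y * Q (\<lambda>z. z) y\<bar> \<le> y" using Qid1 y by (simp add: abs_mult mult_left_le)
  have y2: "y\<^sup>2 \<le> y" using y by (simp add: power2_eq_square mult_left_le)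
  have "\<bar>v\<bar> \<le> (2 * C\<^sub>u) * y powr \<alpha> + 2 * y + y"
  proof -
    have "\<bar>Q (\<lambda>z. z\<^sup>2) y\<bar> \<le> (2 * C\<^sub>u) * y powr \<alpha>" using Qsq[OF y, of 0] y ends by simp
    moreover have "v = Q (\<lambda>z. z\<^sup>2) y - 2 * (y * Q (\<lambda>z. z) y) + y\<^sup>2" by (simp add: v_def)
    ultimately show ?thesis using ym y2 zero_le_power2[of y] by linarith
  qed
  also have "\<dots> \<le> (2 * C\<^sub>u) * y powr \<alpha> + 2 * y powr \<alpha> + y powr \<alpha>" using py by linarith
  \<comment> \<open>The bound at 0 is rounded up to the constant that arises at 1, since
    \<open>norm_Qn_bound\<close> takes a common \<open>K\<close>.\<close>
  also have "\<dots> \<le> (4 * C\<^sub>u + 4) * y powr \<alpha>"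
    using mult_nonneg_nonneg[of "C\<^sub>u" "y powr \<alpha>"] C\<^sub>u_ge_1 by (simp add: algebra_simps)
  finally show "\<bar>v\<bar> \<le> (4 * C\<^sub>u + 4) * y powr \<alpha>" .
  \<comment> \<open>Expansion around y = 1, in which every term is small with 1 - y.\<close>
  have eq: "v = (Q (\<lambda>z. z\<^sup>2) y - 1) - 2 * (Q (\<lambda>z. z) y - 1) + 2 * ((1 - y) * Q (\<lambda>z. z) y) - (1 - y) * (1 + y)"
    by (simp add: v_def power2_eq_square algebra_simps)
  have a: "\<bar>Q (\<lambda>z. z\<^sup>2) y - 1\<bar> \<le> (2 * C\<^sub>u) * (1 - y) powr \<alpha>" "\<bar>Q (\<lambda>z. z) y - 1\<bar> \<le> C\<^sub>u * (1 - y) powr \<alpha>"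
    using Qsq[OF y, of 1] Qid[OF y, of 1] y ends by (auto simp: abs_minus_commute)
  have b: "\<bar>(1 - y) * Q (\<lambda>z. z) y\<bar> \<le> 1 - y" using Qid1 y by (simp add: abs_mult mult_left_le)
  have c: "0 \<le> (1 - y) * (1 + y)" "(1 - y) * (1 + y) \<le> (1 - y) * 2"
    using y by simp (rule mult_left_mono, use y in auto)
  have "\<bar>v\<bar> \<le> (2 * C\<^sub>u) * (1 - y) powr \<alpha> + 2 * (C\<^sub>u * (1 - y) powr \<alpha>) + 2 * (1 - y) + (1 - y) * 2"
  proof -
    have "\<bar>a - 2 * b + 2 * c - e\<bar> \<le> A + 2 * B + 2 * w + w * 2"
      if "\<bar>a\<bar> \<le> A" "\<bar>b\<bar> \<le> B" "\<bar>c\<bar> \<le> w" "0 \<le> e" "e \<le> w * 2" for a b c e A B w :: real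
      using that by linarith
    from this[OF a b c] show ?thesis unfolding eq .
  qed
  also have "\<dots> \<le> (2 * C\<^sub>u) * (1 - y) powr \<alpha> + 2 * (C\<^sub>u * (1 - y) powr \<alpha>) + 2 * (1 - y) powr \<alpha> + (1 - y) powr \<alpha> * 2"
    by (intro add_mono mult_left_mono mult_right_mono py order_refl) auto
  also have "\<dots> = (4 * C\<^sub>u + 4) * (1 - y) powr \<alpha>" by (simp add: algebra_simps)
  finally show "\<bar>v\<bar> \<le> (4 * C\<^sub>u + 4) * (1 - y) powr \<alpha>" .
qed

lemma chain_converges:
  fixes \<mu> :: "'w measure" and Z :: "nat \<Rightarrow> 'w \<Rightarrow> real"
  assumes x: "x \<in> {0..1}" and chain: "DF_chain p q x \<mu> Z"
  shows "AE \<omega> in \<mu>. convergent (\<lambda>n. Z n \<omega>)"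
proof -
  interpret C: weights_chain p q x \<mu> Z by unfold_locales (fact x, fact chain)
  \<comment> \<open>Second moments of the increments decay like \<open>\<rho>\<^sub>W ^ n\<close>,
    so first moments should decay like \<open>s ^ n\<close>.\<close>
  define s where "s = sqrt \<rho>\<^sub>W"
  have s: "0 < s" "s < 1" "s * s = \<rho>\<^sub>W" using \<rho>\<^sub>W by (auto simp: s_def)
  define K where "K = (4 * C\<^sub>u + 4) * \<kappa>\<^sub>W"
  define d where "d = (\<lambda>n \<omega>. \<bar>Z (Suc n) \<omega> - Z n \<omega>\<bar>)"
  have id: "(\<lambda>z::real. z) \<in> bounded_borel" by (rule id_bb)
  have int: "integrable \<mu> (d n)" for n
    unfolding d_def using C.integrable_Z[OF id] by (intro integrable_abs Bochner_Integration.integrable_diff)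
  have "(LINT \<omega>|\<mu>. (Z (Suc n) \<omega> - Z n \<omega>)\<^sup>2) \<le> (4 * C\<^sub>u + 4) * (\<kappa>\<^sub>W * \<rho>\<^sub>W ^ n)" for n
    using norm_Qn_bound[OF x C.bounded_borel_variance, of "4 * C\<^sub>u + 4" n] variance_bound C\<^sub>u_ge_1
    unfolding C.LINT_square_increment by fastforce
  then have sqb: "(LINT \<omega>|\<mu>. (Z (Suc n) \<omega> - Z n \<omega>)\<^sup>2) \<le> K * s ^ n * s ^ n" for n
    by (simp add: K_def s(3)[symmetric] power_mult_distrib mult_ac)
  have "(LINT \<omega>|\<mu>. d n \<omega>) \<le> (1 + K) * s ^ n" for n
  proof -
    have sn: "0 < s ^ n" using s by simp
    \<comment> \<open>The elementary bound d \<le> e + d^2 / e for e > 0 stands in for the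
      Cauchy-Schwarz inequality; e = \<open>s ^ n\<close> balances the two terms.\<close>
    have "(LINT \<omega>|\<mu>. d n \<omega>) \<le> (LINT \<omega>|\<mu>. s ^ n + (Z (Suc n) \<omega> - Z n \<omega>)\<^sup>2 / s ^ n)"
    proof (rule integral_mono[OF int])
      show "integrable \<mu> (\<lambda>\<omega>. s ^ n + (Z (Suc n) \<omega> - Z n \<omega>)\<^sup>2 / s ^ n)"
        using C.integrable_square_increment[of n] by simp
      fix \<omega>
      have "d n \<omega> * s ^ n \<le> s ^ n * s ^ n + (d n \<omega>)\<^sup>2"
      proof -
        have "0 \<le> d n \<omega> * s ^ n" "0 \<le> (s ^ n - d n \<omega>) * (s ^ n - d n \<omega>)" using sn by (auto simp: d_def)
        then show ?thesis unfolding power2_eq_square by (simp add: algebra_simps del: zero_le_square)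
      qed
      then show "d n \<omega> \<le> s ^ n + (Z (Suc n) \<omega> - Z n \<omega>)\<^sup>2 / s ^ n"
        using divide_right_mono[of "d n \<omega> * s ^ n" "s ^ n * s ^ n + (d n \<omega>)\<^sup>2" "s ^ n"] sn s(1)
        by (simp add: add_divide_distrib d_def)
    qed
    also have "\<dots> = s ^ n + (LINT \<omega>|\<mu>. (Z (Suc n) \<omega> - Z n \<omega>)\<^sup>2) / s ^ n"
      using C.integrable_square_increment[of n] C.prob_space by simp
    also have "\<dots> \<le> s ^ n + (K * s ^ n * s ^ n) / s ^ n"
      using sqb[of n] sn by (intro add_left_mono divide_right_mono) auto
    finally show ?thesis using sn s(1) by (simp add: algebra_simps)
  qed
  moreover have "summable (\<lambda>n. (1 + K) * s ^ n)" using s by (intro summable_mult summable_geometric) auto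
  ultimately have "AE \<omega> in \<mu>. summable (\<lambda>n. d n \<omega>)"
    by (intro AE_summable_if_LINT_summable[where b="\<lambda>n. (1 + K) * s ^ n", OF int]) (simp_all add: d_def)
  then show ?thesis
  proof eventually_elim
    case (elim \<omega>)
    then have "summable (\<lambda>n. Z (Suc n) \<omega> - Z n \<omega>)"
      unfolding d_def by (rule summable_rabs_cancel)
    then have "convergent (\<lambda>n. Z n \<omega> - Z 0 \<omega>)"
      by (simp only: summable_iff_convergent sum_lessThan_telescope[of "\<lambda>n. Z n \<omega>"])
    then show ?case by (simp only: convergent_diff_const_right_iff)
  qed
qed

text \<open>The function y (1 - y) vanishes only at the endpoints of the interval and its mean along
  the chain tends to 0, so the limit is 0 or 1. Its mean, the limit of the means of
  \<open>Z n\<close>, is then the probability of the value 1.\<close>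

lemma chain_limit_law:
  fixes \<mu> :: "'w measure" and Z :: "nat \<Rightarrow> 'w \<Rightarrow> real"
  assumes x: "x \<in> {0..1}" and chain: "DF_chain p q x \<mu> Z"
  shows "\<exists>Zlim. Zlim \<in> borel_measurable \<mu> \<and> (\<forall>\<omega>\<in>space \<mu>. Zlim \<omega> \<in> {0, 1}) \<and>
    (AE \<omega> in \<mu>. (\<lambda>n. Z n \<omega>) \<longlonglongrightarrow> Zlim \<omega>) \<and>
    measure \<mu> {\<omega> \<in> space \<mu>. Zlim \<omega> = 0} = 1 - h x \<and> measure \<mu> {\<omega> \<in> space \<mu>. Zlim \<omega> = 1} = h x"
proof -
  interpret C: weights_chain p q x \<mu> Z by unfold_locales (fact x, fact chain)
  have Z_meas [measurable]: "Z n \<in> borel_measurable \<mu>" for n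
    using C.measurable_comp_Z[OF bounded_borelD[OF id_bb]] .
  \<comment> \<open>\<open>lim\<close> has some value even where the sequence diverges, so
    \<open>Y\<close> is total and measurable, but its values are controlled almost surely
    only.\<close>
  define Y where "Y = (\<lambda>\<omega>. lim (\<lambda>n. Z n \<omega>))"
  have Y_meas [measurable]: "Y \<in> borel_measurable \<mu>" unfolding Y_def by measurable
  have lim: "AE \<omega> in \<mu>. (\<lambda>n. Z n \<omega>) \<longlonglongrightarrow> Y \<omega>"
    using chain_converges[OF x chain] unfolding Y_def convergent_LIMSEQ_iff .
  then have Y01: "AE \<omega> in \<mu>. Y \<omega> \<in> {0..1}"
    using AE_space
  proof eventually_elim
    case (elim \<omega>)
    show ?case
      by (rule closed_sequentially[OF closed_atLeastAtMost _ elim(1)]) (rule C.Z_mem[OF elim(2)])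
  qed
  let ?g = "\<lambda>y::real. y * (1 - y)"
  have gb: "0 \<le> ?g y" "?g y \<le> 1" "?g y \<le> 1 * y powr \<alpha>" "?g y \<le> 1 * (1 - y) powr \<alpha>" if "y \<in> {0..1}" for y
  proof -
    have "?g y \<le> y * 1" "?g y \<le> 1 * (1 - y)" using that by (intro mult_left_mono mult_right_mono; simp)+
    then show "?g y \<le> 1" "?g y \<le> 1 * y powr \<alpha>" "?g y \<le> 1 * (1 - y) powr \<alpha>"
      using abs_le_powr[of y] abs_le_powr[of "1 - y"] that by auto
  qed (use that in auto)
  have gbb: "?g \<in> bounded_borel" by (intro bounded_borel_continuous continuous_intros)
  have conv: "(\<lambda>n. LINT \<omega>|\<mu>. f (Z n \<omega>)) \<longlonglongrightarrow> (LINT \<omega>|\<mu>. f (Y \<omega>))"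
    if "continuous_on UNIV f" "\<And>y. y \<in> {0..1} \<Longrightarrow> \<bar>f y\<bar> \<le> 1" for f :: "real \<Rightarrow> real"
  proof (rule integral_dominated_convergence[where w="\<lambda>_. 1"])
    have [measurable]: "f \<in> borel_measurable borel" using that(1) by (rule borel_measurable_continuous_onI)
    show "(\<lambda>\<omega>. f (Y \<omega>)) \<in> borel_measurable \<mu>" "(\<lambda>\<omega>. f (Z n \<omega>)) \<in> borel_measurable \<mu>" for n by measurable
    show "AE \<omega> in \<mu>. (\<lambda>n. f (Z n \<omega>)) \<longlonglongrightarrow> f (Y \<omega>)"
      using lim
    proof eventually_elim
      case (elim \<omega>)
      then show ?case using that(1) by (intro isCont_tendsto_compose[OF _ elim]) (simp add: continuous_on_eq_continuous_at)
    qed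
    show "AE \<omega> in \<mu>. norm (f (Z n \<omega>)) \<le> 1" for n using that(2) C.Z_mem by (intro AE_I2) simp
  qed simp
  have "(\<lambda>n. LINT \<omega>|\<mu>. ?g (Z n \<omega>)) \<longlonglongrightarrow> 0"
    unfolding C.LINT_Z[OF gbb] using gb by (intro Qn_tendsto_0[OF x gbb, of 1]) (auto simp del: mult_1)
  moreover have "(\<lambda>n. LINT \<omega>|\<mu>. ?g (Z n \<omega>)) \<longlonglongrightarrow> (LINT \<omega>|\<mu>. ?g (Y \<omega>))"
    by (rule conv) (use gb in \<open>auto intro!: continuous_intros simp: abs_mult\<close>)
  ultimately have g0: "(LINT \<omega>|\<mu>. ?g (Y \<omega>)) = 0" by (rule LIMSEQ_unique[symmetric])
  have gY: "AE \<omega> in \<mu>. 0 \<le> ?g (Y \<omega>)" using Y01 by eventually_elim (use gb in blast)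
  have "AE \<omega> in \<mu>. norm (?g (Y \<omega>)) \<le> 1"
    using Y01 by eventually_elim (simp only: real_norm_def abs_of_nonneg[OF gb(1)] gb(2))
  then have "integrable \<mu> (\<lambda>\<omega>. ?g (Y \<omega>))"
    by (rule C.integrable_const_bound) measurable
  then have "AE \<omega> in \<mu>. ?g (Y \<omega>) = 0" using integral_nonneg_eq_0_iff_AE[OF _ gY] g0 by simp
  then have Y2: "AE \<omega> in \<mu>. Y \<omega> = 0 \<or> Y \<omega> = 1" by eventually_elim auto
  \<comment> \<open>The values must lie in {0, 1} everywhere, so the exceptional null set is sent to
    0.\<close>
  define Zl where "Zl = (\<lambda>\<omega>. if Y \<omega> = 1 then 1 else 0 :: real)"
  have Zl_meas [measurable]: "Zl \<in> borel_measurable \<mu>" unfolding Zl_def by measurable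
  have ZlY: "AE \<omega> in \<mu>. Y \<omega> = Zl \<omega>" using Y2 by eventually_elim (auto simp: Zl_def)
  have "measure \<mu> {\<omega> \<in> space \<mu>. Zl \<omega> = 1} = (LINT \<omega>|\<mu>. indicator {\<omega> \<in> space \<mu>. Zl \<omega> = 1} \<omega>)"
    by simp
  also have "\<dots> = (LINT \<omega>|\<mu>. Y \<omega>)"
  proof (rule integral_cong_AE[OF _ Y_meas])
    have "{\<omega> \<in> space \<mu>. Zl \<omega> = 1} = Zl -` {1} \<inter> space \<mu>" by auto
    then show "(\<lambda>\<omega>. indicator {\<omega> \<in> space \<mu>. Zl \<omega> = 1} \<omega> :: real) \<in> borel_measurable \<mu>"
      using measurable_sets[OF Zl_meas, of "{1}"] by (intro borel_measurable_indicator) simp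
    show "AE \<omega> in \<mu>. indicator {\<omega> \<in> space \<mu>. Zl \<omega> = 1} \<omega> = Y \<omega>"
      using ZlY AE_space by eventually_elim (auto simp: Zl_def indicator_def)
  qed
  also have "\<dots> = h x"
  proof (rule LIMSEQ_unique)
    show "(\<lambda>n. LINT \<omega>|\<mu>. Z n \<omega>) \<longlonglongrightarrow> (LINT \<omega>|\<mu>. Y \<omega>)" by (rule conv[of "\<lambda>y. y"]) auto
    show "(\<lambda>n. LINT \<omega>|\<mu>. Z n \<omega>) \<longlonglongrightarrow> h x"
      using u_tendsto[OF x] unfolding u_def C.LINT_Z[OF id_bb] .
  qed
  finally have 1: "measure \<mu> {\<omega> \<in> space \<mu>. Zl \<omega> = 1} = h x" .
  have "{\<omega> \<in> space \<mu>. Zl \<omega> = 0} = space \<mu> - {\<omega> \<in> space \<mu>. Zl \<omega> = 1}" by (auto simp: Zl_def)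
  then have 0: "measure \<mu> {\<omega> \<in> space \<mu>. Zl \<omega> = 0} = 1 - h x"
    using C.prob_compl[of "{\<omega> \<in> space \<mu>. Zl \<omega> = 1}"] 1 by simp
  have "AE \<omega> in \<mu>. (\<lambda>n. Z n \<omega>) \<longlonglongrightarrow> Zl \<omega>" using lim ZlY by eventually_elim simp
  then show ?thesis using 0 1 Zl_meas by (intro exI[of _ Zl]) (auto simp: Zl_def)
qed

text \<open>An invariant measure is carried by the zeros of \<open>W\<close>, the two endpoints, and
  \<open>s\<close> is its mass at 1. Conversely, on measures carried by absorbing points
  \<open>Q\<close> leaves test functions unchanged almost everywhere.\<close>

lemma invariant_iff:
  "DF_invariant p q \<nu> \<longleftrightarrow> sets \<nu> = sets unit_borel \<and>
     (\<exists>s\<in>{0..1}. \<forall>A\<in>sets unit_borel.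
        emeasure \<nu> A = ennreal (1 - s) * emeasure (return unit_borel 0) A
                     + ennreal s * emeasure (return unit_borel 1) A)"
proof (intro iffI conjI)
  assume \<nu>: "DF_invariant p q \<nu>"
  note sp = invariant_space[OF \<nu>]
  show "sets \<nu> = sets unit_borel" by fact
  interpret prob_space \<nu> by fact
  obtain r where r: "0 < r" "r < 1" "\<And>y. y \<in> {0..1} \<Longrightarrow> Q W y \<le> r * W y" using Q_W by blast
  have QQ: "Q (Q W) y \<le> r * W y" if "y \<in> {0..1}" for y
    using Q_mono[OF that Q_bounded_borel[OF W_bb] W_bb] r that W_nonneg
    by (meson less_imp_le mult_left_le_one_le order_trans)
  have "AE y in \<nu>. W y = 0"
    by (rule invariant_lyapunov[OF \<nu> W_bb W_nonneg r(2) QQ])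
  then have AE: "AE y in \<nu>. y = 0 \<or> y = 1"
    using AE_space
  proof eventually_elim
    case (elim y)
    then have "y powr \<alpha> = 0 \<or> (1 - y) powr \<alpha> = 0"
      using L_ge_1 sp(3) by (auto simp: W_def min_def split: if_splits)
    then show ?case by auto
  qed
  have ms: "{0} \<in> sets \<nu>" "{1} \<in> sets \<nu>"
    unfolding sp(2) by (auto simp: sets_restrict_space_iff)
  let ?s = "measure \<nu> {1}"
  have "prob ({0} \<union> {1}) = 1"
    by (subst prob_eq_1[OF sets.Un[OF ms]]) (use AE in auto)
  then have s0: "measure \<nu> {0} = 1 - ?s"
    using finite_measure_Union[OF ms] by simp
  show "\<exists>s\<in>{0..1}. \<forall>A\<in>sets unit_borel.
        emeasure \<nu> A = ennreal (1 - s) * emeasure (return unit_borel 0) A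
                     + ennreal s * emeasure (return unit_borel 1) A"
  proof (intro bexI[of _ ?s] ballI)
    fix A :: "real set" assume A: "A \<in> sets unit_borel"
    have "emeasure \<nu> A = emeasure \<nu> (A \<inter> {0} \<union> A \<inter> {1})"
      by (rule emeasure_eq_AE) (use AE A ms sp(2) in \<open>auto elim!: eventually_mono\<close>)
    also have "\<dots> = emeasure \<nu> (A \<inter> {0}) + emeasure \<nu> (A \<inter> {1})"
      by (rule plus_emeasure[symmetric]) (use A ms sp(2) in auto)
    also have "emeasure \<nu> (A \<inter> {0}) = ennreal (1 - ?s) * emeasure (return unit_borel 0) A"
      using A s0 by (auto simp: emeasure_eq_measure indicator_def)
    also have "emeasure \<nu> (A \<inter> {1}) = ennreal ?s * emeasure (return unit_borel 1) A"
      using A by (auto simp: emeasure_eq_measure indicator_def)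
    finally show "emeasure \<nu> A = ennreal (1 - ?s) * emeasure (return unit_borel 0) A
                     + ennreal ?s * emeasure (return unit_borel 1) A" .
  qed auto
next
  assume "sets \<nu> = sets unit_borel \<and> (\<exists>s\<in>{0..1}. \<forall>A\<in>sets unit_borel.
        emeasure \<nu> A = ennreal (1 - s) * emeasure (return unit_borel 0) A
                     + ennreal s * emeasure (return unit_borel 1) A)"
  then obtain s where sets: "sets \<nu> = sets unit_borel" and s: "s \<in> {0..1}"
    and em: "\<And>A. A \<in> sets unit_borel \<Longrightarrow> emeasure \<nu> A = ennreal (1 - s) * emeasure (return unit_borel 0) A
                     + ennreal s * emeasure (return unit_borel 1) A" by blast
  have sp: "space \<nu> = {0..1}" using sets_eq_imp_space_eq[OF sets] by (simp add: space_restrict_space)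
  have S: "{0..1} \<in> sets unit_borel" "{0<..<1} \<in> sets unit_borel"
    by (auto simp: sets_restrict_space_iff)
  have ps: "prob_space \<nu>"
    by (rule prob_spaceI) (use em[OF S(1)] s S in \<open>simp add: sp flip: ennreal_plus\<close>)
  have "emeasure \<nu> {0<..<1} = 0" using em[OF S(2)] S by simp
  then have AE: "AE y in \<nu>. y = 0 \<or> y = 1"
    by (intro AE_I[of _ _ "{0<..<1}"]) (use S sp sets in auto)
  have "(LINT y|\<nu>. Q \<phi> y) = (LINT y|\<nu>. \<phi> y)" if \<phi>: "\<phi> \<in> bounded_borel" for \<phi> :: "real \<Rightarrow> complex"
    by (rule integral_cong_AE
        [OF borel_measurable_integrable[OF integrable_bounded_borel[OF ps sets Q_bounded_borel[OF \<phi>]]]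
          borel_measurable_integrable[OF integrable_bounded_borel[OF ps sets \<phi>]]])
      (use AE in \<open>eventually_elim, auto simp: Q_at_0[OF p0] Q_at_1[OF q1]\<close>)
  then show "DF_invariant p q \<nu>" using ps sets by (simp add: DF_invariant_def)
qed

end

section \<open>No absorbing endpoint: uniform ergodicity\<close>

lemma set_integrable_bounded_borel:
  fixes f :: "real \<Rightarrow> 'a::{banach,second_countable_topology}"
  assumes f: "f \<in> bounded_borel" and S: "S \<in> sets borel" "S \<subseteq> {0..1}"
  shows "set_integrable lborel S f"
proof -
  obtain B where B: "\<And>y. y \<in> {0..1} \<Longrightarrow> norm (f y) \<le> B" using f bounded_borelE by metis
  have "unit_borel \<rightarrow>\<^sub>M borel = unit_lebesgue \<rightarrow>\<^sub>M (borel :: 'a measure)"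
    by (rule measurable_cong_sets) (simp_all add: sets_restrict_space)
  then have "f \<in> borel_measurable unit_lebesgue" using bounded_borelD[OF f] by blast
  then have "integrable unit_lebesgue f" by (rule integrable_unit_lebesgue) (rule B)
  then have "set_integrable lborel {0..1} f" by (simp add: set_integrable_def integrable_restrict_space)
  then show ?thesis by (rule set_integrable_subset) (use S in auto)
qed

lemma measurable_indicator_bounded_borel:
  fixes \<phi> :: "real \<Rightarrow> real"
  assumes "\<phi> \<in> bounded_borel" shows "(\<lambda>x. ennreal (indicator {0..1} x *\<^sub>R \<phi> x)) \<in> borel_measurable borel"
  using bounded_borelD[OF assms] borel_measurable_restrict_space_iff[of "{0..1}" borel \<phi>] by simp

context weights
begin

lemma LINT_Qn_invariant:
  fixes f :: "real \<Rightarrow> real"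
  assumes \<nu>: "DF_invariant p q \<nu>" and f: "f \<in> bounded_borel"
  shows "(LINT y|\<nu>. (Q ^^ n) f y) = (LINT y|\<nu>. f y)"
  by (induction n) (simp_all add: invariant_LINT_real[OF \<nu> Qn_bounded_borel[OF f]])

text \<open>Continuity at the endpoints, where \<open>p 1\<close> and \<open>q 0\<close> are
  positive. The bound d \<le> 1/4 leaves a middle interval of length at least 1/2; c \<le> 1/2 helps
  to keep the later contraction factor positive.\<close>

lemma weights_bounded_below:
  assumes p0: "p 0 < 1" and q1: "q 1 < 1"
  obtains c d where "0 < c" "c \<le> 1 / 2" "0 < d" "d \<le> 1 / 4"
    "\<And>y. y \<in> {0..1} \<Longrightarrow> 1 - d \<le> y \<Longrightarrow> c \<le> p y" "\<And>y. y \<in> {0..1} \<Longrightarrow> y \<le> d \<Longrightarrow> c \<le> q y"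
proof -
  have pos: "0 < p 1" "0 < q 0" using p0 q1 q_eq[of 0] q_eq[of 1] by auto
  have "\<exists>d>0. \<forall>y\<in>{0..1}. dist y 1 < d \<longrightarrow> dist (p y) (p 1) < p 1 / 2"
    using continuous_p pos unfolding continuous_on_iff by (metis atLeastAtMost_iff half_gt_zero order_refl zero_le_one)
  then obtain d\<^sub>1 where d1: "0 < d\<^sub>1" "\<And>y. y \<in> {0..1} \<Longrightarrow> dist y 1 < d\<^sub>1 \<Longrightarrow> dist (p y) (p 1) < p 1 / 2"
    by blast
  have "\<exists>d>0. \<forall>y\<in>{0..1}. dist y 0 < d \<longrightarrow> dist (q y) (q 0) < q 0 / 2"
    using continuous_q pos unfolding continuous_on_iff by (metis atLeastAtMost_iff half_gt_zero order_refl zero_le_one)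
  then obtain d\<^sub>0 where d0: "0 < d\<^sub>0" "\<And>y. y \<in> {0..1} \<Longrightarrow> dist y 0 < d\<^sub>0 \<Longrightarrow> dist (q y) (q 0) < q 0 / 2"
    by blast
  define d where "d = min (1 / 4) (min (d\<^sub>0 / 2) (d\<^sub>1 / 2))"
  have d: "0 < d" "d \<le> 1 / 4" using d0 d1 by (auto simp: d_def)
  define c where "c = min (p 1 / 2) (q 0 / 2)"
  have c: "0 < c" "c \<le> 1 / 2" using pos p_le_1[of 1] by (auto simp: c_def)
  have pc: "c \<le> p y" if "y \<in> {0..1}" "1 - d \<le> y" for y
  proof -
    have "dist y 1 < d\<^sub>1" using that d1(1) by (auto simp: dist_real_def d_def)
    then have "\<bar>p y - p 1\<bar> < p 1 / 2" using d1(2) that by (simp add: dist_real_def)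
    moreover have "c \<le> p 1 / 2" by (simp add: c_def)
    ultimately show ?thesis by linarith
  qed
  have qc: "c \<le> q y" if "y \<in> {0..1}" "y \<le> d" for y
  proof -
    have "dist y 0 < d\<^sub>0" using that d0(1) by (auto simp: dist_real_def d_def)
    then have "\<bar>q y - q 0\<bar> < q 0 / 2" using d0(2) that by (simp add: dist_real_def)
    moreover have "c \<le> q 0 / 2" by (simp add: c_def)
    ultimately show ?thesis by linarith
  qed
  from that[OF c d pc qc] show thesis .
qed

text \<open>A uniform Doeblin minorization: from \<open>E = {0..d} \<union> {1 - d..1}\<close> one step charges the whole of
  \<open>{d..1 - d}\<close>, and \<open>E\<close> is reached in one step from everywhere.\<close>

lemma minorization:
  assumes p0: "p 0 < 1" and q1: "q 1 < 1"
  obtains e d where "0 < e" "e \<le> 1 / 8" "0 < d" "d \<le> 1 / 4"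
    "\<And>f :: real \<Rightarrow> real. \<And>x. f \<in> bounded_borel \<Longrightarrow> (\<And>y. y \<in> {0..1} \<Longrightarrow> 0 \<le> f y) \<Longrightarrow> x \<in> {0..1} \<Longrightarrow>
       e * (LINT y:{d..1 - d}|lborel. f y) \<le> Q (Q f) x"
proof -
  obtain c d where c: "0 < c" "c \<le> 1 / 2" and d: "0 < d" "d \<le> 1 / 4"
    and pc: "\<And>y. y \<in> {0..1} \<Longrightarrow> 1 - d \<le> y \<Longrightarrow> c \<le> p y"
    and qc: "\<And>y. y \<in> {0..1} \<Longrightarrow> y \<le> d \<Longrightarrow> c \<le> q y"
    using weights_bounded_below[OF assms] by blast
  have "(c * d) * (LINT y:{d..1 - d}|lborel. f y) \<le> Q (Q f) x"
    if f: "f \<in> bounded_borel" "\<And>y. y \<in> {0..1} \<Longrightarrow> 0 \<le> f y" and x: "x \<in> {0..1}" for f x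
  proof -
    let ?J = "LINT y:{d..1 - d}|lborel. f y"
    have J: "?J \<le> (LINT y:{a..b}|lborel. f y)" if "0 \<le> a" "a \<le> d" "1 - d \<le> b" "b \<le> 1" for a b
      unfolding set_lebesgue_integral_def
      by (rule integral_mono; (fold set_integrable_def, intro set_integrable_bounded_borel f(1))?)
        (use that d f(2) in \<open>auto simp: indicator_def\<close>)
    have J0: "0 \<le> ?J"
      unfolding set_lebesgue_integral_def by (rule Bochner_Integration.integral_nonneg) (use d f(2) in \<open>auto simp: indicator_def\<close>)
    have A0: "0 \<le> (LINT t|unit_lebesgue. f (t * y))" and B0: "0 \<le> (LINT t|unit_lebesgue. f (t * y + 1 - t))"
      if "y \<in> {0..1}" for y
      using LINT_down_ge[OF that f, of 0 0] LINT_up_ge[OF that f, of 0 0] f(2) by auto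
    have "c * ?J \<le> Q f y" if y: "y \<in> {0..1}" and E: "y \<le> d \<or> 1 - d \<le> y" for y
    proof (cases "y \<le> d")
      case True
      \<comment> \<open>The upward move from \<open>y\<close> is uniform on [y, 1], which contains
        \<open>{d..1 - d}\<close>, with density 1 / (1 - y) \<ge> 1.\<close>
      have "?J \<le> (LINT z:{y..1}|lborel. f z)" using True y d by (intro J) auto
      also have "\<dots> = (1 - y) * (LINT t|unit_lebesgue. f (t * y + 1 - t))"
        using unit_mult_LINT_up[of y f] True y d by simp
      also have "\<dots> \<le> 1 * (LINT t|unit_lebesgue. f (t * y + 1 - t))"
        using B0[OF y] y by (intro mult_right_mono) auto
      finally have "c * ?J \<le> q y * (LINT t|unit_lebesgue. f (t * y + 1 - t))"
        using c qc[OF y True] J0 by (intro mult_mono) auto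
      moreover have "0 \<le> p y * (LINT t|unit_lebesgue. f (t * y))" using A0[OF y] p_nonneg[OF y] by simp
      ultimately show ?thesis unfolding DF_op_eq real_scaleR_def by linarith
    next
      case False
      then have y1: "1 - d \<le> y" "0 < y" using E d by auto
      have "?J \<le> (LINT z:{0..y}|lborel. f z)" using y1 y d by (intro J) auto
      also have "\<dots> = y * (LINT t|unit_lebesgue. f (t * y))"
        using unit_mult_LINT_down[of y f] y1 y by simp
      also have "\<dots> \<le> 1 * (LINT t|unit_lebesgue. f (t * y))"
        using A0[OF y] y by (intro mult_right_mono) auto
      finally have "c * ?J \<le> p y * (LINT t|unit_lebesgue. f (t * y))"
        using c pc[OF y y1(1)] J0 by (intro mult_mono) auto
      moreover have "0 \<le> q y * (LINT t|unit_lebesgue. f (t * y + 1 - t))" using B0[OF y] q_nonneg[OF y] by simp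
      ultimately show ?thesis unfolding DF_op_eq real_scaleR_def by linarith
    qed
    moreover have "0 \<le> Q f y" if "y \<in> {0..1}" for y
      using Q_mono[OF that bounded_borel_const[of 0] f] that by (simp add: Q_const)
    ultimately have "(c * ?J) * d \<le> Q (Q f) x"
      by (intro Q_ge_spread[OF x Q_bounded_borel[OF f(1)]]) (use d in auto)
    then show ?thesis by (simp add: mult_ac)
  qed
  moreover have "0 < c * d" "c * d \<le> 1 / 8" using c d mult_mono[of c "1/2" d "1/4"] by auto
  ultimately show thesis using that d by blast
qed

text \<open>Minorization applied to \<open>f - a\<close> and to \<open>b - f\<close> raises the
  lower bound and lowers the upper one, by amounts that add up to e (1 - 2 d) (b - a).\<close>

lemma oscillation_contracts:
  assumes p0: "p 0 < 1" and q1: "q 1 < 1"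
  obtains r where "0 < r" "r < 1"
    "\<And>(f :: real \<Rightarrow> real) a b. f \<in> bounded_borel \<Longrightarrow> (\<And>y. y \<in> {0..1} \<Longrightarrow> a \<le> f y \<and> f y \<le> b) \<Longrightarrow>
       \<exists>a' b'. b' - a' \<le> r * (b - a) \<and> (\<forall>y\<in>{0..1}. a' \<le> Q (Q f) y \<and> Q (Q f) y \<le> b')"
proof -
  obtain e d where ed: "0 < e" "e \<le> 1 / 8" "0 < d" "d \<le> 1 / 4"
    and minor: "\<And>f :: real \<Rightarrow> real. \<And>x. f \<in> bounded_borel \<Longrightarrow> (\<And>y. y \<in> {0..1} \<Longrightarrow> 0 \<le> f y) \<Longrightarrow> x \<in> {0..1} \<Longrightarrow>
       e * (LINT y:{d..1 - d}|lborel. f y) \<le> Q (Q f) x"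
    using minorization[OF assms] by blast
  define J :: "(real \<Rightarrow> real) \<Rightarrow> real" where "J f = (LINT y:{d..1 - d}|lborel. f y)" for f
  have Jdiff: "J (\<lambda>y. f y - g y) = J f - J g" if "f \<in> bounded_borel" "g \<in> bounded_borel" for f g
    unfolding J_def using that ed by (intro set_integral_diff set_integrable_bounded_borel) auto
  have Jc: "J (\<lambda>_. c) = c * (1 - 2 * d)" for c
    unfolding J_def set_lebesgue_integral_def using ed by simp
  let ?r = "1 - e * (1 - 2 * d)"
  have "\<exists>a' b'. b' - a' \<le> ?r * (b - a) \<and> (\<forall>y\<in>{0..1}. a' \<le> Q (Q f) y \<and> Q (Q f) y \<le> b')"
    if f: "f \<in> bounded_borel" and ab: "\<And>y. y \<in> {0..1} \<Longrightarrow> a \<le> f y \<and> f y \<le> b" for f a b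
  \<comment> \<open>The witnesses \<open>a'\<close> and \<open>b'\<close> stay schematic until the
    first two \<open>show\<close> commands determine them.\<close>
  proof (intro exI conjI ballI)
    note cb = bounded_borel_const
    have QQd: "Q (Q (\<lambda>y. g y - k y)) x = Q (Q g) x - Q (Q k) x"
      if "x \<in> {0..1}" "g \<in> bounded_borel" "k \<in> bounded_borel" for x and g k :: "real \<Rightarrow> real"
      using Qn_diff[OF that, of 2] by (simp add: numeral_2_eq_2)
    have QQc: "Q (Q (\<lambda>_. c)) x = c" if "x \<in> {0..1}" for x c :: real
      using Qn_const[OF that, of 2 c] by (simp add: numeral_2_eq_2)
    fix y :: real assume y: "y \<in> {0..1}"
    have "e * J (\<lambda>y. f y - a) \<le> Q (Q (\<lambda>y. f y - a)) y"
      unfolding J_def by (rule minor[OF bounded_borel_diff[OF f cb] _ y]) (use ab in auto)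
    then show "a + e * (J f - J (\<lambda>_. a)) \<le> Q (Q f) y"
      using QQd[OF y f cb] QQc[OF y] Jdiff[OF f cb] by simp
    have "e * J (\<lambda>y. b - f y) \<le> Q (Q (\<lambda>y. b - f y)) y"
      unfolding J_def by (rule minor[OF bounded_borel_diff[OF cb f] _ y]) (use ab in auto)
    then show "Q (Q f) y \<le> b - e * (J (\<lambda>_. b) - J f)"
      using QQd[OF y cb f] QQc[OF y] Jdiff[OF cb f] by simp
  next
    show "b - e * (J (\<lambda>_. b) - J f) - (a + e * (J f - J (\<lambda>_. a))) \<le> ?r * (b - a)"
      by (simp add: Jc algebra_simps)
  qed
  moreover have "0 < e * (1 - 2 * d)" "e * (1 - 2 * d) \<le> 1 / 8 * 1"
    using ed by (simp, intro mult_mono) auto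
  then have "0 < ?r" "?r < 1" by auto
  ultimately show thesis using that by blast
qed

text \<open>By invariance the mean of \<open>f\<close> is also the mean of
  \<open>(Q ^^ n) f\<close>, so it lies between the same bounds as every value of that iterate and
  differs from any value by at most the oscillation.\<close>

lemma oscillation_decay:
  assumes p0: "p 0 < 1" and q1: "q 1 < 1"
  obtains \<kappa> \<rho> where "0 < \<kappa>" "0 < \<rho>" "\<rho> < (1::real)"
    "\<And>(f :: real \<Rightarrow> real) B \<nu> n x. f \<in> bounded_borel \<Longrightarrow> (\<And>y. y \<in> {0..1} \<Longrightarrow> \<bar>f y\<bar> \<le> B) \<Longrightarrow>
       DF_invariant p q \<nu> \<Longrightarrow> x \<in> {0..1} \<Longrightarrow> \<bar>(Q ^^ n) f x - (LINT y|\<nu>. f y)\<bar> \<le> \<kappa> * \<rho> ^ n * B"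
proof -
  obtain r where r: "0 < r" "r < 1"
    and step: "\<And>(f :: real \<Rightarrow> real) a b. f \<in> bounded_borel \<Longrightarrow> (\<And>y. y \<in> {0..1} \<Longrightarrow> a \<le> f y \<and> f y \<le> b) \<Longrightarrow>
       \<exists>a' b'. b' - a' \<le> r * (b - a) \<and> (\<forall>y\<in>{0..1}. a' \<le> Q (Q f) y \<and> Q (Q f) y \<le> b')"
    using oscillation_contracts[OF assms] by blast
  have even: "\<exists>a b. b - a \<le> r ^ k * (2 * B) \<and> (\<forall>y\<in>{0..1}. a \<le> (Q ^^ (2 * k)) f y \<and> (Q ^^ (2 * k)) f y \<le> b)"
    if f: "f \<in> bounded_borel" and B: "\<And>y. y \<in> {0..1} \<Longrightarrow> \<bar>f y\<bar> \<le> B" for f :: "real \<Rightarrow> real" and B k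
  proof (induction k)
    case 0
    then show ?case using B by (intro exI[of _ "- B"] exI[of _ B]) (auto simp: abs_le_iff minus_le_iff)
  next
    case (Suc k)
    then obtain a b where ab: "b - a \<le> r ^ k * (2 * B)"
      "\<And>y. y \<in> {0..1} \<Longrightarrow> a \<le> (Q ^^ (2 * k)) f y \<and> (Q ^^ (2 * k)) f y \<le> b" by blast
    obtain a' b' where ab': "b' - a' \<le> r * (b - a)"
      "\<And>y. y \<in> {0..1} \<Longrightarrow> a' \<le> Q (Q ((Q ^^ (2 * k)) f)) y \<and> Q (Q ((Q ^^ (2 * k)) f)) y \<le> b'"
      using step[OF Qn_bounded_borel[OF f] ab(2)] by blast
    have "r * (b - a) \<le> r * (r ^ k * (2 * B))" using ab(1) r by (intro mult_left_mono) auto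
    then show ?case using ab' by (intro exI[of _ a'] exI[of _ b']) (auto simp: mult_ac)
  qed
  have all: "\<exists>a b. b - a \<le> r ^ (n div 2) * (2 * B) \<and> (\<forall>y\<in>{0..1}. a \<le> (Q ^^ n) f y \<and> (Q ^^ n) f y \<le> b)"
    if f: "f \<in> bounded_borel" and B: "\<And>y. y \<in> {0..1} \<Longrightarrow> \<bar>f y\<bar> \<le> B" for f :: "real \<Rightarrow> real" and B n
  proof -
    obtain a b where ab: "b - a \<le> r ^ (n div 2) * (2 * B)"
      "\<And>y. y \<in> {0..1} \<Longrightarrow> a \<le> (Q ^^ (2 * (n div 2))) f y \<and> (Q ^^ (2 * (n div 2))) f y \<le> b" using even[OF f B] by blast
    show ?thesis
    proof (cases "even n")
      case True then show ?thesis using ab by (intro exI[of _ a] exI[of _ b]) auto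
    next
      case False
      then have n: "(Q ^^ n) f = Q ((Q ^^ (2 * (n div 2))) f)"
        by (metis comp_apply funpow.simps(2) odd_two_times_div_two_succ Suc_eq_plus1)
      have "a \<le> (Q ^^ n) f y \<and> (Q ^^ n) f y \<le> b" if y: "y \<in> {0..1}" for y
        unfolding n using Q_mono[OF y bounded_borel_const[of a] Qn_bounded_borel[OF f]]
          Q_mono[OF y Qn_bounded_borel[OF f] bounded_borel_const[of b]] ab(2) y by (simp add: Q_const)
      then show ?thesis using ab by (intro exI[of _ a] exI[of _ b]) auto
    qed
  qed
  obtain \<kappa> \<rho> where \<kappa>: "\<kappa> > 0" "0 < \<rho>" "\<rho> < 1" "\<And>n. r ^ (n div 2) \<le> \<kappa> * \<rho> ^ n"
    using half_power_bound[OF r] by blast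
  have "\<bar>(Q ^^ n) f x - (LINT y|\<nu>. f y)\<bar> \<le> (2 * \<kappa>) * \<rho> ^ n * B"
    if f: "f \<in> bounded_borel" and B: "\<And>y. y \<in> {0..1} \<Longrightarrow> \<bar>f y\<bar> \<le> B"
      and \<nu>: "DF_invariant p q \<nu>" and x: "x \<in> {0..1}" for f :: "real \<Rightarrow> real" and B \<nu> n x
  proof -
    obtain a b where ab: "b - a \<le> r ^ (n div 2) * (2 * B)"
      "\<And>y. y \<in> {0..1} \<Longrightarrow> a \<le> (Q ^^ n) f y \<and> (Q ^^ n) f y \<le> b" using all[OF f B] by blast
    note sp = invariant_space[OF \<nu>]
    interpret prob_space \<nu> by (rule sp)
    note int = integrable_bounded_borel[OF sp(1,2) Qn_bounded_borel[OF f], of n]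
    have "(LINT y|\<nu>. a) \<le> (LINT y|\<nu>. (Q ^^ n) f y)" "(LINT y|\<nu>. (Q ^^ n) f y) \<le> (LINT y|\<nu>. b)"
      by (intro integral_mono int integrable_const; use ab(2) sp(3) in blast)+
    then have "a \<le> (LINT y|\<nu>. f y)" "(LINT y|\<nu>. f y) \<le> b"
      unfolding LINT_Qn_invariant[OF \<nu> f] by (simp_all add: prob_space)
    then have "\<bar>(Q ^^ n) f x - (LINT y|\<nu>. f y)\<bar> \<le> b - a" using ab(2)[OF x] by linarith
    also have "\<dots> \<le> r ^ (n div 2) * (2 * B)" by (rule ab(1))
    also have "\<dots> \<le> (\<kappa> * \<rho> ^ n) * (2 * B)"
      by (rule mult_right_mono[OF \<kappa>(4)]) (use B[of 0] in auto)
    finally show ?thesis by (simp add: mult_ac)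
  qed
  then show thesis using that[of "2 * \<kappa>" \<rho>] \<kappa>(1-3) by simp
qed

text \<open>Measures are compared on indicators: the same numbers \<open>(Q ^^ n) ?f 0\<close>
  approach both integrals.\<close>

lemma invariant_unique:
  assumes "p 0 < 1" "q 1 < 1" and \<nu>: "DF_invariant p q \<nu>" and \<nu>': "DF_invariant p q \<nu>'"
  shows "\<nu>' = \<nu>"
proof (rule measure_eqI)
  note sp = invariant_space[OF \<nu>] and sp' = invariant_space[OF \<nu>']
  show "sets \<nu>' = sets \<nu>" using sp sp' by simp
  interpret N: prob_space \<nu> by (rule sp)
  interpret N': prob_space \<nu>' by (rule sp')
  obtain \<kappa> \<rho> where \<kappa>: "0 < \<kappa>" "0 < \<rho>" "\<rho> < (1::real)"
    and dec: "\<And>(f :: real \<Rightarrow> real) B \<nu> n x. f \<in> bounded_borel \<Longrightarrow> (\<And>y. y \<in> {0..1} \<Longrightarrow> \<bar>f y\<bar> \<le> B) \<Longrightarrow>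
       DF_invariant p q \<nu> \<Longrightarrow> x \<in> {0..1} \<Longrightarrow> \<bar>(Q ^^ n) f x - (LINT y|\<nu>. f y)\<bar> \<le> \<kappa> * \<rho> ^ n * B"
    using oscillation_decay[OF assms(1,2)] by blast
  fix A assume A: "A \<in> sets \<nu>'"
  let ?f = "indicator A :: real \<Rightarrow> real"
  have f: "?f \<in> bounded_borel"
    by (rule bounded_borelI[where B=1]) (use A sp' in \<open>auto simp: indicator_def\<close>)
  have f1: "\<bar>?f y\<bar> \<le> 1" for y by (simp add: indicator_def)
  have "\<bar>measure \<nu>' A - measure \<nu> A\<bar> \<le> 2 * \<kappa> * \<rho> ^ n" for n
    using dec[OF f f1 \<nu>, of 0 n] dec[OF f f1 \<nu>', of 0 n] sets.sets_into_space[OF A] sp(3) sp'(3)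
    by (simp add: Int_absorb2)
  moreover have "(\<lambda>n. 2 * \<kappa> * \<rho> ^ n) \<longlonglongrightarrow> 2 * \<kappa> * 0"
    using \<kappa> by (intro tendsto_intros LIMSEQ_realpow_zero) auto
  ultimately have "\<bar>measure \<nu>' A - measure \<nu> A\<bar> \<le> 2 * \<kappa> * 0"
    by (intro LIMSEQ_le_const[where X="\<lambda>n. 2 * \<kappa> * \<rho> ^ n"]) auto
  then show "emeasure \<nu>' A = emeasure \<nu> A" by (simp add: N.emeasure_eq_measure N'.emeasure_eq_measure)
qed

text \<open>Real and imaginary parts are estimated separately, whence the factor 2; the Hoelder norm
  enters as a bound for the sup norm.\<close>

lemma geometric_ergodicity:
  assumes "p 0 < 1" "q 1 < 1" and \<nu>: "DF_invariant p q \<nu>" and \<alpha>: "0 < \<alpha>"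
  shows "\<exists>\<kappa>>0. \<exists>\<rho>. 0 \<le> \<rho> \<and> \<rho> < 1 \<and>
     (\<forall>\<phi>::real \<Rightarrow> complex. \<phi> \<in> holder \<alpha> \<longrightarrow> (\<forall>x\<in>{0..1}. \<forall>n.
        norm ((Q ^^ n) \<phi> x - (LINT y|\<nu>. \<phi> y)) \<le> \<kappa> * \<rho> ^ n * holder_norm \<alpha> \<phi>))"
proof -
  note sp = invariant_space[OF \<nu>]
  obtain \<kappa> \<rho> where \<kappa>: "0 < \<kappa>" "0 < \<rho>" "\<rho> < (1::real)"
    and dec: "\<And>(f :: real \<Rightarrow> real) B \<nu> n x. f \<in> bounded_borel \<Longrightarrow> (\<And>y. y \<in> {0..1} \<Longrightarrow> \<bar>f y\<bar> \<le> B) \<Longrightarrow>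
       DF_invariant p q \<nu> \<Longrightarrow> x \<in> {0..1} \<Longrightarrow> \<bar>(Q ^^ n) f x - (LINT y|\<nu>. f y)\<bar> \<le> \<kappa> * \<rho> ^ n * B"
    using oscillation_decay[OF assms(1,2)] by blast
  have "norm ((Q ^^ n) \<phi> x - (LINT y|\<nu>. \<phi> y)) \<le> (2 * \<kappa>) * \<rho> ^ n * holder_norm \<alpha> \<phi>"
    if \<phi>: "\<phi> \<in> holder \<alpha>" and x: "x \<in> {0..1}" for \<phi> :: "real \<Rightarrow> complex" and x n
  proof -
    note bb = bounded_borel_continuous[OF holder_continuous_on[OF \<phi> \<alpha>]]
    note int = integrable_bounded_borel[OF sp(1,2) bb]
    have part: "\<bar>T ((Q ^^ n) \<phi> x - (LINT y|\<nu>. \<phi> y))\<bar> \<le> \<kappa> * \<rho> ^ n * holder_norm \<alpha> \<phi>"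
      if T: "bounded_linear T" "\<And>z. \<bar>T z\<bar> \<le> norm z" for T :: "complex \<Rightarrow> real"
    proof -
      have "T ((Q ^^ n) \<phi> x - (LINT y|\<nu>. \<phi> y)) = (Q ^^ n) (\<lambda>y. T (\<phi> y)) x - (LINT y|\<nu>. T (\<phi> y))"
        by (simp only: Qn_bounded_linear[OF x bb T(1)] integral_bounded_linear[OF T(1) int]
            linear_diff[OF bounded_linear.linear[OF T(1)]])
      also have "\<bar>\<dots>\<bar> \<le> \<kappa> * \<rho> ^ n * holder_norm \<alpha> \<phi>"
        by (rule dec[OF bounded_borel_bounded_linear[OF T(1) bb] _ \<nu> x])
          (rule order_trans[OF T(2) norm_le_holder_norm[OF \<phi> \<alpha>]])
      finally show ?thesis .
    qed
    show ?thesis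
      using cmod_le[of "(Q ^^ n) \<phi> x - (LINT y|\<nu>. \<phi> y)"] part[OF bounded_linear_Re abs_Re_le_cmod]
        part[OF bounded_linear_Im abs_Im_le_cmod] by simp
  qed
  then show ?thesis using \<kappa>(1,3) less_imp_le[OF \<kappa>(2)] by (intro exI[of _ "2 * \<kappa>"] conjI[OF _ exI[of _ \<rho>]]) auto
qed

end

section \<open>The invariant density\<close>

text \<open>The integrands to come may blow up at 0 and 1, so the fundamental theorem of calculus is
  applied on compact subintervals; monotone convergence extends a uniform bound.\<close>

lemma nn_integral_exhaust_interval:
  fixes w :: "real \<Rightarrow> ennreal"
  assumes w [measurable]: "w \<in> borel_measurable borel" and ab: "a < b"
    and K: "\<And>c d. a < c \<Longrightarrow> c \<le> d \<Longrightarrow> d < b \<Longrightarrow> (\<integral>\<^sup>+x. w x * indicator {c..d} x \<partial>lborel) \<le> K"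
  shows "(\<integral>\<^sup>+x. w x * indicator {a<..<b} x \<partial>lborel) \<le> K"
proof -
  \<comment> \<open>The offset 2 keeps \<open>e n\<close> at most half of the length, so the
    endpoints of \<open>A n\<close> are in the right order.\<close>
  define e where "e n = (b - a) / real (n + 2)" for n
  define A where "A n = {a + e n..b - e n}" for n
  have pos: "0 < e n" "e n \<le> (b - a) / 2" for n
    unfolding e_def using ab by simp (rule divide_left_mono, use ab in auto)
  have "incseq A"
  proof (rule incseq_SucI)
    fix n
    have "e (Suc n) \<le> e n" unfolding e_def using ab by (intro divide_left_mono) auto
    then show "A n \<subseteq> A (Suc n)" unfolding A_def by auto
  qed
  moreover have "(\<Union>n. A n) = {a<..<b}"
  proof (intro equalityI subsetI)
    fix x assume x: "x \<in> {a<..<b}"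
    have "e \<longlonglongrightarrow> 0"
      unfolding e_def
      by (rule tendsto_divide_0[OF tendsto_const]) (rule filterlim_at_top_imp_at_infinity, 
        rule filterlim_compose[OF filterlim_real_sequentially filterlim_add_const_nat_at_top])
    moreover have "0 < min (x - a) (b - x)" using x by auto
    ultimately have "eventually (\<lambda>n. e n < min (x - a) (b - x)) sequentially"
      by (rule order_tendstoD)
    then obtain n where "e n < min (x - a) (b - x)"
      by (auto simp: eventually_sequentially)
    then have "x \<in> A n" by (simp add: A_def)
    then show "x \<in> (\<Union>n. A n)" by blast
  next
    fix x assume "x \<in> (\<Union>n. A n)"
    then obtain n where "x \<in> A n" by blast
    then show "x \<in> {a<..<b}" using pos(1)[of n] unfolding A_def by auto
  qed
  moreover have "range A \<subseteq> sets (density lborel w)" by (auto simp: A_def)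
  ultimately have "emeasure (density lborel w) {a<..<b} = (SUP n. emeasure (density lborel w) (A n))"
    using SUP_emeasure_incseq[of A "density lborel w"] by simp
  also have "\<dots> \<le> K"
  proof (rule SUP_least)
    fix n
    have "(\<integral>\<^sup>+x. w x * indicator (A n) x \<partial>lborel) \<le> K"
      using pos[of n] unfolding A_def by (intro K; simp)
    then show "emeasure (density lborel w) (A n) \<le> K" by (simp add: emeasure_density A_def)
  qed
  finally show ?thesis by (simp add: emeasure_density)
qed

text \<open>Real-valued counterpart, with base point 1/2, of the extended integrals in the density
  formula.\<close>

definition primitive :: "(real \<Rightarrow> real) \<Rightarrow> real \<Rightarrow> real" where
  "primitive k x = (LBINT y=ereal (1 / 2)..ereal x. k y)"

lemma primitive_deriv:
  assumes k: "continuous_on {0<..<1} k" and x: "0 < x" "x < 1"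
  shows "(primitive k has_real_derivative k x) (at x)"
proof -
  \<comment> \<open>A compact interval inside (0, 1) that contains the base point 1/2 and has
    \<open>x\<close> in its interior, so that the one-sided form of the derivative becomes
    two-sided.\<close>
  define a where "a = min x (1 / 2) / 2"
  define b where "b = (1 + max x (1 / 2)) / 2"
  have ab: "0 < a" "b < 1" "a < x" "x < b" "a \<le> 1 / 2" "1 / 2 \<le> b" using x by (auto simp: a_def b_def)
  have "((\<lambda>u. LBINT y=ereal (1 / 2)..ereal u. k y) has_vector_derivative k x) (at x within {a..b})"
    by (rule interval_integral_FTC2) (use ab in \<open>auto intro: continuous_on_subset[OF k]\<close>)
  moreover have "at x within {a..b} = at x"
    by (rule at_within_interior) (use ab in auto)
  ultimately show ?thesis
    by (simp add: primitive_def[abs_def] has_real_derivative_iff_has_vector_derivative)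
qed

lemma set_integrable_Icc:
  assumes "continuous_on {0<..<1} k" "0 < a" "b < 1"
  shows "set_integrable lborel {a..b} (k :: real \<Rightarrow> real)"
  unfolding set_integrable_def
  by (rule borel_integrable_compact) (use assms in \<open>auto intro: continuous_on_subset\<close>)

lemma enn2ereal_nn_integral_Icc:
  assumes k: "continuous_on {0<..<1} k" "\<And>y. 0 < y \<Longrightarrow> y < 1 \<Longrightarrow> 0 \<le> k y" and ab: "0 < a" "a \<le> b" "b < 1"
  shows "enn2ereal (\<integral>\<^sup>+y\<in>{a..b}. ennreal (k y) \<partial>lborel) = ereal (LBINT y=ereal a..ereal b. k y)"
proof -
  have "(\<integral>\<^sup>+y\<in>{a..b}. ennreal (k y) \<partial>lborel) = (\<integral>\<^sup>+y. ennreal (indicator {a..b} y *\<^sub>R k y) \<partial>lborel)"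
    by (intro nn_integral_cong) (simp add: indicator_def)
  also have "\<dots> = ennreal (LINT y|lborel. indicator {a..b} y *\<^sub>R k y)"
    by (rule nn_integral_eq_integral[OF set_integrable_Icc[OF k(1) ab(1,3), unfolded set_integrable_def]])
      (use k ab in \<open>auto simp: indicator_def intro!: AE_I2\<close>)
  also have "(LINT y|lborel. indicator {a..b} y *\<^sub>R k y) = (LBINT y=ereal a..ereal b. k y)"
    using interval_integral_Icc[OF ab(2), of k] by (simp add: set_lebesgue_integral_def)
  finally have eq: "(\<integral>\<^sup>+y\<in>{a..b}. ennreal (k y) \<partial>lborel) = ennreal (LBINT y=ereal a..ereal b. k y)" .
  have "0 \<le> (LBINT y=ereal a..ereal b. k y)"
    unfolding interval_integral_Icc[OF ab(2)] set_lebesgue_integral_def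
    by (rule Bochner_Integration.integral_nonneg) (use k ab in \<open>auto simp: indicator_def\<close>)
  then show ?thesis unfolding eq by (simp add: enn2ereal_ennreal)
qed

lemma ext_integral_eq_primitive:
  assumes k: "continuous_on {0<..<1} k" "\<And>y. 0 < y \<Longrightarrow> y < 1 \<Longrightarrow> 0 \<le> k y" and x: "0 < x" "x < 1"
  shows "ext_integral (1 / 2) x k = ereal (primitive k x)" "ext_integral x (1 / 2) k = ereal (- primitive k x)"
proof -
  have r: "(LBINT y=ereal x..ereal (1 / 2). k y) = - primitive k x"
    unfolding primitive_def by (rule interval_integral_endpoints_reverse)
  show "ext_integral (1 / 2) x k = ereal (primitive k x)"
  proof (cases "1 / 2 \<le> x")
    case True
    then show ?thesis using enn2ereal_nn_integral_Icc[OF k _ True x(2)] by (simp add: ext_integral_def primitive_def)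
  next
    case False
    then show ?thesis using enn2ereal_nn_integral_Icc[OF k x(1), of "1 / 2"] r by (simp add: ext_integral_def)
  qed
  show "ext_integral x (1 / 2) k = ereal (- primitive k x)"
  proof (cases "x \<le> 1 / 2")
    case True
    then show ?thesis using enn2ereal_nn_integral_Icc[OF k x(1) True] r by (simp add: ext_integral_def)
  next
    case False
    then show ?thesis using enn2ereal_nn_integral_Icc[OF k, of "1 / 2" x] x by (simp add: ext_integral_def primitive_def)
  qed
qed

section \<open>The candidate density and its dual equation\<close>

locale regular_weights = weights +
  assumes p0: "p 0 < 1" and q1: "q 1 < 1"
begin

abbreviation kp :: "real \<Rightarrow> real" where "kp \<equiv> \<lambda>y. p y / y"
abbreviation kq :: "real \<Rightarrow> real" where "kq \<equiv> \<lambda>y. q y / (1 - y)"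

lemma continuous_kp: "continuous_on {0<..<1} kp" and continuous_kq: "continuous_on {0<..<1} kq"
  by (intro continuous_intros continuous_on_subset[OF continuous_p] continuous_on_subset[OF continuous_q]; force)+

lemma kp_nonneg: "0 < y \<Longrightarrow> y < 1 \<Longrightarrow> 0 \<le> kp y" and kq_nonneg: "0 < y \<Longrightarrow> y < 1 \<Longrightarrow> 0 \<le> kq y"
  using p_nonneg q_nonneg by auto

text \<open>p + q = 1 in terms of the two kernels: the algebra behind both derivative identities and
  behind conservation of mass.\<close>

lemma kp_kq: "0 < x \<Longrightarrow> x < 1 \<Longrightarrow> x * kp x + (1 - x) * kq x = 1"
  using q_eq[of x] by simp

text \<open>The density before normalization, equal to 1 at x = 1/2.\<close>

definition f :: "real \<Rightarrow> real" where "f x = exp (primitive kq x - primitive kp x)"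

lemma f_pos: "0 < f x" by (simp add: f_def)

lemma f_kp_nonneg: "0 < x \<Longrightarrow> x < 1 \<Longrightarrow> 0 \<le> f x * kp x"
  and f_kq_nonneg: "0 < x \<Longrightarrow> x < 1 \<Longrightarrow> 0 \<le> f x * kq x"
  by (intro mult_nonneg_nonneg less_imp_le[OF f_pos] kp_nonneg kq_nonneg; assumption)+

lemma f_deriv:
  assumes "0 < x" "x < 1"
  shows "(f has_real_derivative f x * (kq x - kp x)) (at x)"
  unfolding f_def[abs_def]
  by (rule derivative_eq_intros primitive_deriv continuous_kp continuous_kq assms refl)+

lemma continuous_f: "continuous_on {0<..<1} f"
  by (rule DERIV_continuous_on) (use f_deriv in \<open>auto intro: DERIV_subset\<close>)

lemma DF_density_eq:
  assumes "0 < x" "x < 1" "0 < C" shows "DF_density p q C x = ennreal (C * f x)"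
proof -
  have "ext_integral (1 / 2) x kq = ereal (primitive kq x)"
    by (rule ext_integral_eq_primitive(1)[OF continuous_kq kq_nonneg assms(1,2)])
  moreover have "ext_integral x (1 / 2) kp = ereal (- primitive kp x)"
    by (rule ext_integral_eq_primitive(2)[OF continuous_kp kp_nonneg assms(1,2)])
  ultimately show ?thesis
    unfolding DF_density_def using assms(3) by (simp only:) (simp add: f_def ennreal_mult')
qed

text \<open>Extended nonnegative versions, cut off to the open interval, so that Tonelli's theorem
  applies on the whole line. \<open>fp x\<close> and \<open>fq x\<close> are the densities with
  which the mass at \<open>x\<close> is spread uniformly below and above \<open>x\<close>.\<close>

definition fe :: "real \<Rightarrow> ennreal" where "fe x = ennreal (indicator {0<..<1} x *\<^sub>R f x)"
definition fp :: "real \<Rightarrow> ennreal" where "fp x = ennreal (indicator {0<..<1} x *\<^sub>R (f x * kp x))"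
definition fq :: "real \<Rightarrow> ennreal" where "fq x = ennreal (indicator {0<..<1} x *\<^sub>R (f x * kq x))"

lemma measurable_fe [measurable]: "fe \<in> borel_measurable borel"
  and measurable_fp [measurable]: "fp \<in> borel_measurable borel"
  and measurable_fq [measurable]: "fq \<in> borel_measurable borel"
  unfolding fe_def[abs_def] fp_def[abs_def] fq_def[abs_def]
  by (intro measurable_compose[OF borel_measurable_continuous_on_indicator measurable_ennreal]
      continuous_on_mult continuous_f continuous_kp continuous_kq; simp)+

text \<open>The identities \<open>(x f)' = f q / (1 - x)\<close> and \<open>((1 - x) f)' = - f p / x\<close> bound both terms of the dual
  operator applied to \<open>f\<close>.\<close>

lemma nn_integral_fq_le:
  assumes y: "0 < y" "y < 1"
  shows "(\<integral>\<^sup>+x. fq x * indicator {0<..<y} x \<partial>lborel) \<le> ennreal (y * f y)"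
proof (rule nn_integral_exhaust_interval[OF measurable_fq y(1)])
  have D: "((\<lambda>x. x * f x) has_real_derivative f x * kq x) (at x)" if "0 < x" "x < 1" for x
  proof -
    have "f x + x * (f x * (kq x - kp x)) = f x * kq x"
      using kp_kq[OF that] by algebra
    then show ?thesis using DERIV_mult[OF DERIV_ident f_deriv[OF that]] by (simp add: mult_ac add.commute)
  qed
  fix c d :: real assume cd: "0 < c" "c \<le> d" "d < y"
  have "(\<integral>\<^sup>+x. fq x * indicator {c..d} x \<partial>lborel)
      = (\<integral>\<^sup>+x. ennreal (indicator {0<..<1} x *\<^sub>R (f x * kq x)) * indicator {c..d} x \<partial>lborel)" by (simp add: fq_def)
  also have "\<dots> = ennreal (d * f d - c * f c)"
  proof (rule nn_integral_FTC_Icc[where F="\<lambda>x. x * f x"])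
    show "(\<lambda>x. indicator {0<..<1} x *\<^sub>R (f x * kq x)) \<in> borel_measurable borel"
      by (intro borel_measurable_continuous_on_indicator continuous_on_mult continuous_f continuous_kq) simp
    show "((\<lambda>x. x * f x) has_real_derivative indicator {0<..<1} x *\<^sub>R (f x * kq x)) (at x)"
      "0 \<le> indicator {0<..<1} x *\<^sub>R (f x * kq x)" if "x \<in> {c..d}" for x
      using D[of x] f_kq_nonneg[of x] that cd y by simp_all
  qed (rule cd)
  also have "\<dots> \<le> ennreal (y * f y)"
  proof (rule ennreal_leI)
    \<comment> \<open>\<open>x * f x\<close> is nondecreasing, so \<open>d\<close> can be moved up
      to \<open>y\<close>; the term at \<open>c\<close> is dropped by its sign, without computing
      its limit at 0.\<close>
    have "d * f d \<le> y * f y"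
      by (rule DERIV_nonneg_imp_nondecreasing[where f="\<lambda>x. x * f x"])
        (use cd y in \<open>auto intro!: exI[of _ "f _ * kq _"] D mult_nonneg_nonneg less_imp_le[OF f_pos] kq_nonneg\<close>)
    moreover have "0 \<le> c * f c" using cd f_pos[of c] by simp
    ultimately show "d * f d - c * f c \<le> y * f y" by linarith
  qed
  finally show "(\<integral>\<^sup>+x. fq x * indicator {c..d} x \<partial>lborel) \<le> ennreal (y * f y)" .
qed

lemma nn_integral_fp_le:
  assumes y: "0 < y" "y < 1"
  shows "(\<integral>\<^sup>+x. fp x * indicator {y<..<1} x \<partial>lborel) \<le> ennreal ((1 - y) * f y)"
proof (rule nn_integral_exhaust_interval[OF measurable_fp y(2)])
  \<comment> \<open>The sign is chosen to make the derivative nonnegative, as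
    \<open>nn_integral_FTC_Icc\<close> requires.\<close>
  have D: "((\<lambda>x. (x - 1) * f x) has_real_derivative f x * kp x) (at x)" if "0 < x" "x < 1" for x
  proof -
    have "f x + (x - 1) * (f x * (kq x - kp x)) = f x * kp x"
      using kp_kq[OF that] by algebra
    moreover have "((\<lambda>x. x - 1) has_real_derivative 1) (at x)" by (auto intro!: derivative_eq_intros)
    ultimately show ?thesis using DERIV_mult[OF _ f_deriv[OF that], of "\<lambda>x. x - 1" 1] by (simp add: mult_ac add.commute)
  qed
  fix c d :: real assume cd: "y < c" "c \<le> d" "d < 1"
  have "(\<integral>\<^sup>+x. fp x * indicator {c..d} x \<partial>lborel)
      = (\<integral>\<^sup>+x. ennreal (indicator {0<..<1} x *\<^sub>R (f x * kp x)) * indicator {c..d} x \<partial>lborel)" by (simp add: fp_def)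
  also have "\<dots> = ennreal ((d - 1) * f d - (c - 1) * f c)"
  proof (rule nn_integral_FTC_Icc[where F="\<lambda>x. (x - 1) * f x"])
    show "(\<lambda>x. indicator {0<..<1} x *\<^sub>R (f x * kp x)) \<in> borel_measurable borel"
      by (intro borel_measurable_continuous_on_indicator continuous_on_mult continuous_f continuous_kp) simp
    show "((\<lambda>x. (x - 1) * f x) has_real_derivative indicator {0<..<1} x *\<^sub>R (f x * kp x)) (at x)"
      "0 \<le> indicator {0<..<1} x *\<^sub>R (f x * kp x)" if "x \<in> {c..d}" for x
      using D[of x] f_kp_nonneg[of x] that cd y by simp_all
  qed (rule cd)
  also have "\<dots> \<le> ennreal ((1 - y) * f y)"
  proof (rule ennreal_leI)
    have "(y - 1) * f y \<le> (c - 1) * f c"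
      by (rule DERIV_nonneg_imp_nondecreasing[where f="\<lambda>x. (x - 1) * f x"])
        (use cd y in \<open>auto intro!: exI[of _ "f _ * kp _"] D mult_nonneg_nonneg less_imp_le[OF f_pos] kp_nonneg\<close>)
    moreover have "0 \<le> (1 - d) * f d" using cd f_pos[of d] by simp
    ultimately show "(d - 1) * f d - (c - 1) * f c \<le> (1 - y) * f y" by (simp add: algebra_simps)
  qed
  finally show "(\<integral>\<^sup>+x. fp x * indicator {c..d} x \<partial>lborel) \<le> ennreal ((1 - y) * f y)" .
qed

text \<open>Both endpoint hypotheses enter: near 0 the weight \<open>q\<close> is at least
  \<open>c\<close>, so \<open>f\<close> is bounded by \<open>fq\<close> divided by \<open>c\<close>,
  and near 1 \<open>fp\<close> plays this role; both have finite integrals there. In the middle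
  \<open>f\<close> is bounded by compactness.\<close>

lemma nn_integral_fe_finite: "(\<integral>\<^sup>+x. fe x \<partial>lborel) < \<infinity>"
proof -
  obtain c d where c: "0 < c" "c \<le> 1 / 2" and d: "0 < d" "d \<le> 1 / 4"
    and pc: "\<And>y. y \<in> {0..1} \<Longrightarrow> 1 - d \<le> y \<Longrightarrow> c \<le> p y"
    and qc: "\<And>y. y \<in> {0..1} \<Longrightarrow> y \<le> d \<Longrightarrow> c \<le> q y"
    using weights_bounded_below[OF p0 q1] by blast
  have cpt: "compact (f ` {d..1 - d})"
    by (rule compact_continuous_image) (use d in \<open>auto intro: continuous_on_subset[OF continuous_f]\<close>)
  then obtain B where B: "\<And>x. x \<in> {d..1 - d} \<Longrightarrow> \<bar>f x\<bar> \<le> B"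
    using compact_imp_bounded[OF cpt] unfolding bounded_iff real_norm_def by blast
  let ?u = "\<lambda>x. ennreal (1 / c) * (fq x * indicator {0<..<d} x) + ennreal B * indicator {d..1 - d} x
      + ennreal (1 / c) * (fp x * indicator {1 - d<..<1} x)"
  have le: "fe x \<le> ?u x" for x
  proof -
    consider "x \<le> 0 \<or> 1 \<le> x" | "0 < x" "x < d" | "d \<le> x" "x \<le> 1 - d" | "1 - d < x" "x < 1" by linarith
    then show ?thesis
    proof cases
      case 2
      have "c * (1 - x) \<le> c" using c 2 by (intro mult_left_le) auto
      also have "c \<le> q x" using qc[of x] 2 d by auto
      finally have "c * (1 - x) \<le> q x" .
      then have "1 \<le> 1 / c * kq x" using c 2 d by (simp add: field_simps)
      then have "f x * 1 \<le> f x * (1 / c * kq x)" by (intro mult_left_mono less_imp_le[OF f_pos])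
      then have "ennreal (f x) \<le> ennreal (1 / c * (f x * kq x))" by (intro ennreal_leI) (simp add: mult_ac)
      also have "\<dots> = ennreal (1 / c) * ennreal (f x * kq x)" using c by (intro ennreal_mult') simp
      finally have "fe x \<le> ennreal (1 / c) * fq x" using 2 d by (simp add: fe_def fq_def)
      then show ?thesis using 2 d by (simp add: add_increasing2)
    next
      case 3
      have "fe x \<le> ennreal B" using B[of x] 3 d by (auto simp: fe_def intro!: ennreal_leI)
      then show ?thesis using 3 by simp
    next
      case 4
      have "c * x \<le> c" using c 4 by (intro mult_left_le) auto
      also have "c \<le> p x" using pc[of x] 4 d by auto
      finally have "c * x \<le> p x" .
      then have "1 \<le> 1 / c * kp x" using c 4 d by (simp add: field_simps)
      then have "f x * 1 \<le> f x * (1 / c * kp x)" by (intro mult_left_mono less_imp_le[OF f_pos])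
      then have "ennreal (f x) \<le> ennreal (1 / c * (f x * kp x))" by (intro ennreal_leI) (simp add: mult_ac)
      also have "\<dots> = ennreal (1 / c) * ennreal (f x * kp x)" using c by (intro ennreal_mult') simp
      finally have "fe x \<le> ennreal (1 / c) * fp x" using 4 d by (simp add: fe_def fp_def)
      then show ?thesis using 4 d by simp
    qed (auto simp: fe_def)
  qed
  have "(\<integral>\<^sup>+x. fe x \<partial>lborel) \<le> (\<integral>\<^sup>+x. ?u x \<partial>lborel)" by (intro nn_integral_mono le)
  also have "\<dots> = ennreal (1 / c) * (\<integral>\<^sup>+x. fq x * indicator {0<..<d} x \<partial>lborel)
      + ennreal B * (\<integral>\<^sup>+x. indicator {d..1 - d} x \<partial>lborel)
      + ennreal (1 / c) * (\<integral>\<^sup>+x. fp x * indicator {1 - d<..<1} x \<partial>lborel)"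
    by (simp add: nn_integral_add nn_integral_cmult)
  also have "\<dots> < \<infinity>"
    using order.strict_trans1[OF nn_integral_fq_le[of d] ennreal_less_top]
      order.strict_trans1[OF nn_integral_fp_le[of "1 - d"] ennreal_less_top] d
    by (simp add: ennreal_mult_less_top)
  finally show ?thesis .
qed

text \<open>The dual operator applied to \<open>f\<close>: the mass that reaches \<open>y\<close> by
  going down from the right or up from the left.\<close>

definition G :: "real \<Rightarrow> ennreal" where
  "G y = (\<integral>\<^sup>+x. fp x * indicator {y<..<1} x \<partial>lborel) + (\<integral>\<^sup>+x. fq x * indicator {0<..<y} x \<partial>lborel)"

lemma measurable_G [measurable]: "G \<in> borel_measurable borel"
proof -
  \<comment> \<open>Conditions in place of indicators of intervals depending on \<open>y\<close> let
    joint measurability be found automatically.\<close>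
  have "G = (\<lambda>y. (\<integral>\<^sup>+x. fp x * (if y < x \<and> x < 1 then 1 else 0) \<partial>lborel)
      + (\<integral>\<^sup>+x. fq x * (if 0 < x \<and> x < y then 1 else 0) \<partial>lborel))"
    unfolding G_def by (intro ext arg_cong2[where f="(+)"] nn_integral_cong) (auto simp: indicator_def)
  then show ?thesis by simp
qed

text \<open>Tonelli's theorem on the triangles y < x and x < y. A test function for \<open>F\<close>
  expresses duality; F = 1 computes the mass of \<open>G\<close>.\<close>

lemma nn_integral_dual:
  fixes F :: "real \<Rightarrow> ennreal"
  assumes [measurable]: "F \<in> borel_measurable borel"
  shows "(\<integral>\<^sup>+x. (fp x * (\<integral>\<^sup>+y. F y * indicator {0<..<x} y \<partial>lborel)
        + fq x * (\<integral>\<^sup>+y. F y * indicator {x<..<1} y \<partial>lborel)) \<partial>lborel)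
    = (\<integral>\<^sup>+y. F y * (G y * indicator {0<..<1} y) \<partial>lborel)"
proof -
  let ?T = "\<lambda>x y. F y * (fp x * (if 0 < y \<and> y < x \<and> x < 1 then 1 else 0)
      + fq x * (if 0 < x \<and> x < y \<and> y < 1 then 1 else 0))"
  have supp: "fp x = 0" "fq x = 0" if "\<not> (0 < x \<and> x < 1)" for x using that by (auto simp: fp_def fq_def)
  have "(\<integral>\<^sup>+x. (fp x * (\<integral>\<^sup>+y. F y * indicator {0<..<x} y \<partial>lborel)
        + fq x * (\<integral>\<^sup>+y. F y * indicator {x<..<1} y \<partial>lborel)) \<partial>lborel) = (\<integral>\<^sup>+x. \<integral>\<^sup>+y. ?T x y \<partial>lborel \<partial>lborel)"
  proof (rule nn_integral_cong)
    fix x :: real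
    have "fp x * (\<integral>\<^sup>+y. F y * indicator {0<..<x} y \<partial>lborel) + fq x * (\<integral>\<^sup>+y. F y * indicator {x<..<1} y \<partial>lborel)
        = (\<integral>\<^sup>+y. fp x * (F y * indicator {0<..<x} y) + fq x * (F y * indicator {x<..<1} y) \<partial>lborel)"
      by (simp add: nn_integral_add nn_integral_cmult)
    also have "\<dots> = (\<integral>\<^sup>+y. ?T x y \<partial>lborel)"
      using supp[of x] by (intro nn_integral_cong) (auto simp: indicator_def distrib_left mult_ac)
    finally show "fp x * (\<integral>\<^sup>+y. F y * indicator {0<..<x} y \<partial>lborel) + fq x * (\<integral>\<^sup>+y. F y * indicator {x<..<1} y \<partial>lborel)
        = (\<integral>\<^sup>+y. ?T x y \<partial>lborel)" .
  qed
  also have "\<dots> = (\<integral>\<^sup>+y. \<integral>\<^sup>+x. ?T x y \<partial>lborel \<partial>lborel)"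
    by (rule lborel_pair.Fubini'[symmetric]) measurable
  also have "\<dots> = (\<integral>\<^sup>+y. F y * (G y * indicator {0<..<1} y) \<partial>lborel)"
  proof (rule nn_integral_cong)
    fix y :: real
    have "(\<integral>\<^sup>+x. ?T x y \<partial>lborel) = (\<integral>\<^sup>+x. F y * ((fp x * indicator {y<..<1} x
        + fq x * indicator {0<..<y} x) * indicator {0<..<1} y) \<partial>lborel)"
      by (intro nn_integral_cong) (auto simp: indicator_def)
    also have "\<dots> = F y * ((\<integral>\<^sup>+x. fp x * indicator {y<..<1} x
        + fq x * indicator {0<..<y} x \<partial>lborel) * indicator {0<..<1} y)"
      by (simp only: nn_integral_cmult nn_integral_multc measurable_fp measurable_fq measurable_lborel2
          borel_measurable_times_ennreal borel_measurable_add borel_measurable_indicator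
          borel_measurable_const lborelD sets_lborel greaterThanLessThan_borel)
    also have "(\<integral>\<^sup>+x. fp x * indicator {y<..<1} x + fq x * indicator {0<..<y} x \<partial>lborel) = G y"
      unfolding G_def by (rule nn_integral_add) simp_all
    finally show "(\<integral>\<^sup>+x. ?T x y \<partial>lborel) = F y * (G y * indicator {0<..<1} y)" .
  qed
  finally show ?thesis .
qed

text \<open>\<open>G \<le> f\<close> pointwise while both have the same finite integral, because the chain preserves mass.\<close>

lemma G_eq_fe: "AE y in lborel. G y * indicator {0<..<1} y = fe y"
proof -
  let ?G = "\<lambda>y. G y * indicator {0<..<1} y"
  have le: "?G y \<le> fe y" for y
  proof (cases "0 < y \<and> y < 1")
    case True
    then have "G y \<le> ennreal ((1 - y) * f y) + ennreal (y * f y)"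
      unfolding G_def by (intro add_mono nn_integral_fp_le nn_integral_fq_le) auto
    also have "\<dots> = ennreal ((1 - y) * f y + y * f y)"
      using True f_pos[of y] by (intro ennreal_plus[symmetric]) auto
    also have "\<dots> = fe y" using True by (simp add: fe_def algebra_simps)
    finally show ?thesis using True by simp
  qed (auto simp: indicator_def)
  have "(\<integral>\<^sup>+y. ?G y \<partial>lborel) = (\<integral>\<^sup>+x. (fp x * (\<integral>\<^sup>+y. 1 * indicator {0<..<x} y \<partial>lborel)
        + fq x * (\<integral>\<^sup>+y. 1 * indicator {x<..<1} y \<partial>lborel)) \<partial>lborel)"
    by (subst nn_integral_dual) simp_all
  also have "\<dots> = (\<integral>\<^sup>+x. fe x \<partial>lborel)"
  proof (rule nn_integral_cong)
    fix x :: real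
    show "fp x * (\<integral>\<^sup>+y. 1 * indicator {0<..<x} y \<partial>lborel) + fq x * (\<integral>\<^sup>+y. 1 * indicator {x<..<1} y \<partial>lborel) = fe x"
    proof (cases "0 < x \<and> x < 1")
      case True
      have "f x * kp x * x + f x * kq x * (1 - x) = f x" using kp_kq[of x] True by algebra
      moreover have "0 \<le> f x * p x" "0 \<le> f x * q x"
        using True p_nonneg[of x] q_nonneg[of x] f_pos[of x] by auto
      moreover have "0 \<le> f x * kp x" "0 \<le> f x * kq x" using True f_kp_nonneg f_kq_nonneg by blast+
      ultimately show ?thesis using True
        by (simp add: fp_def fq_def fe_def flip: ennreal_mult' ennreal_plus)
    qed (auto simp: fp_def fq_def fe_def)
  qed
  finally have eq: "(\<integral>\<^sup>+y. ?G y \<partial>lborel) = (\<integral>\<^sup>+x. fe x \<partial>lborel)" .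
  \<comment> \<open>Splitting the integral of this difference of extended nonnegative functions
    relies on the finite mass of \<open>?G\<close>.\<close>
  have "(\<integral>\<^sup>+y. fe y - ?G y \<partial>lborel) = (\<integral>\<^sup>+y. fe y \<partial>lborel) - (\<integral>\<^sup>+y. ?G y \<partial>lborel)"
    by (rule nn_integral_diff) (use eq nn_integral_fe_finite le in auto)
  also have "\<dots> = 0" using eq nn_integral_fe_finite by simp
  finally have "AE y in lborel. fe y - ?G y = 0" by (subst (asm) nn_integral_0_iff_AE) auto
  moreover have "fe y < \<infinity>" for y by (simp add: fe_def)
  ultimately show ?thesis
    by (elim eventually_mono) (metis diff_eq_0_iff_ennreal le antisym)
qed

end

section \<open>Normalization and invariance of the density\<close>

context regular_weights
begin

definition C :: real where "C = 1 / enn2real (\<integral>\<^sup>+x. fe x \<partial>lborel)"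

lemma nn_integral_fe_pos: "0 < (\<integral>\<^sup>+x. fe x \<partial>lborel)"
proof (rule ccontr)
  assume "\<not> 0 < (\<integral>\<^sup>+x. fe x \<partial>lborel)"
  then have "AE x in lborel. fe x = 0" by (simp add: nn_integral_0_iff_AE)
  then have "AE x in lborel. \<not> (0 < x \<and> x < (1::real))"
  proof eventually_elim
    case (elim x)
    show ?case
    proof
      assume "0 < x \<and> x < 1"
      with elim have "f x \<le> 0" by (simp add: fe_def ennreal_eq_0_iff)
      then show False using f_pos[of x] by linarith
    qed
  qed
  then have "emeasure lborel {x \<in> space lborel. 0 < x \<and> x < (1::real)} = 0" by (rule emeasure_eq_0_AE)
  moreover have "{x \<in> space lborel. 0 < x \<and> x < (1::real)} = {0<..<1}" by auto
  ultimately show False by simp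
qed

lemma C_pos: "0 < C"
  unfolding C_def using nn_integral_fe_pos nn_integral_fe_finite by (simp add: enn2real_positive_iff)

lemma C_normalizes: "ennreal C * (\<integral>\<^sup>+x. fe x \<partial>lborel) = 1"
proof -
  let ?m = "\<integral>\<^sup>+x. fe x \<partial>lborel"
  have m: "?m = ennreal (enn2real ?m)" using nn_integral_fe_finite by simp
  have pos: "0 < enn2real ?m" using nn_integral_fe_pos nn_integral_fe_finite by (simp add: enn2real_positive_iff)
  have "ennreal C * ?m = ennreal C * ennreal (enn2real ?m)" using m by simp
  also have "\<dots> = ennreal (C * enn2real ?m)" using C_pos by (simp add: ennreal_mult')
  also have "C * enn2real ?m = 1" unfolding C_def using pos by simp
  finally show ?thesis by simp
qed

abbreviation D :: "real \<Rightarrow> ennreal" where "D \<equiv> DF_density p q C"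

lemma D_eq: "0 < x \<Longrightarrow> x < 1 \<Longrightarrow> D x = ennreal C * fe x"
  using DF_density_eq[OF _ _ C_pos] C_pos by (simp add: fe_def ennreal_mult')

lemma measurable_D: "D \<in> borel_measurable unit_lebesgue"
proof -
  \<comment> \<open>The formula may be infinite at the endpoints, so \<open>D\<close> is compared
    with a Borel function adjusted at these two points.\<close>
  let ?D = "\<lambda>x. if x = 0 then D 0 else if x = 1 then D 1 else ennreal C * fe x"
  have "?D \<in> borel_measurable borel" by measurable
  then have "?D \<in> borel_measurable unit_lebesgue" by (intro measurable_restrict_space1) simp
  moreover have "?D x = D x" if "x \<in> space unit_lebesgue" for x
    using that D_eq[of x] by (auto simp: space_restrict_space)
  ultimately show ?thesis using measurable_cong[of unit_lebesgue ?D D] by blast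
qed

definition \<nu> :: "real measure" where "\<nu> = density unit_lebesgue D"

lemma sets_\<nu>: "sets \<nu> = sets unit_borel" and space_\<nu>: "space \<nu> = {0..1}"
  by (simp_all add: \<nu>_def sets_restrict_space space_restrict_space)

text \<open>The endpoints form a null set, so the cut-off function \<open>fe\<close> can replace the
  density formula.\<close>

lemma nn_integral_\<nu>:
  assumes k [measurable]: "k \<in> borel_measurable borel"
  shows "(\<integral>\<^sup>+x. k x \<partial>\<nu>) = ennreal C * (\<integral>\<^sup>+x. fe x * k x \<partial>lborel)"
proof -
  have "k \<in> borel_measurable unit_lebesgue" by (intro measurable_restrict_space1) simp
  then have "(\<integral>\<^sup>+x. k x \<partial>\<nu>) = (\<integral>\<^sup>+x. D x * k x \<partial>unit_lebesgue)"
    unfolding \<nu>_def by (intro nn_integral_density measurable_D)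
  also have "\<dots> = (\<integral>\<^sup>+x. D x * k x * indicator {0..1} x \<partial>lborel)" by (rule nn_integral_restrict_space) simp
  also have "\<dots> = (\<integral>\<^sup>+x. ennreal C * (fe x * k x) \<partial>lborel)"
  proof (rule nn_integral_cong_AE)
    show "AE x in lborel. D x * k x * indicator {0..1} x = ennreal C * (fe x * k x)"
      using AE_lborel_singleton[of 0] AE_lborel_singleton[of 1]
    proof eventually_elim
      case (elim x)
      show ?case
      proof (cases "0 < x \<and> x < 1")
        case True then show ?thesis using D_eq[of x] by (simp add: mult_ac)
      next
        case False then show ?thesis using elim by (auto simp: fe_def indicator_def)
      qed
    qed
  qed
  also have "\<dots> = ennreal C * (\<integral>\<^sup>+x. fe x * k x \<partial>lborel)" by (rule nn_integral_cmult) measurable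
  finally show ?thesis .
qed

lemma prob_space_\<nu>: "prob_space \<nu>"
proof (rule prob_spaceI)
  have "emeasure \<nu> (space \<nu>) = (\<integral>\<^sup>+x. 1 \<partial>\<nu>)" by simp
  also have "\<dots> = 1" by (subst nn_integral_\<nu>) (simp_all add: C_normalizes)
  finally show "emeasure \<nu> (space \<nu>) = 1" .
qed

text \<open>After substitution the two averages are integrals over [0, x] and [x, 1] divided by x
  and 1 - x; multiplying by \<open>f\<close> turns the weights into \<open>fp\<close> and
  \<open>fq\<close>.\<close>

lemma fe_Q_eq:
  fixes \<phi> :: "real \<Rightarrow> real"
  assumes \<phi>: "\<phi> \<in> bounded_borel" "\<And>y. y \<in> {0..1} \<Longrightarrow> 0 \<le> \<phi> y"
    and F_def: "\<And>y. F y = ennreal (indicator {0..1} y *\<^sub>R \<phi> y)"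
  shows "fe x * ennreal (indicator {0..1} x *\<^sub>R Q \<phi> x)
    = fp x * (\<integral>\<^sup>+y. F y * indicator {0<..<x} y \<partial>lborel) + fq x * (\<integral>\<^sup>+y. F y * indicator {x<..<1} y \<partial>lborel)"
proof (cases "0 < x \<and> x < 1")
  case True
  then have x: "0 < x" "x < 1" by auto
  define P where "P = (LINT y:{0..x}|lborel. \<phi> y)"
  define R where "R = (LINT y:{x..1}|lborel. \<phi> y)"
  have nn: "(\<integral>\<^sup>+y. F y * indicator {a<..<b} y \<partial>lborel) = ennreal (LINT y:{a..b}|lborel. \<phi> y)"
    if ab: "0 \<le> a" "b \<le> 1" for a b
  proof -
    have "(\<integral>\<^sup>+y. F y * indicator {a<..<b} y \<partial>lborel) = (\<integral>\<^sup>+y. ennreal (indicator {a..b} y *\<^sub>R \<phi> y) \<partial>lborel)"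
    proof (rule nn_integral_cong_AE)
      show "AE y in lborel. F y * indicator {a<..<b} y = ennreal (indicator {a..b} y *\<^sub>R \<phi> y)"
        using AE_lborel_singleton[of a] AE_lborel_singleton[of b]
        by eventually_elim (use ab in \<open>auto simp: F_def indicator_def\<close>)
    qed
    also have "\<dots> = ennreal (LINT y|lborel. indicator {a..b} y *\<^sub>R \<phi> y)"
      by (rule nn_integral_eq_integral[OF set_integrable_bounded_borel[OF \<phi>(1), unfolded set_integrable_def]])
        (use ab \<phi>(2) in \<open>auto simp: indicator_def intro!: AE_I2\<close>)
    finally show ?thesis by (simp add: set_lebesgue_integral_def)
  qed
  have PR: "0 \<le> P" "0 \<le> R"
    unfolding P_def R_def set_lebesgue_integral_def
    by (rule Bochner_Integration.integral_nonneg, use x \<phi>(2) in \<open>auto simp: indicator_def\<close>)+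
  have "x * (LINT t|unit_lebesgue. \<phi> (t * x)) = P" "(1 - x) * (LINT t|unit_lebesgue. \<phi> (t * x + 1 - t)) = R"
    using unit_mult_LINT_down[of x \<phi>] unit_mult_LINT_up[of x \<phi>] x by (simp_all add: P_def R_def)
  then have "(LINT t|unit_lebesgue. \<phi> (t * x)) = P / x" "(LINT t|unit_lebesgue. \<phi> (t * x + 1 - t)) = R / (1 - x)"
    using x by (simp_all add: field_simps)
  then have "f x * Q \<phi> x = (f x * kp x) * P + (f x * kq x) * R"
    unfolding DF_op_eq by (simp add: distrib_left)
  then have "ennreal (f x * Q \<phi> x) = ennreal (f x * kp x) * ennreal P + ennreal (f x * kq x) * ennreal R"
    using PR f_kp_nonneg[OF x] f_kq_nonneg[OF x]
    by (simp only: ennreal_mult[symmetric] ennreal_plus[symmetric] mult_nonneg_nonneg)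
  moreover have "ennreal (f x * Q \<phi> x) = ennreal (f x) * ennreal (Q \<phi> x)"
    by (rule ennreal_mult') (rule less_imp_le[OF f_pos])
  ultimately show ?thesis
    using x nn[of 0 x] nn[of x 1] by (simp add: fe_def fp_def fq_def P_def R_def)
qed (auto simp: fe_def fp_def fq_def)

text \<open>Duality moves \<open>Q\<close> from the test function to the density, where
  \<open>G_eq_fe\<close> absorbs it.\<close>

lemma nn_integral_Q_\<nu>:
  fixes \<phi> :: "real \<Rightarrow> real"
  assumes \<phi>: "\<phi> \<in> bounded_borel" "\<And>y. y \<in> {0..1} \<Longrightarrow> 0 \<le> \<phi> y"
  shows "(\<integral>\<^sup>+x. ennreal (Q \<phi> x) \<partial>\<nu>) = (\<integral>\<^sup>+x. ennreal (\<phi> x) \<partial>\<nu>)"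
proof -
  define F where "F y = ennreal (indicator {0..1} y *\<^sub>R \<phi> y)" for y
  have Fm [measurable]: "F \<in> borel_measurable borel"
    unfolding F_def by (rule measurable_indicator_bounded_borel[OF \<phi>(1)])
  have "(\<integral>\<^sup>+x. ennreal (Q \<phi> x) \<partial>\<nu>) = (\<integral>\<^sup>+x. ennreal (indicator {0..1} x *\<^sub>R Q \<phi> x) \<partial>\<nu>)"
    by (intro nn_integral_cong) (simp add: space_\<nu>)
  also have "\<dots> = ennreal C * (\<integral>\<^sup>+x. fe x * ennreal (indicator {0..1} x *\<^sub>R Q \<phi> x) \<partial>lborel)"
    by (rule nn_integral_\<nu>[OF measurable_indicator_bounded_borel[OF Q_bounded_borel[OF \<phi>(1)]]])
  also have "\<dots> = ennreal C * (\<integral>\<^sup>+y. F y * (G y * indicator {0<..<1} y) \<partial>lborel)"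
    by (simp only: fe_Q_eq[OF \<phi> F_def] nn_integral_dual[OF Fm])
  also have "(\<integral>\<^sup>+y. F y * (G y * indicator {0<..<1} y) \<partial>lborel) = (\<integral>\<^sup>+y. fe y * F y \<partial>lborel)"
    by (rule nn_integral_cong_AE) (use G_eq_fe in \<open>eventually_elim, simp add: mult.commute\<close>)
  also have "ennreal C * \<dots> = (\<integral>\<^sup>+x. F x \<partial>\<nu>)" by (rule nn_integral_\<nu>[OF Fm, symmetric])
  also have "\<dots> = (\<integral>\<^sup>+x. ennreal (\<phi> x) \<partial>\<nu>)"
    by (intro nn_integral_cong) (simp add: space_\<nu> F_def)
  finally show ?thesis .
qed

lemma LINT_Q_\<nu>:
  fixes \<phi> :: "real \<Rightarrow> real"
  assumes \<phi>: "\<phi> \<in> bounded_borel"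
  shows "(LINT x|\<nu>. Q \<phi> x) = (LINT x|\<nu>. \<phi> x)"
proof -
  interpret prob_space \<nu> by (rule prob_space_\<nu>)
  note int = integrable_bounded_borel[OF prob_space_\<nu> sets_\<nu>]
  have nonneg: "(LINT x|\<nu>. Q \<psi> x) = (LINT x|\<nu>. \<psi> x)"
    if \<psi>: "\<psi> \<in> bounded_borel" "\<And>y. y \<in> {0..1} \<Longrightarrow> 0 \<le> \<psi> y" for \<psi> :: "real \<Rightarrow> real"
  proof -
    have Q0: "0 \<le> Q \<psi> y" if "y \<in> {0..1}" for y
      using Q_mono[OF that bounded_borel_const[of 0] \<psi>] that by (simp add: Q_const)
    have "(LINT x|\<nu>. Q \<psi> x) = enn2real (\<integral>\<^sup>+x. ennreal (Q \<psi> x) \<partial>\<nu>)"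
      by (rule integral_eq_nn_integral[OF borel_measurable_integrable[OF int[OF Q_bounded_borel[OF \<psi>(1)]]]])
        (use Q0 space_\<nu> in \<open>auto intro!: AE_I2\<close>)
    also have "\<dots> = enn2real (\<integral>\<^sup>+x. ennreal (\<psi> x) \<partial>\<nu>)" by (simp only: nn_integral_Q_\<nu>[OF \<psi>])
    also have "\<dots> = (LINT x|\<nu>. \<psi> x)"
      by (rule integral_eq_nn_integral[symmetric, OF borel_measurable_integrable[OF int[OF \<psi>(1)]]])
        (use \<psi>(2) space_\<nu> in \<open>auto intro!: AE_I2\<close>)
    finally show ?thesis .
  qed
  \<comment> \<open>Adding the constant \<open>B\<close> makes the test function nonnegative and
    contributes equally to both sides.\<close>
  obtain B where B: "\<And>y. y \<in> {0..1} \<Longrightarrow> norm (\<phi> y) \<le> B" using \<phi> bounded_borelE by metis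
  note bb = bounded_borel_add[OF \<phi> bounded_borel_const[of B]]
  have "0 \<le> \<phi> y + B" if "y \<in> {0..1}" for y using B[OF that] by (auto simp: abs_le_iff)
  then have "(LINT x|\<nu>. Q (\<lambda>y. \<phi> y + B) x) = (LINT x|\<nu>. \<phi> x + B)" by (rule nonneg[OF bb])
  moreover have "(LINT x|\<nu>. Q (\<lambda>y. \<phi> y + B) x) = (LINT x|\<nu>. Q \<phi> x + B)"
  proof (rule Bochner_Integration.integral_cong[OF refl])
    fix x assume "x \<in> space \<nu>"
    then have x: "x \<in> {0..1}" by (simp only: space_\<nu>)
    show "Q (\<lambda>y. \<phi> y + B) x = Q \<phi> x + B"
      using DF_op_add[OF x \<phi> bounded_borel_const[of B], of p q] by (simp only: Q_const[OF x])
  qed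
  ultimately show ?thesis
    using Bochner_Integration.integral_add[OF int[OF Q_bounded_borel[OF \<phi>]] integrable_const[of B]]
      Bochner_Integration.integral_add[OF int[OF \<phi>] integrable_const[of B]] by simp
qed

lemma invariant_\<nu>: "DF_invariant p q \<nu>"
  unfolding DF_invariant_def
proof (intro conjI allI impI prob_space_\<nu> sets_\<nu>)
  fix \<phi> :: "real \<Rightarrow> complex" assume \<phi>: "\<phi> \<in> bounded_borel"
  note int = integrable_bounded_borel[OF prob_space_\<nu> sets_\<nu>]
  have part: "T (LINT x|\<nu>. Q \<phi> x) = T (LINT x|\<nu>. \<phi> x)" if T: "bounded_linear T" for T :: "complex \<Rightarrow> real"
  proof -
    have "T (LINT x|\<nu>. Q \<phi> x) = (LINT x|\<nu>. T (Q \<phi> x))"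
      by (rule integral_bounded_linear[OF T int[OF Q_bounded_borel[OF \<phi>]], symmetric])
    also have "\<dots> = (LINT x|\<nu>. Q (\<lambda>y. T (\<phi> y)) x)"
      by (rule Bochner_Integration.integral_cong[OF refl])
        (rule DF_op_bounded_linear[OF _ \<phi> T, symmetric], simp only: space_\<nu>)
    also have "\<dots> = (LINT x|\<nu>. T (\<phi> x))" by (rule LINT_Q_\<nu>[OF bounded_borel_bounded_linear[OF T \<phi>]])
    also have "\<dots> = T (LINT x|\<nu>. \<phi> x)" by (rule integral_bounded_linear[OF T int[OF \<phi>]])
    finally show ?thesis .
  qed
  show "(LINT x|\<nu>. Q \<phi> x) = (LINT x|\<nu>. \<phi> x)"
    by (rule complex_eqI) (rule part, rule bounded_linear_Re bounded_linear_Im)+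
qed

end

theorem theorem3p1:
  fixes \<alpha> :: real and p q :: "real \<Rightarrow> real"
  assumes "0 < \<alpha>" and "\<alpha> \<le> 1"
    and "p \<in> {0..1} \<rightarrow> {0..1}"
    and "\<forall>x\<in>{0..1}. q x = 1 - p x"
    and "p \<in> holder \<alpha>" and "q \<in> holder \<alpha>"
  shows
    "(p 0 < 1 \<and> q 1 < 1 \<longrightarrow>
       (\<exists>\<nu>. DF_invariant p q \<nu> \<and> (\<forall>\<nu>'. DF_invariant p q \<nu>' \<longrightarrow> \<nu>' = \<nu>) \<and>
          absolutely_continuous unit_lebesgue \<nu> \<and>
          (\<exists>C>0. \<nu> = density unit_lebesgue (DF_density p q C)) \<and>
          (\<exists>\<kappa>>0. \<exists>\<rho>. 0 \<le> \<rho> \<and> \<rho> < 1 \<and>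
             (\<forall>\<phi>::real \<Rightarrow> complex. \<phi> \<in> holder \<alpha> \<longrightarrow> (\<forall>x\<in>{0..1}. \<forall>n.
                norm ((DF_op p q ^^ n) \<phi> x - (LINT y|\<nu>. \<phi> y)) \<le> \<kappa> * \<rho> ^ n * holder_norm \<alpha> \<phi>)))))
     \<and>
     (p 0 = 1 \<and> q 1 < 1 \<longrightarrow>
       (\<forall>\<nu>. DF_invariant p q \<nu> \<longleftrightarrow> \<nu> = return unit_borel 0) \<and>
       (\<exists>\<kappa>>0. \<exists>\<rho>. 0 \<le> \<rho> \<and> \<rho> < 1 \<and>
          (\<forall>\<phi>::real \<Rightarrow> complex. \<phi> \<in> holder \<alpha> \<longrightarrow> (\<forall>x\<in>{0..1}. \<forall>n.
             norm ((DF_op p q ^^ n) \<phi> x - \<phi> 0) \<le> \<kappa> * \<rho> ^ n * holder_norm \<alpha> \<phi>))))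
     \<and>
     (p 0 < 1 \<and> q 1 = 1 \<longrightarrow>
       (\<forall>\<nu>. DF_invariant p q \<nu> \<longleftrightarrow> \<nu> = return unit_borel 1) \<and>
       (\<exists>\<kappa>>0. \<exists>\<rho>. 0 \<le> \<rho> \<and> \<rho> < 1 \<and>
          (\<forall>\<phi>::real \<Rightarrow> complex. \<phi> \<in> holder \<alpha> \<longrightarrow> (\<forall>x\<in>{0..1}. \<forall>n.
             norm ((DF_op p q ^^ n) \<phi> x - \<phi> 1) \<le> \<kappa> * \<rho> ^ n * holder_norm \<alpha> \<phi>))))
     \<and>
     (p 0 = 1 \<and> q 1 = 1 \<longrightarrow>
       (\<forall>\<nu>. DF_invariant p q \<nu> \<longleftrightarrow>
          sets \<nu> = sets unit_borel \<and>
          (\<exists>s\<in>{0..1}. \<forall>A\<in>sets unit_borel.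
             emeasure \<nu> A = ennreal (1 - s) * emeasure (return unit_borel 0) A
                          + ennreal s * emeasure (return unit_borel 1) A)) \<and>
       (\<exists>h::real \<Rightarrow> complex.
          (h \<in> holder \<alpha> \<and> (\<forall>x\<in>{0..1}. DF_op p q h x = h x) \<and> h 0 = 0 \<and> h 1 = 1) \<and>
          (\<forall>g. g \<in> holder \<alpha> \<and> (\<forall>x\<in>{0..1}. DF_op p q g x = g x) \<and> g 0 = 0 \<and> g 1 = 1
               \<longrightarrow> (\<forall>x\<in>{0..1}. g x = h x)) \<and>
          (\<forall>x\<in>{0..1}. \<forall>(M :: 'w measure) Z. DF_chain p q x M Z \<longrightarrow>
             (\<exists>Zlim. Zlim \<in> borel_measurable M \<and> (\<forall>\<omega>\<in>space M. Zlim \<omega> \<in> {0, 1}) \<and>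
                (AE \<omega> in M. (\<lambda>n. Z n \<omega>) \<longlonglongrightarrow> Zlim \<omega>) \<and>
                complex_of_real (measure M {\<omega> \<in> space M. Zlim \<omega> = 0}) = 1 - h x \<and>
                complex_of_real (measure M {\<omega> \<in> space M. Zlim \<omega> = 1}) = h x)) \<and>
          (\<exists>\<kappa>>0. \<exists>\<rho>. 0 \<le> \<rho> \<and> \<rho> < 1 \<and>
             (\<forall>\<phi>::real \<Rightarrow> complex. \<phi> \<in> holder \<alpha> \<longrightarrow> (\<forall>x\<in>{0..1}. \<forall>n.
                norm ((DF_op p q ^^ n) \<phi> x - (1 - h x) * \<phi> 0 - h x * \<phi> 1)
                  \<le> \<kappa> * \<rho> ^ n * holder_norm \<alpha> \<phi>)))))"
proof -
  interpret H: holder_weights p q \<alpha> "holder_norm \<alpha> p"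
  proof
    show "\<bar>p x - p y\<bar> \<le> holder_norm \<alpha> p * \<bar>x - y\<bar> powr \<alpha>" if "x \<in> {0..1}" "y \<in> {0..1}" for x y
      using holder_norm_diff[OF assms(5,1) that] by simp
  qed (use assms holder_norm_nonneg[OF assms(5,1)] in auto)
  show ?thesis
  proof (intro conjI impI; (elim conjE)?)
    assume p0: "p 0 < 1" and q1: "q 1 < 1"
    interpret regular_weights p q by unfold_locales (fact p0, fact q1)
    show "\<exists>\<nu>. DF_invariant p q \<nu> \<and> (\<forall>\<nu>'. DF_invariant p q \<nu>' \<longrightarrow> \<nu>' = \<nu>) \<and>
          absolutely_continuous unit_lebesgue \<nu> \<and>
          (\<exists>C>0. \<nu> = density unit_lebesgue (DF_density p q C)) \<and>
          (\<exists>\<kappa>>0. \<exists>\<rho>. 0 \<le> \<rho> \<and> \<rho> < 1 \<and>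
             (\<forall>\<phi>::real \<Rightarrow> complex. \<phi> \<in> holder \<alpha> \<longrightarrow> (\<forall>x\<in>{0..1}. \<forall>n.
                norm ((DF_op p q ^^ n) \<phi> x - (LINT y|\<nu>. \<phi> y)) \<le> \<kappa> * \<rho> ^ n * holder_norm \<alpha> \<phi>)))"
    proof (rule exI[of _ \<nu>], intro conjI allI impI)
      show "absolutely_continuous unit_lebesgue \<nu>"
        unfolding \<nu>_def by (rule absolutely_continuousI_density[OF measurable_D])
      show "\<exists>C>0. \<nu> = density unit_lebesgue (DF_density p q C)"
        using C_pos \<nu>_def by blast
    qed (rule invariant_\<nu> H.invariant_unique[OF p0 q1 invariant_\<nu>]
        H.geometric_ergodicity[OF p0 q1 invariant_\<nu> assms(1)]; assumption)+
  next
    assume p0: "p 0 = 1" and q1: "q 1 < 1"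
    obtain W r where W: "W \<in> bounded_borel" "\<And>y. y \<in> {0..1} \<Longrightarrow> 0 \<le> W y" "\<And>y. y \<in> {0..1} \<Longrightarrow> W y \<le> (1::real)"
      "\<And>y. y \<in> {0..1} \<Longrightarrow> y powr \<alpha> \<le> W y" and r: "0 < r" "r < 1"
      and QQ: "\<And>y. y \<in> {0..1} \<Longrightarrow> DF_op p q (DF_op p q W) y \<le> r * W y"
      using H.lyapunov_absorbing_0[OF p0 q1] by blast
    have W0: "\<bar>y - 0\<bar> powr \<alpha> \<le> W y" if "y \<in> {0..1}" for y using W(4)[OF that] that by simp
    note concl = H.absorbing_conclusion[of 0, OF _ H.Q_at_0[OF p0] W(1-3) W0 r QQ, simplified]
    show "\<forall>\<nu>. DF_invariant p q \<nu> \<longleftrightarrow> \<nu> = return unit_borel 0" using concl(1) by blast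
    show "\<exists>\<kappa>>0. \<exists>\<rho>. 0 \<le> \<rho> \<and> \<rho> < 1 \<and>
          (\<forall>\<phi>::real \<Rightarrow> complex. \<phi> \<in> holder \<alpha> \<longrightarrow> (\<forall>x\<in>{0..1}. \<forall>n.
             norm ((DF_op p q ^^ n) \<phi> x - \<phi> 0) \<le> \<kappa> * \<rho> ^ n * holder_norm \<alpha> \<phi>))"
      using concl(2) by simp
  next
    assume p0: "p 0 < 1" and q1: "q 1 = 1"
    obtain W r where W: "W \<in> bounded_borel" "\<And>y. y \<in> {0..1} \<Longrightarrow> 0 \<le> W y" "\<And>y. y \<in> {0..1} \<Longrightarrow> W y \<le> (1::real)"
      "\<And>y. y \<in> {0..1} \<Longrightarrow> (1 - y) powr \<alpha> \<le> W y" and r: "0 < r" "r < 1"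
      and QQ: "\<And>y. y \<in> {0..1} \<Longrightarrow> DF_op p q (DF_op p q W) y \<le> r * W y"
      using H.lyapunov_absorbing_1[OF p0 q1] by blast
    have W1: "\<bar>y - 1\<bar> powr \<alpha> \<le> W y" if "y \<in> {0..1}" for y
      using W(4)[OF that] that by (simp add: abs_minus_commute)
    note concl = H.absorbing_conclusion[of 1, OF _ H.Q_at_1[OF q1] W(1-3) W1 r QQ, simplified]
    show "\<forall>\<nu>. DF_invariant p q \<nu> \<longleftrightarrow> \<nu> = return unit_borel 1" using concl(1) by blast
    show "\<exists>\<kappa>>0. \<exists>\<rho>. 0 \<le> \<rho> \<and> \<rho> < 1 \<and>
          (\<forall>\<phi>::real \<Rightarrow> complex. \<phi> \<in> holder \<alpha> \<longrightarrow> (\<forall>x\<in>{0..1}. \<forall>n.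
             norm ((DF_op p q ^^ n) \<phi> x - \<phi> 1) \<le> \<kappa> * \<rho> ^ n * holder_norm \<alpha> \<phi>))"
      using concl(2) by simp
  next
    assume p0: "p 0 = 1" and q1: "q 1 = 1"
    interpret A: absorbing_weights p q \<alpha> "holder_norm \<alpha> p" by unfold_locales (fact p0, fact q1)
    show "\<forall>\<nu>. DF_invariant p q \<nu> \<longleftrightarrow>
          sets \<nu> = sets unit_borel \<and>
          (\<exists>s\<in>{0..1}. \<forall>A\<in>sets unit_borel.
             emeasure \<nu> A = ennreal (1 - s) * emeasure (return unit_borel 0) A
                          + ennreal s * emeasure (return unit_borel 1) A)"
      using A.invariant_iff by blast
    \<comment> \<open>Uniqueness is claimed among complex-valued functions, so the real function
      \<open>A.h\<close> is embedded.\<close>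
    let ?h = "\<lambda>x. complex_of_real (A.h x)"
    let ?K = "(1 + 2 * A.C\<^sub>u) * A.\<kappa>\<^sub>W"
    have K: "0 < ?K" using A.C\<^sub>u_ge_1 A.\<kappa>\<^sub>W by simp
    have decay: "\<exists>\<kappa>>0. \<exists>\<rho>. 0 \<le> \<rho> \<and> \<rho> < 1 \<and>
             (\<forall>\<phi>::real \<Rightarrow> complex. \<phi> \<in> holder \<alpha> \<longrightarrow> (\<forall>x\<in>{0..1}. \<forall>n.
                norm ((DF_op p q ^^ n) \<phi> x - (1 - ?h x) * \<phi> 0 - ?h x * \<phi> 1)
                  \<le> \<kappa> * \<rho> ^ n * holder_norm \<alpha> \<phi>))"
    proof (rule exI[of _ ?K], rule conjI[OF K], rule exI[of _ A.\<rho>\<^sub>W], intro conjI allI impI ballI)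
      show "0 \<le> A.\<rho>\<^sub>W" "A.\<rho>\<^sub>W < 1" using A.\<rho>\<^sub>W by auto
      show "norm ((DF_op p q ^^ n) \<phi> x - (1 - ?h x) * \<phi> 0 - ?h x * \<phi> 1)
          \<le> ?K * A.\<rho>\<^sub>W ^ n * holder_norm \<alpha> \<phi>" if "\<phi> \<in> holder \<alpha>" "x \<in> {0..1}" for \<phi> x n
        using A.Qn_limit[OF that, of n] by (simp only: of_real_diff of_real_1)
    qed
    have law: "\<exists>Zlim. Zlim \<in> borel_measurable M \<and> (\<forall>\<omega>\<in>space M. Zlim \<omega> \<in> {0, 1}) \<and>
                (AE \<omega> in M. (\<lambda>n. Z n \<omega>) \<longlonglongrightarrow> Zlim \<omega>) \<and>
                complex_of_real (measure M {\<omega> \<in> space M. Zlim \<omega> = 0}) = 1 - ?h x \<and>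
                complex_of_real (measure M {\<omega> \<in> space M. Zlim \<omega> = 1}) = ?h x"
      if "x \<in> {0..1}" "DF_chain p q x M Z" for x and M :: "'w measure" and Z
    proof -
      from A.chain_limit_law[OF that] obtain Y where Y: "Y \<in> borel_measurable M" "\<forall>\<omega>\<in>space M. Y \<omega> \<in> {0, 1}" "AE \<omega> in M. (\<lambda>n. Z n \<omega>) \<longlonglongrightarrow> Y \<omega>"
        and m: "measure M {\<omega> \<in> space M. Y \<omega> = 0} = 1 - A.h x" "measure M {\<omega> \<in> space M. Y \<omega> = 1} = A.h x"
        by blast
      show ?thesis
        by (rule exI[of _ Y], intro conjI Y) (simp_all only: m of_real_diff of_real_1)
    qed
    show "\<exists>h::real \<Rightarrow> complex.
          (h \<in> holder \<alpha> \<and> (\<forall>x\<in>{0..1}. DF_op p q h x = h x) \<and> h 0 = 0 \<and> h 1 = 1) \<and>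
          (\<forall>g. g \<in> holder \<alpha> \<and> (\<forall>x\<in>{0..1}. DF_op p q g x = g x) \<and> g 0 = 0 \<and> g 1 = 1
               \<longrightarrow> (\<forall>x\<in>{0..1}. g x = h x)) \<and>
          (\<forall>x\<in>{0..1}. \<forall>(M :: 'w measure) Z. DF_chain p q x M Z \<longrightarrow>
             (\<exists>Zlim. Zlim \<in> borel_measurable M \<and> (\<forall>\<omega>\<in>space M. Zlim \<omega> \<in> {0, 1}) \<and>
                (AE \<omega> in M. (\<lambda>n. Z n \<omega>) \<longlonglongrightarrow> Zlim \<omega>) \<and>
                complex_of_real (measure M {\<omega> \<in> space M. Zlim \<omega> = 0}) = 1 - h x \<and>
                complex_of_real (measure M {\<omega> \<in> space M. Zlim \<omega> = 1}) = h x)) \<and>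
          (\<exists>\<kappa>>0. \<exists>\<rho>. 0 \<le> \<rho> \<and> \<rho> < 1 \<and>
             (\<forall>\<phi>::real \<Rightarrow> complex. \<phi> \<in> holder \<alpha> \<longrightarrow> (\<forall>x\<in>{0..1}. \<forall>n.
                norm ((DF_op p q ^^ n) \<phi> x - (1 - h x) * \<phi> 0 - h x * \<phi> 1)
                  \<le> \<kappa> * \<rho> ^ n * holder_norm \<alpha> \<phi>)))"
    proof (rule exI[of _ ?h], intro conjI allI ballI impI)
      show "?h \<in> holder \<alpha>" by (rule A.complex_h_holder)
      show "DF_op p q ?h x = ?h x" if "x \<in> {0..1}" for x by (rule A.Q_complex_h[OF that])
      show "?h 0 = 0" "?h 1 = 1" by (simp_all add: A.h_0 A.h_1)
      show "g x = ?h x" if "g \<in> holder \<alpha> \<and> (\<forall>x\<in>{0..1}. DF_op p q g x = g x) \<and> g 0 = 0 \<and> g 1 = 1" "x \<in> {0..1}" for g x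
        using A.harmonic_unique[of g x] that by blast
    qed (fact law | fact decay)+
  qed
qed

end
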